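(* Let $I\subset\Delta^+$ be an $\mathsf{ad}$-nilpotent ideal. Then the number of generators of $I$ equals the codimension (in $V$) of the minimal face of the simplex $\widetilde D$ containing the point $d_I$.
   Context: Let $\Delta$ be the (reduced, irreducible, crystallographic) root system of a simple Lie algebra $\mathfrak g$ of rank $p$, with Weyl group $W$, positive roots $\Delta^+$, simple roots $\Pi=\{\alpha_1,\dots,\alpha_p\}$ and highest root $\theta$. Let $V=\bigoplus_{i=1}^p\mathbb Q\alpha_i$ with a $W$-invariant inner product $(\ ,\ )$; $\mu^\vee=2\mu/(\mu,\mu)$, and $Q^\vee=\bigoplus_i\mathbb Z\alpha_i^\vee\subset V$ is the coroot lattice. An $\mathsf{ad}$-nilpotent ideal is a subset $I\subset\Delta^+$ such that $\gamma\in I$, $\nu\in\Delta^+$, $\gamma+\nu\in\Delta$ imply $\gamma+\nu\in I$ (these are the sets of roots of the ideals of the Borel subalgebra $\mathfrak b$ contained in $[\mathfrak b,\mathfrak b]$). An element $\gamma\in I$ is a generator of $I$ if $\gamma-\alpha\notin I$ for all $\alpha\in\Delta^+$. Affine notation: $\widehat V=V\oplus\mathbb Q\delta\oplus\mathbb Q\lambda$, with $(\ ,\ )$ extended by $(\delta,V)=(\lambda,V)=(\delta,\delta)=(\lambda,\lambda)=0$, $(\delta,\lambda)=1$. Affine real roots: $\widehat\Delta=\{\beta+k\delta\mid\beta\in\Delta,\ k\in\mathbb Z\}$; $\widehat\Delta^+=\Delta^+\cup\{\beta+k\delta\mid\beta\in\Delta,\ k\ge1\}$; simple roots $\widehat\Pi=\Pi\cup\{\alpha_0\}$,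 $\alpha_0=\delta-\theta$. The affine Weyl group $\widehat W$ is generated by the reflections of $\widehat V$ in $\alpha_0,\dots,\alpha_p$. Put $\widehat N(w)=\{\alpha\in\widehat\Delta^+\mid w(\alpha)\in-\widehat\Delta^+\}$. An element $w\in\widehat W$ is admissible if (a) $w(\alpha)\in\widehat\Delta^+$ for all $\alpha\in\Pi$, and (b) whenever $\alpha\in\widehat\Pi$ and $w^{-1}(\alpha)\in-\widehat\Delta^+$, one has $w^{-1}(\alpha)=\gamma-\delta$ for some $\gamma\in\Delta^+$. By Cellini–Papi, $w\mapsto I_w=\{\gamma\in\Delta^+\mid\delta-\gamma\in\widehat N(w)\}$ is a bijection from admissible elements onto $\mathsf{ad}$-nilpotent ideals; its inverse is written $I\mapsto w\langle I\rangle$. $\widehat W$ is the semidirect product of $W$ and $Q^\vee$: each $w\in\widehat W$ is uniquely $w=v_w\cdot t_{r_w}$ with $v_w\in W$, $r_w\in Q^\vee$, where $t_r$ acts on $V\oplus\mathbb Q\delta$ by $t_r(x)=x-(x,r)\delta$. Put $d_w=v_w(r_w)\in Q^\vee$ and $d_I=d_{w\langle I\rangle}$. The simplex is $\widetilde D=\{\tau\in V\mid(\tau,\alpha)\ge-1\ \ \forall\alpha\in\Pi,\ (\tau,\theta)\le2\}$; by Cellini–Papi, $I\mapsto d_I$ is a bijection from the set of $\mathsf{ad}$-nilpotent ideals onto $\widetilde D\cap Q^\vee$. The simplex $\widetilde D$ itself counts as its face of codimension $0$. *)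

theory Defs
  imports "HOL-Analysis.Analysis" "HOL-Algebra.Bij" "HOL-Algebra.Generated_Groups"
begin

section \<open>Root systems in a rational inner product space\<close>

text \<open>
  The rational vector space \<open>V\<close> of dimension \<open>p\<close> is \<^typ>\<open>rat ^ 'n\<close> with \<open>p = CARD('n)\<close>, carrying an
  arbitrary rational inner product \<open>ip\<close>; linear algebra over \<open>\<rat>\<close> is the interpretation \<open>vec\<close>.
  The standard coordinates play no role.
  Throughout, \<open>\<Delta>\<close> is the root system and \<open>S\<close> its set of simple roots.
\<close>

definition inner_product :: "(rat ^ 'n \<Rightarrow> rat ^ 'n \<Rightarrow> rat) \<Rightarrow> bool" where
  "inner_product ip \<longleftrightarrow>
     (\<forall>x y. ip x y = ip y x) \<and>
     (\<forall>x y z. ip (x + y) z = ip x z + ip y z) \<and>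
     (\<forall>c x y. ip (c *s x) y = c * ip x y) \<and>
     (\<forall>x. x \<noteq> 0 \<longrightarrow> ip x x > 0)"

definition coroot :: "(rat ^ 'n \<Rightarrow> rat ^ 'n \<Rightarrow> rat) \<Rightarrow> rat ^ 'n \<Rightarrow> rat ^ 'n" where
  "coroot ip \<mu> = (2 / ip \<mu> \<mu>) *s \<mu>"

definition root_reflection :: "(rat ^ 'n \<Rightarrow> rat ^ 'n \<Rightarrow> rat) \<Rightarrow> rat ^ 'n \<Rightarrow> rat ^ 'n \<Rightarrow> rat ^ 'n" where
  "root_reflection ip \<mu> x = x - ip x (coroot ip \<mu>) *s \<mu>"

text \<open>
  Reduced irreducible crystallographic root systems. The inner product is automatically invariant
  under the Weyl group, as the reflections are the orthogonal reflections for \<open>ip\<close>. \<open>\<Delta>\<close> is nonempty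
  because it spans a space of dimension \<open>CARD('n) \<ge> 1\<close>.
\<close>

definition irreducible_root_system ::
  "(rat ^ 'n::finite \<Rightarrow> rat ^ 'n \<Rightarrow> rat) \<Rightarrow> (rat ^ 'n) set \<Rightarrow> bool" where
  "irreducible_root_system ip \<Delta> \<longleftrightarrow>
     inner_product ip \<and>
     finite \<Delta> \<and> 0 \<notin> \<Delta> \<and> vec.span \<Delta> = UNIV \<and>
     (\<forall>\<alpha>\<in>\<Delta>. root_reflection ip \<alpha> ` \<Delta> = \<Delta>) \<and>
     (\<forall>\<alpha>\<in>\<Delta>. \<forall>\<beta>\<in>\<Delta>. ip \<beta> (coroot ip \<alpha>) \<in> \<int>) \<and>
     (\<forall>\<alpha>\<in>\<Delta>. \<forall>c. c *s \<alpha> \<in> \<Delta> \<longrightarrow> c = 1 \<or> c = -1) \<and>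
     (\<forall>A B. \<Delta> = A \<union> B \<and> (\<forall>\<alpha>\<in>A. \<forall>\<beta>\<in>B. ip \<alpha> \<beta> = 0) \<longrightarrow> A = {} \<or> B = {})"

definition nonneg_comb :: "(rat ^ 'n) set \<Rightarrow> (rat ^ 'n) set" where
  "nonneg_comb S = {\<Sum>\<alpha>\<in>S. of_nat (c \<alpha>) *s \<alpha> | c :: rat ^ 'n \<Rightarrow> nat. True}"

definition simple_system :: "(rat ^ 'n::finite) set \<Rightarrow> (rat ^ 'n) set \<Rightarrow> bool" where
  "simple_system \<Delta> S \<longleftrightarrow>
     S \<subseteq> \<Delta> \<and> vec.independent S \<and> (\<forall>\<beta>\<in>\<Delta>. \<beta> \<in> nonneg_comb S \<or> - \<beta> \<in> nonneg_comb S)"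

definition pos_roots :: "(rat ^ 'n) set \<Rightarrow> (rat ^ 'n) set \<Rightarrow> (rat ^ 'n) set" where
  "pos_roots \<Delta> S = \<Delta> \<inter> nonneg_comb S"

definition highest_root :: "(rat ^ 'n) set \<Rightarrow> (rat ^ 'n) set \<Rightarrow> rat ^ 'n" where
  "highest_root \<Delta> S = (THE \<theta>. \<theta> \<in> \<Delta> \<and> (\<forall>\<beta>\<in>\<Delta>. \<theta> - \<beta> \<in> nonneg_comb S))"

definition weyl_group ::
  "(rat ^ 'n \<Rightarrow> rat ^ 'n \<Rightarrow> rat) \<Rightarrow> (rat ^ 'n) set \<Rightarrow> (rat ^ 'n \<Rightarrow> rat ^ 'n) set" where
  "weyl_group ip S = generate (BijGroup UNIV) (root_reflection ip ` S)"

definition coroot_lattice :: "(rat ^ 'n \<Rightarrow> rat ^ 'n \<Rightarrow> rat) \<Rightarrow> (rat ^ 'n) set \<Rightarrow> (rat ^ 'n) set" where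
  "coroot_lattice ip S = {\<Sum>\<alpha>\<in>S. of_int (c \<alpha>) *s coroot ip \<alpha> | c :: rat ^ 'n \<Rightarrow> int. True}"

definition ad_nilpotent_ideal :: "(rat ^ 'n) set \<Rightarrow> (rat ^ 'n) set \<Rightarrow> (rat ^ 'n) set \<Rightarrow> bool" where
  "ad_nilpotent_ideal \<Delta> S I \<longleftrightarrow>
     I \<subseteq> pos_roots \<Delta> S \<and>
     (\<forall>\<gamma>\<in>I. \<forall>\<nu>\<in>pos_roots \<Delta> S. \<gamma> + \<nu> \<in> \<Delta> \<longrightarrow> \<gamma> + \<nu> \<in> I)"

definition ideal_generators ::
  "(rat ^ 'n) set \<Rightarrow> (rat ^ 'n) set \<Rightarrow> (rat ^ 'n) set \<Rightarrow> (rat ^ 'n) set" where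
  "ideal_generators \<Delta> S I = {\<gamma> \<in> I. \<forall>\<alpha>\<in>pos_roots \<Delta> S. \<gamma> - \<alpha> \<notin> I}"

section \<open>The affine Weyl group\<close>

text \<open>The triple \<open>(x, k, l)\<close> stands for \<open>x + k \<delta> + l \<lambda>\<close>.\<close>

type_synonym 'n affine_vec = "(rat ^ 'n) \<times> rat \<times> rat"

definition affine_form ::
  "(rat ^ 'n::finite \<Rightarrow> rat ^ 'n \<Rightarrow> rat) \<Rightarrow> 'n affine_vec \<Rightarrow> 'n affine_vec \<Rightarrow> rat" where
  "affine_form ip = (\<lambda>(x, k, l) (y, m, n). ip x y + k * n + l * m)"

definition affine_scale :: "rat \<Rightarrow> 'n::finite affine_vec \<Rightarrow> 'n affine_vec" where
  "affine_scale c = (\<lambda>(x, k, l). (c *s x, c * k, c * l))"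

definition affine_reflection ::
  "(rat ^ 'n::finite \<Rightarrow> rat ^ 'n \<Rightarrow> rat) \<Rightarrow> 'n affine_vec \<Rightarrow> 'n affine_vec \<Rightarrow> 'n affine_vec" where
  "affine_reflection ip a x = x - affine_scale (2 * affine_form ip x a / affine_form ip a a) a"

definition affine_pos_roots :: "(rat ^ 'n::finite) set \<Rightarrow> (rat ^ 'n) set \<Rightarrow> 'n affine_vec set" where
  "affine_pos_roots \<Delta> S =
     {(\<beta>, 0, 0) | \<beta>. \<beta> \<in> pos_roots \<Delta> S} \<union> {(\<beta>, of_int k, 0) | \<beta> k. \<beta> \<in> \<Delta> \<and> k \<ge> (1::int)}"

definition affine_simple_roots :: "(rat ^ 'n::finite) set \<Rightarrow> (rat ^ 'n) set \<Rightarrow> 'n affine_vec set" where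
  "affine_simple_roots \<Delta> S = {(\<alpha>, 0, 0) | \<alpha>. \<alpha> \<in> S} \<union> {(- highest_root \<Delta> S, 1, 0)}"

definition affine_weyl_group ::
  "(rat ^ 'n::finite \<Rightarrow> rat ^ 'n \<Rightarrow> rat) \<Rightarrow> (rat ^ 'n) set \<Rightarrow> (rat ^ 'n) set
     \<Rightarrow> ('n affine_vec \<Rightarrow> 'n affine_vec) set" where
  "affine_weyl_group ip \<Delta> S =
     generate (BijGroup UNIV) (affine_reflection ip ` affine_simple_roots \<Delta> S)"

definition inversion_set ::
  "(rat ^ 'n::finite) set \<Rightarrow> (rat ^ 'n) set \<Rightarrow> ('n affine_vec \<Rightarrow> 'n affine_vec) \<Rightarrow> 'n affine_vec set" where
  "inversion_set \<Delta> S w =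
     {a \<in> affine_pos_roots \<Delta> S. w a \<in> uminus ` affine_pos_roots \<Delta> S}"

definition admissible ::
  "(rat ^ 'n::finite \<Rightarrow> rat ^ 'n \<Rightarrow> rat) \<Rightarrow> (rat ^ 'n) set \<Rightarrow> (rat ^ 'n) set
     \<Rightarrow> ('n affine_vec \<Rightarrow> 'n affine_vec) set" where
  "admissible ip \<Delta> S =
     {w \<in> affine_weyl_group ip \<Delta> S.
        (\<forall>\<alpha>\<in>S. w (\<alpha>, 0, 0) \<in> affine_pos_roots \<Delta> S) \<and>
        (\<forall>a\<in>affine_simple_roots \<Delta> S.
           inv_into UNIV w a \<in> uminus ` affine_pos_roots \<Delta> S \<longrightarrow>
             (\<exists>\<gamma>\<in>pos_roots \<Delta> S. inv_into UNIV w a = (\<gamma>, -1, 0)))}"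

definition ideal_of ::
  "(rat ^ 'n::finite) set \<Rightarrow> (rat ^ 'n) set \<Rightarrow> ('n affine_vec \<Rightarrow> 'n affine_vec) \<Rightarrow> (rat ^ 'n) set" where
  "ideal_of \<Delta> S w = {\<gamma> \<in> pos_roots \<Delta> S. (- \<gamma>, 1, 0) \<in> inversion_set \<Delta> S w}"

definition admissible_of ::
  "(rat ^ 'n::finite \<Rightarrow> rat ^ 'n \<Rightarrow> rat) \<Rightarrow> (rat ^ 'n) set \<Rightarrow> (rat ^ 'n) set \<Rightarrow> (rat ^ 'n) set
     \<Rightarrow> ('n affine_vec \<Rightarrow> 'n affine_vec)" where
  "admissible_of ip \<Delta> S I = the_inv_into (admissible ip \<Delta> S) (ideal_of \<Delta> S) I"

text \<open>
  The translation \<open>t\<^sub>r\<close> is given on all of \<open>V \<oplus> \<rat>\<delta> \<oplus> \<rat>\<lambda>\<close>, by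
  \<open>t\<^sub>r(x) = x + (x,\<delta>) r - ((x,r) + (r,r)(x,\<delta>)/2) \<delta>\<close>; this is the isometric extension of its action
  \<open>x \<mapsto> x - (x,r) \<delta>\<close> on \<open>V \<oplus> \<rat>\<delta>\<close>. Elements of the finite Weyl group act on the larger space by
  fixing \<open>\<delta>\<close> and \<open>\<lambda>\<close>.
\<close>

definition translation ::
  "(rat ^ 'n::finite \<Rightarrow> rat ^ 'n \<Rightarrow> rat) \<Rightarrow> rat ^ 'n \<Rightarrow> 'n affine_vec \<Rightarrow> 'n affine_vec" where
  "translation ip r = (\<lambda>(x, k, l). (x + l *s r, k - ip x r - ip r r / 2 * l, l))"

definition affine_lift :: "(rat ^ 'n::finite \<Rightarrow> rat ^ 'n) \<Rightarrow> 'n affine_vec \<Rightarrow> 'n affine_vec" where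
  "affine_lift v = (\<lambda>(x, k, l). (v x, k, l))"

definition weyl_decomp ::
  "(rat ^ 'n::finite \<Rightarrow> rat ^ 'n \<Rightarrow> rat) \<Rightarrow> (rat ^ 'n) set \<Rightarrow> ('n affine_vec \<Rightarrow> 'n affine_vec)
     \<Rightarrow> (rat ^ 'n \<Rightarrow> rat ^ 'n) \<times> (rat ^ 'n)" where
  "weyl_decomp ip S w =
     (THE (v, r). v \<in> weyl_group ip S \<and> r \<in> coroot_lattice ip S \<and>
        w = affine_lift v \<circ> translation ip r)"

definition d_elem ::
  "(rat ^ 'n::finite \<Rightarrow> rat ^ 'n \<Rightarrow> rat) \<Rightarrow> (rat ^ 'n) set \<Rightarrow> ('n affine_vec \<Rightarrow> 'n affine_vec) \<Rightarrow> rat ^ 'n" where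
  "d_elem ip S w = fst (weyl_decomp ip S w) (snd (weyl_decomp ip S w))"

definition d_ideal ::
  "(rat ^ 'n::finite \<Rightarrow> rat ^ 'n \<Rightarrow> rat) \<Rightarrow> (rat ^ 'n) set \<Rightarrow> (rat ^ 'n) set \<Rightarrow> (rat ^ 'n) set \<Rightarrow> rat ^ 'n" where
  "d_ideal ip \<Delta> S I = d_elem ip S (admissible_of ip \<Delta> S I)"

section \<open>The simplex and its faces\<close>

definition D_simplex ::
  "(rat ^ 'n::finite \<Rightarrow> rat ^ 'n \<Rightarrow> rat) \<Rightarrow> (rat ^ 'n) set \<Rightarrow> (rat ^ 'n) set \<Rightarrow> (rat ^ 'n) set" where
  "D_simplex ip \<Delta> S = {\<tau>. (\<forall>\<alpha>\<in>S. ip \<tau> \<alpha> \<ge> -1) \<and> ip \<tau> (highest_root \<Delta> S) \<le> 2}"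

text \<open>
  Convexity and faces as in \<^const>\<open>convex\<close> and \<^const>\<open>face_of\<close>, which are only available over the
  reals. A convex set is a face of itself.
\<close>

definition rat_convex :: "(rat ^ 'n::finite) set \<Rightarrow> bool" where
  "rat_convex C \<longleftrightarrow> (\<forall>x\<in>C. \<forall>y\<in>C. \<forall>t. 0 \<le> t \<and> t \<le> 1 \<longrightarrow> (1 - t) *s x + t *s y \<in> C)"

definition rat_face_of :: "(rat ^ 'n::finite) set \<Rightarrow> (rat ^ 'n) set \<Rightarrow> bool" where
  "rat_face_of F C \<longleftrightarrow>
     F \<subseteq> C \<and> rat_convex F \<and>
     (\<forall>x\<in>C. \<forall>y\<in>C. \<forall>t. 0 < t \<and> t < 1 \<and> (1 - t) *s x + t *s y \<in> F \<longrightarrow> x \<in> F \<and> y \<in> F)"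

definition minimal_face :: "(rat ^ 'n::finite) set \<Rightarrow> rat ^ 'n \<Rightarrow> (rat ^ 'n) set" where
  "minimal_face C x =
     (THE F. rat_face_of F C \<and> x \<in> F \<and> (\<forall>G. rat_face_of G C \<and> x \<in> G \<longrightarrow> F \<subseteq> G))"

text \<open>The codimension of the affine hull, whose direction space is spanned by differences.\<close>

definition codimension :: "(rat ^ 'n::finite) set \<Rightarrow> nat" where
  "codimension F =
     vec.dim (UNIV :: (rat ^ 'n) set) - vec.dim {x - y | x y. x \<in> F \<and> y \<in> F}"

end

theory Submission
  imports Defs
begin

text \<open>
  Let \<open>w\<close> be the admissible element of \<open>I\<close> and \<open>d = d\<^sub>I\<close>. For an affine simple root \<open>a\<close> the
  \<open>\<delta>\<close>-coefficient of \<open>w\<inverse>(a)\<close> is at least \<open>-1\<close>, with equality exactly if \<open>d\<close> lies on the wall of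
  the simplex belonging to \<open>a\<close>; in that case \<open>w\<inverse>(a) = \<gamma> - \<delta>\<close> with \<open>\<gamma> \<in> I\<close>. The \<open>\<gamma>\<close> so obtained
  are the generators of \<open>I\<close>, and the walls through \<open>d\<close> are linearly independent.

  The crucial point is that every affine root \<open>e\<close> of negative level with \<open>w(e) > 0\<close> lies in the
  additive cone generated by \<open>\<Delta>\<^sup>+\<close>, \<open>I - \<delta>\<close> and \<open>\<delta>\<close>, and is decomposable in it unless \<open>w(e)\<close> is
  simple. This identifies the generators, and it also shows that \<open>I\<close> determines the inversions of
  \<open>w\<close> and hence \<open>w\<close> itself. Existence of \<open>w\<close> is obtained by removing generators one at a time from
  \<open>\<Delta>\<^sup>+\<close>, whose region contains a translation: if \<open>w(\<gamma> - \<delta>) = a\<close> is simple, then \<open>s\<^sub>a w\<close> belongs to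
  \<open>I - {\<gamma>}\<close>, and an element with the fewest inversions for a given ideal is admissible.
\<close>

section \<open>Inner products and orthogonal complements\<close>

text \<open>The highest root, the factorisation of \<open>w\<close> into a finite part and a
  translation, the element attached to \<open>I\<close> and the minimal face are all definite
  descriptions. Each of them therefore needs existence and uniqueness before anything can be
  counted. The point \<open>d\<close> enters through a single identity. The \<delta>-coefficient
  (the level) of a vector is its pairing with \<lambda>, \<open>w\<close> is an isometry, and the
  finite part of \<open>w\<close> applied to \<lambda> is \<open>d\<close>; so the inverse of
  \<open>w\<close> sends y + k\<delta> to level (d,y) + k. Signs of affine roots are read off from a
  linear height that equals 1 on every affine simple root. The obstacle is the descent in this
  height: subtracting a simple root \<open>a\<close> from w(e) subtracts from e the preimage of
  \<open>a\<close> under \<open>w\<close>, which may have positive level and then need not lie in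
  the cone. What remains is a cone element plus a root outside the cone, and this sum has to be
  regrouped into two nonzero cone elements.\<close>

locale rat_inner =
  fixes ip :: "rat ^ 'n::finite \<Rightarrow> rat ^ 'n \<Rightarrow> rat"
  assumes inner: "inner_product ip"
begin

lemma ip_sym: "ip x y = ip y x"
  using inner unfolding inner_product_def by blast

lemma ip_add_left [simp]: "ip (x + y) z = ip x z + ip y z"
  using inner unfolding inner_product_def by blast

lemma ip_scale_left [simp]: "ip (c *s x) y = c * ip x y"
  using inner unfolding inner_product_def by blast

lemma ip_pos: "x \<noteq> 0 \<Longrightarrow> ip x x > 0"
  using inner unfolding inner_product_def by blast

lemma ip_add_right [simp]: "ip x (y + z) = ip x y + ip x z"
  by (metis ip_sym ip_add_left)

lemma ip_scale_right [simp]: "ip x (c *s y) = c * ip x y"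
  by (metis ip_sym ip_scale_left)

lemma ip_zero_left [simp]: "ip 0 x = 0"
  using ip_add_left[of 0 0 x] by simp

lemma ip_zero_right [simp]: "ip x 0 = 0"
  by (metis ip_sym ip_zero_left)

lemma ip_minus_left [simp]: "ip (- x) y = - ip x y"
  using ip_add_left[of x "- x" y] by (simp del: ip_add_left)

lemma ip_minus_right [simp]: "ip x (- y) = - ip x y"
  by (metis ip_sym ip_minus_left)

lemma ip_diff_left [simp]: "ip (x - y) z = ip x z - ip y z"
  using ip_add_left[of x "- y" z] by (simp del: ip_add_left)

lemma ip_diff_right [simp]: "ip x (y - z) = ip x y - ip x z"
  using ip_add_right[of x y "- z"] by (simp del: ip_add_right)

lemma ip_sum_left: "ip (\<Sum>i\<in>A. f i) y = (\<Sum>i\<in>A. ip (f i) y)"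
  by (induction A rule: infinite_finite_induct) auto

lemma ip_sum_right: "ip x (\<Sum>i\<in>A. f i) = (\<Sum>i\<in>A. ip x (f i))"
  by (induction A rule: infinite_finite_induct) auto

lemma ip_sum_list_right: "ip x (sum_list ys) = (\<Sum>y\<leftarrow>ys. ip x y)"
  by (induction ys) auto

lemma ip_eq_0_iff [simp]: "ip x x = 0 \<longleftrightarrow> x = 0"
  using ip_pos[of x] by (cases "x = 0") auto

lemma ip_nonneg [simp]: "ip x x \<ge> 0"
  using ip_pos[of x] by (cases "x = 0") auto

lemma ip_nondegenerate: "(\<And>y. ip y x = ip y z) \<Longrightarrow> x = z"
  using ip_eq_0_iff[of "x - z"] by (simp del: ip_eq_0_iff)

lemma Cauchy_Schwarz_strict:
  assumes "y \<noteq> 0" "\<And>c. x \<noteq> c *s y"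
  shows "ip x y * ip x y < ip x x * ip y y"
proof -
  have yy: "ip y y > 0" using ip_pos assms(1) .
  define c where "c = ip x y / ip y y"
  have "0 < ip (x - c *s y) (x - c *s y)"
    using ip_pos[of "x - c *s y"] assms(2)[of c] by simp
  also have "\<dots> = ip x x - ip x y * ip x y / ip y y"
    using yy by (simp add: c_def ip_sym[of y x] field_simps)
  finally show ?thesis using yy by (simp add: field_simps)
qed

lemma ip_span_eq_0:
  assumes "x \<in> vec.span B" "\<And>b. b \<in> B \<Longrightarrow> ip y b = 0"
  shows "ip y x = 0"
  using assms(1)
proof (induction rule: vec.span_induct_alt)
  case base then show ?case by simp
next
  case (step c x z) then show ?case using assms(2) by simp
qed

lemma orthogonal_projection:
  assumes "finite B"
  shows "\<exists>p \<in> vec.span B. \<forall>b\<in>B. ip (x - p) b = 0"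
  using assms
proof (induction arbitrary: x)
  case empty then show ?case by (auto intro: vec.span_zero)
next
  case (insert b B)
  obtain p where p: "p \<in> vec.span B" "\<forall>c\<in>B. ip (x - p) c = 0" using insert.IH by blast
  obtain r where r: "r \<in> vec.span B" "\<forall>c\<in>B. ip (b - r) c = 0" using insert.IH by blast
  define q where "q = b - r"
  \<comment> \<open>If \<open>b\<close> already lies in the span of \<open>B\<close>, then
    \<open>q = 0\<close>, and division by zero makes \<open>k\<close> zero as well.\<close>
  define k where "k = ip (x - p) q / ip q q"
  have orth: "ip (x - p - k *s q) z = 0" if "z \<in> vec.span B" for z
    using ip_span_eq_0[OF that, of "x - p - k *s q"] p r by (simp add: q_def)
  have "ip (x - p - k *s q) q = 0"
    by (cases "q = 0") (simp_all add: k_def)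
  then have b: "ip (x - p - k *s q) b = 0"
    using orth[OF r(1)] by (simp add: q_def)
  have mono: "z \<in> vec.span (insert b B)" if "z \<in> vec.span B" for z
    using that vec.span_mono[of B "insert b B"] by blast
  have "p + k *s q \<in> vec.span (insert b B)"
    unfolding q_def
    using mono[OF p(1)] mono[OF r(1)] vec.span_base[of b "insert b B"]
    by (intro vec.span_add vec.span_scale vec.span_diff) auto
  moreover have "\<forall>c \<in> insert b B. ip (x - (p + k *s q)) c = 0"
    using b orth[OF vec.span_base] by (auto simp: algebra_simps)
  ultimately show ?case by blast
qed

text \<open>\<open>B\<close> together with a basis of its complement is a basis of the whole space:
  positive definiteness makes the two spans meet only in 0, and orthogonal projection makes them
  span.\<close>

lemma dim_orthogonal_complement:
  assumes "vec.independent B"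
  shows "vec.dim {x. \<forall>b\<in>B. ip x b = 0} + card B = CARD('n)"
proof -
  define L where "L = {x. \<forall>b\<in>B. ip x b = 0}"
  have finB: "finite B" using assms vec.independent_bound_general by blast
  have L: "vec.subspace L" by (auto simp: vec.subspace_def L_def)
  obtain C where C: "C \<subseteq> L" "vec.independent C" "L \<subseteq> vec.span C" "card C = vec.dim L"
    using vec.basis_exists by blast
  have finC: "finite C" using C vec.independent_bound_general by blast
  have span_C: "vec.span C = L" using C L vec.span_minimal by blast
  have orth: "ip x y = 0" if "x \<in> L" "y \<in> vec.span B" for x y
    using ip_span_eq_0[OF that(2), of x] that(1) by (auto simp: L_def)
  have disj: "B \<inter> C = {}"
  proof -
    have "b = 0" if "b \<in> B" "b \<in> C" for b
      using orth[of b b] that C(1) vec.span_base[of b B] by auto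
    then show ?thesis using C(2) vec.dependent_zero by blast
  qed
  have "vec.independent (B \<union> C)"
  proof (rule vec.independent_if_scalars_zero)
    fix u x assume sum0: "(\<Sum>x\<in>B \<union> C. u x *s x) = 0" and x: "x \<in> B \<union> C"
    define b where "b = (\<Sum>x\<in>B. u x *s x)"
    define c where "c = (\<Sum>x\<in>C. u x *s x)"
    have bc: "b + c = 0" using sum0 by (simp add: b_def c_def sum.union_disjoint finB finC disj)
    have "b \<in> vec.span B" unfolding b_def by (intro vec.span_sum vec.span_scale vec.span_base)
    moreover have "c \<in> L" unfolding c_def span_C[symmetric]
      by (intro vec.span_sum vec.span_scale vec.span_base)
    moreover have "c = - b" using bc by (simp add: eq_neg_iff_add_eq_0 add.commute)
    ultimately have "ip c c = 0" using orth[of c b] by simp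
    then have "c = 0" by simp
    then have "b = 0" using bc by simp
    show "u x = 0"
      using x
    proof
      assume "x \<in> B"
      then show ?thesis using vec.independentD[OF assms finB subset_refl, of u x] \<open>b = 0\<close> b_def by simp
    next
      assume "x \<in> C"
      then show ?thesis using vec.independentD[OF C(2) finC subset_refl, of u x] \<open>c = 0\<close> c_def by simp
    qed
  qed (simp add: finB finC)
  moreover have "x \<in> vec.span (B \<union> C)" for x
  proof -
    obtain p where p: "p \<in> vec.span B" "\<forall>b\<in>B. ip (x - p) b = 0"
      using orthogonal_projection[OF finB] by blast
    then have "x - p \<in> vec.span C" by (simp add: span_C L_def)
    then have "p + (x - p) \<in> vec.span (B \<union> C)"
      using p(1) vec.span_mono[of B "B \<union> C"] vec.span_mono[of C "B \<union> C"]
      by (intro vec.span_add) auto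
    then show ?thesis by simp
  qed
  ultimately have "card (B \<union> C) = vec.dim (UNIV :: (rat ^ 'n) set)"
    by (intro vec.basis_card_eq_dim) auto
  then have "card (B \<union> C) = CARD('n)" by (simp only: vec_dim_card)
  then show ?thesis
    using C(4) disj finB finC by (simp add: card_Un_disjoint L_def)
qed

end

section \<open>Root systems\<close>

locale root_system = rat_inner ip for ip :: "rat ^ 'n::finite \<Rightarrow> rat ^ 'n \<Rightarrow> rat" +
  fixes \<Delta> S :: "(rat ^ 'n) set"
  assumes root_system: "irreducible_root_system ip \<Delta>"
    and simple: "simple_system \<Delta> S"
begin

abbreviation "\<Phi>p \<equiv> pos_roots \<Delta> S"
abbreviation "\<theta> \<equiv> highest_root \<Delta> S"

lemma finite_roots: "finite \<Delta>" and zero_not_root: "0 \<notin> \<Delta>" and span_roots: "vec.span \<Delta> = UNIV"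
  and reflection_roots: "\<alpha> \<in> \<Delta> \<Longrightarrow> root_reflection ip \<alpha> ` \<Delta> = \<Delta>"
  and cartan_int: "\<alpha> \<in> \<Delta> \<Longrightarrow> \<beta> \<in> \<Delta> \<Longrightarrow> ip \<beta> (coroot ip \<alpha>) \<in> \<int>"
  and reduced: "\<alpha> \<in> \<Delta> \<Longrightarrow> c *s \<alpha> \<in> \<Delta> \<Longrightarrow> c = 1 \<or> c = -1"
  using root_system[unfolded irreducible_root_system_def] by simp_all

lemma irreducible:
  "\<Delta> = A \<union> B \<Longrightarrow> (\<And>\<alpha> \<beta>. \<alpha> \<in> A \<Longrightarrow> \<beta> \<in> B \<Longrightarrow> ip \<alpha> \<beta> = 0) \<Longrightarrow> A = {} \<or> B = {}"
proof -
  assume AB: "\<Delta> = A \<union> B" "\<And>\<alpha> \<beta>. \<alpha> \<in> A \<Longrightarrow> \<beta> \<in> B \<Longrightarrow> ip \<alpha> \<beta> = 0"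
  have "\<forall>A B. \<Delta> = A \<union> B \<and> (\<forall>\<alpha>\<in>A. \<forall>\<beta>\<in>B. ip \<alpha> \<beta> = 0) \<longrightarrow> A = {} \<or> B = {}"
    using root_system unfolding irreducible_root_system_def by (elim conjE)
  from this[rule_format, of A B] show ?thesis using AB by metis
qed

lemma simple_subset: "S \<subseteq> \<Delta>"
  using simple unfolding simple_system_def by (rule conjunct1)

lemma independent_simple: "vec.independent S"
  using simple unfolding simple_system_def by (elim conjE)

lemma pos_or_neg: "\<beta> \<in> \<Delta> \<Longrightarrow> \<beta> \<in> nonneg_comb S \<or> - \<beta> \<in> nonneg_comb S"
  using simple unfolding simple_system_def by (elim conjE) (erule bspec)

lemma finite_simple: "finite S"
  using finite_subset[OF simple_subset finite_roots] .

lemma root_nonzero: "\<alpha> \<in> \<Delta> \<Longrightarrow> \<alpha> \<noteq> 0"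
  using zero_not_root by auto

lemma root_pos: "\<alpha> \<in> \<Delta> \<Longrightarrow> ip \<alpha> \<alpha> > 0"
  by (intro ip_pos root_nonzero)

lemma reflection_root: "\<alpha> \<in> \<Delta> \<Longrightarrow> \<beta> \<in> \<Delta> \<Longrightarrow> root_reflection ip \<alpha> \<beta> \<in> \<Delta>"
  using reflection_roots by blast

lemma uminus_root: "\<alpha> \<in> \<Delta> \<Longrightarrow> - \<alpha> \<in> \<Delta>"
proof -
  assume a: "\<alpha> \<in> \<Delta>"
  have "root_reflection ip \<alpha> \<alpha> = \<alpha> - 2 *s \<alpha>"
    using root_pos[OF a] by (simp add: root_reflection_def coroot_def)
  also have "\<dots> = - \<alpha>" by (simp add: vec_eq_iff)
  finally show ?thesis using reflection_root[OF a a] by simp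
qed

lemma uminus_root_iff [simp]: "- \<alpha> \<in> \<Delta> \<longleftrightarrow> \<alpha> \<in> \<Delta>"
  using uminus_root[of \<alpha>] uminus_root[of "- \<alpha>"] by auto

text \<open>Both Cartan integers are negative, and strict Cauchy-Schwarz bounds their product by 3,
  so one of them is -1. The corresponding reflection produces the sum. Reducedness excludes the
  proportional case, where Cauchy-Schwarz is not strict.\<close>

lemma add_root:
  assumes a: "\<alpha> \<in> \<Delta>" and b: "\<beta> \<in> \<Delta>" and neg: "ip \<alpha> \<beta> < 0" and nz: "\<alpha> + \<beta> \<noteq> 0"
  shows "\<alpha> + \<beta> \<in> \<Delta>"
proof -
  have np: "\<beta> \<noteq> c *s \<alpha>" for c
  proof
    assume "\<beta> = c *s \<alpha>"
    then have "c = 1 \<or> c = -1" using reduced a b by blast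
    then show False using \<open>\<beta> = c *s \<alpha>\<close> nz neg root_pos[OF a] by auto
  qed
  have a0: "\<alpha> \<noteq> 0" using a by (rule root_nonzero)
  have aa: "ip \<alpha> \<alpha> > 0" and bb: "ip \<beta> \<beta> > 0" using a b root_pos by auto
  obtain m where m: "ip \<beta> (coroot ip \<alpha>) = of_int m" using cartan_int[OF a b] by (rule Ints_cases)
  obtain n where n: "ip \<alpha> (coroot ip \<beta>) = of_int n" using cartan_int[OF b a] by (rule Ints_cases)
  have m': "of_int m = 2 * ip \<alpha> \<beta> / ip \<alpha> \<alpha>" and n': "of_int n = 2 * ip \<alpha> \<beta> / ip \<beta> \<beta>"
    using m n by (simp_all add: coroot_def ip_sym[of \<beta> \<alpha>])
  have "(of_int m :: rat) < 0" "(of_int n :: rat) < 0"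
    unfolding m' n' using neg aa bb by (simp_all add: divide_neg_pos)
  then have "m < 0" "n < 0" by simp_all
  have "ip \<beta> \<alpha> * ip \<beta> \<alpha> < ip \<beta> \<beta> * ip \<alpha> \<alpha>" using Cauchy_Schwarz_strict[OF a0 np] .
  then have "(of_int (m * n) :: rat) < of_int 4"
    unfolding of_int_mult m' n' using aa bb by (simp add: field_simps ip_sym[of \<beta> \<alpha>])
  then have mn: "m * n < 4" by linarith
  have "m = -1 \<or> n = -1"
  proof (rule ccontr)
    assume "\<not> ?thesis"
    then have "- m \<ge> 2" "- n \<ge> 2" using \<open>m < 0\<close> \<open>n < 0\<close> by auto
    then have "(- m) * (- n) \<ge> 2 * 2" by (intro mult_mono) auto
    then show False using mn by simp
  qed
  then show ?thesis
  proof
    assume "m = -1"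
    then have "root_reflection ip \<alpha> \<beta> = \<alpha> + \<beta>" using m by (simp add: root_reflection_def)
    then show ?thesis using reflection_root[OF a b] by simp
  next
    assume "n = -1"
    then have "root_reflection ip \<beta> \<alpha> = \<alpha> + \<beta>" using n by (simp add: root_reflection_def)
    then show ?thesis using reflection_root[OF b a] by simp
  qed
qed

lemma diff_root:
  assumes "\<alpha> \<in> \<Delta>" "\<beta> \<in> \<Delta>" "ip \<alpha> \<beta> > 0" "\<alpha> \<noteq> \<beta>"
  shows "\<alpha> - \<beta> \<in> \<Delta>"
  using add_root[of \<alpha> "- \<beta>"] assms by simp

lemma span_simple: "vec.span S = UNIV"
proof -
  have *: "x \<in> vec.span S" if "x \<in> nonneg_comb S" for x
    using that unfolding nonneg_comb_def by (auto intro: vec.span_sum vec.span_scale vec.span_base)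
  have "\<beta> \<in> vec.span S" if "\<beta> \<in> \<Delta>" for \<beta>
    using pos_or_neg[OF that] *[of \<beta>] *[of "- \<beta>"] by (metis vec.span_neg minus_minus)
  then have "vec.span \<Delta> \<subseteq> vec.span S" by (intro vec.span_minimal) auto
  then show ?thesis using span_roots by auto
qed

section \<open>Coordinates with respect to the simple roots\<close>

definition cf :: "rat ^ 'n \<Rightarrow> rat ^ 'n \<Rightarrow> rat" where
  "cf x a = vec.representation S x a"

lemma cf_sum: "(\<Sum>a\<in>S. cf x a *s a) = x"
  unfolding cf_def
  by (rule vec.sum_representation_eq) (auto simp: independent_simple span_simple finite_simple)

lemma cf_add [simp]: "cf (x + y) a = cf x a + cf y a"
  by (simp add: cf_def vec.representation_add independent_simple span_simple)

lemma cf_scale [simp]: "cf (c *s x) a = c * cf x a"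
  by (simp add: cf_def vec.representation_scale independent_simple span_simple)

lemma cf_minus [simp]: "cf (- x) a = - cf x a"
  by (simp add: cf_def vec.representation_neg independent_simple span_simple)

lemma cf_diff [simp]: "cf (x - y) a = cf x a - cf y a"
  by (simp add: cf_def vec.representation_diff independent_simple span_simple)

lemma cf_zero [simp]: "cf 0 a = 0"
  by (simp add: cf_def vec.representation_zero)

lemma cf_simple: "b \<in> S \<Longrightarrow> cf b a = (if a = b then 1 else 0)"
  by (simp add: cf_def vec.representation_basis independent_simple)

lemma cf_setsum: "cf (\<Sum>i\<in>A. f i) a = (\<Sum>i\<in>A. cf (f i) a)"
  by (induction A rule: infinite_finite_induct) auto

lemma cf_sum_scaled: "cf (\<Sum>b\<in>S. c b *s b) a = (if a \<in> S then c a else 0)"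
proof -
  have "cf (\<Sum>b\<in>S. c b *s b) a = (\<Sum>b\<in>S. c b * cf b a)"
    by (simp add: cf_setsum)
  also have "\<dots> = (\<Sum>b\<in>S. if a = b then c b else 0)"
    by (intro sum.cong) (auto simp: cf_simple)
  finally show ?thesis using finite_simple by simp
qed

lemma cf_eqI: "(\<And>a. a \<in> S \<Longrightarrow> cf x a = cf y a) \<Longrightarrow> x = y"
  by (metis (no_types, lifting) cf_sum sum.cong)


end

context root_system
begin

lemma nonneg_comb_iff: "x \<in> nonneg_comb S \<longleftrightarrow> (\<forall>a\<in>S. cf x a \<in> \<nat>)"
proof
  assume "x \<in> nonneg_comb S"
  then show "\<forall>a\<in>S. cf x a \<in> \<nat>" by (auto simp: nonneg_comb_def cf_sum_scaled)
next
  assume *: "\<forall>a\<in>S. cf x a \<in> \<nat>"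
  have "x = (\<Sum>a\<in>S. of_nat (nat \<lfloor>cf x a\<rfloor>) *s a)"
    using * by (subst cf_sum[of x, symmetric], intro sum.cong) (auto elim!: Nats_cases)
  then show "x \<in> nonneg_comb S"
    unfolding nonneg_comb_def by (intro CollectI exI[of _ "\<lambda>a. nat \<lfloor>cf x a\<rfloor>"]) simp
qed

lemma nonneg_comb_ge: "x \<in> nonneg_comb S \<Longrightarrow> a \<in> S \<Longrightarrow> cf x a \<ge> 0"
  by (metis nonneg_comb_iff Nats_cases of_nat_0_le_iff)

lemma nonneg_comb_add: "x \<in> nonneg_comb S \<Longrightarrow> y \<in> nonneg_comb S \<Longrightarrow> x + y \<in> nonneg_comb S"
  by (simp add: nonneg_comb_iff)

lemma nonneg_comb_zero: "0 \<in> nonneg_comb S"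
  by (simp add: nonneg_comb_iff)

lemma nonneg_comb_sum_list: "set xs \<subseteq> nonneg_comb S \<Longrightarrow> sum_list xs \<in> nonneg_comb S"
  by (induction xs) (auto intro: nonneg_comb_add nonneg_comb_zero)

lemma cf_int: "\<beta> \<in> \<Delta> \<Longrightarrow> a \<in> S \<Longrightarrow> cf \<beta> a \<in> \<int>"
  using pos_or_neg[of \<beta>] Nats_subset_Ints Ints_minus[of "cf (- \<beta>) a"]
  by (force simp: nonneg_comb_iff)

section \<open>Height and positivity\<close>

definition ht :: "rat ^ 'n \<Rightarrow> rat" where
  "ht x = (\<Sum>a\<in>S. cf x a)"

lemma ht_add [simp]: "ht (x + y) = ht x + ht y"
  and ht_scale [simp]: "ht (c *s x) = c * ht x"
  and ht_minus [simp]: "ht (- x) = - ht x"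
  and ht_diff [simp]: "ht (x - y) = ht x - ht y"
  and ht_zero [simp]: "ht 0 = 0"
  by (simp_all add: ht_def sum.distrib sum_subtractf sum_distrib_left sum_negf)

lemma ht_simple: "a \<in> S \<Longrightarrow> ht a = 1"
  using finite_simple by (simp add: ht_def cf_simple)

lemma ht_int: "\<beta> \<in> \<Delta> \<Longrightarrow> ht \<beta> \<in> \<int>"
  unfolding ht_def by (auto intro: cf_int)

lemma ht_nonneg_comb: "x \<in> nonneg_comb S \<Longrightarrow> x \<noteq> 0 \<Longrightarrow> ht x \<ge> 1"
proof -
  assume x: "x \<in> nonneg_comb S" "x \<noteq> 0"
  then obtain a where a: "a \<in> S" "cf x a \<noteq> 0" using cf_eqI[of x 0] by auto
  moreover obtain n where "cf x a = of_nat n" using x a by (auto simp: nonneg_comb_iff elim: Nats_cases)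
  ultimately have "cf x a \<ge> 1" by (cases n) auto
  also have "cf x a \<le> ht x"
    unfolding ht_def using finite_simple a x by (intro member_le_sum) (auto intro: nonneg_comb_ge)
  finally show ?thesis .
qed

lemma pos_rootD: "\<beta> \<in> \<Phi>p \<Longrightarrow> \<beta> \<in> \<Delta>" "\<beta> \<in> \<Phi>p \<Longrightarrow> \<beta> \<in> nonneg_comb S"
  by (auto simp: pos_roots_def)

lemma finite_pos_roots: "finite \<Phi>p"
  using finite_roots by (auto simp: pos_roots_def)

lemma ht_pos_root: "\<beta> \<in> \<Phi>p \<Longrightarrow> ht \<beta> \<ge> 1"
  by (intro ht_nonneg_comb root_nonzero pos_rootD)

lemma pos_root_iff: "\<beta> \<in> \<Delta> \<Longrightarrow> \<beta> \<in> \<Phi>p \<longleftrightarrow> ht \<beta> > 0"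
proof
  assume "\<beta> \<in> \<Phi>p" then show "ht \<beta> > 0" using ht_pos_root[of \<beta>] by simp
next
  assume b: "\<beta> \<in> \<Delta>" "ht \<beta> > 0"
  have False if "- \<beta> \<in> nonneg_comb S"
    using ht_pos_root[of "- \<beta>"] that b by (simp add: pos_roots_def)
  then show "\<beta> \<in> \<Phi>p" using b pos_or_neg by (auto simp: pos_roots_def)
qed

lemma uminus_pos_root_iff: "\<beta> \<in> \<Delta> \<Longrightarrow> - \<beta> \<in> \<Phi>p \<longleftrightarrow> \<beta> \<notin> \<Phi>p"
proof -
  assume b: "\<beta> \<in> \<Delta>"
  have "- \<beta> \<in> \<Phi>p \<or> \<beta> \<in> \<Phi>p" using pos_or_neg[OF b] b by (auto simp: pos_roots_def)
  moreover have "\<not> (- \<beta> \<in> \<Phi>p \<and> \<beta> \<in> \<Phi>p)"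
    using ht_pos_root[of \<beta>] ht_pos_root[of "- \<beta>"] by auto
  ultimately show ?thesis by blast
qed

lemma simple_pos: "a \<in> S \<Longrightarrow> a \<in> \<Phi>p"
  using simple_subset pos_root_iff[of a] ht_simple[of a] by auto

lemma nonneg_comb_diff_simple:
  assumes x: "x \<in> nonneg_comb S" and a: "a \<in> S" "cf x a \<noteq> 0"
  shows "x - a \<in> nonneg_comb S"
  unfolding nonneg_comb_iff
proof
  fix b assume b: "b \<in> S"
  obtain n where n: "cf x a = of_nat n" using x a by (auto simp: nonneg_comb_iff elim: Nats_cases)
  show "cf (x - a) b \<in> \<nat>"
  proof (cases "b = a")
    case True
    then have "cf (x - a) b = of_nat (n - 1)" using n a by (cases n) (auto simp: cf_simple)
    then show ?thesis by simp
  next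
    case False then show ?thesis using x a b by (simp add: cf_simple nonneg_comb_iff)
  qed
qed

lemma ht_1_nonneg_comb: "x \<in> nonneg_comb S \<Longrightarrow> ht x = 1 \<Longrightarrow> x \<in> S"
proof -
  assume x: "x \<in> nonneg_comb S" "ht x = 1"
  then have "x \<noteq> 0" by auto
  then obtain a where a: "a \<in> S" "cf x a \<noteq> 0" using cf_eqI[of x 0] by auto
  then have "x - a = 0"
    using ht_nonneg_comb[of "x - a"] nonneg_comb_diff_simple[OF x(1) a] x a by (auto simp: ht_simple)
  then show ?thesis using a by simp
qed

text \<open>Expanding one argument of the positive number \<open>ip x x\<close> in simple roots,
  some term of the sum must be positive.\<close>

lemma root_not_orthogonal_simple: "x \<noteq> 0 \<Longrightarrow> \<exists>a\<in>S. cf x a * ip x a > 0"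
proof (rule ccontr)
  assume x: "x \<noteq> 0" and "\<not> ?thesis"
  then have *: "\<And>a. a \<in> S \<Longrightarrow> cf x a * ip x a \<le> 0" by force
  have "ip x x = (\<Sum>a\<in>S. cf x a * ip x a)"
    by (subst (2) cf_sum[of x, symmetric]) (simp add: ip_sum_right)
  also have "\<dots> \<le> 0" using * by (rule sum_nonpos)
  finally show False using ip_pos[OF x] by simp
qed

lemma nonneg_comb_simple:
  assumes "x \<in> nonneg_comb S" "x \<noteq> 0"
  obtains a where "a \<in> S" "ip x a > 0" "cf x a > 0"
proof -
  obtain a where "a \<in> S" "cf x a * ip x a > 0" using root_not_orthogonal_simple assms(2) by blast
  moreover have "cf x a \<ge> 0" using nonneg_comb_ge assms \<open>a \<in> S\<close> by blast
  ultimately show ?thesis using that[of a] by (auto simp: zero_less_mult_iff)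
qed

lemma coroot_self: "\<alpha> \<in> \<Delta> \<Longrightarrow> ip \<alpha> (coroot ip \<alpha>) = 2"
  using root_pos[of \<alpha>] by (auto simp: coroot_def)

lemma coroot_pos_iff: "\<alpha> \<in> \<Delta> \<Longrightarrow> ip x (coroot ip \<alpha>) > 0 \<longleftrightarrow> ip x \<alpha> > 0"
  using root_pos[of \<alpha>] by (simp add: coroot_def zero_less_divide_iff zero_less_mult_iff)

text \<open>Reflecting in \<open>a\<close> changes only the coefficient at \<open>a\<close>. As
  \<Delta> is reduced, \<beta> has another nonzero coefficient; it stays positive, and one positive
  coefficient decides the sign of a root.\<close>

lemma simple_reflection_pos:
  assumes a: "a \<in> S" and b: "\<beta> \<in> \<Phi>p" "\<beta> \<noteq> a"
  shows "root_reflection ip a \<beta> \<in> \<Phi>p"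
proof -
  have bD: "\<beta> \<in> \<Delta>" "\<beta> \<in> nonneg_comb S" using b pos_rootD by auto
  have aD: "a \<in> \<Delta>" using a simple_subset by blast
  have "\<exists>c\<in>S - {a}. cf \<beta> c \<noteq> 0"
  proof (rule ccontr)
    assume "\<not> ?thesis"
    then have "\<beta> = cf \<beta> a *s a" using a by (intro cf_eqI) (auto simp: cf_simple)
    moreover then have "cf \<beta> a = 1 \<or> cf \<beta> a = -1" using reduced[OF aD, of "cf \<beta> a"] bD by auto
    ultimately show False using nonneg_comb_ge[OF bD(2) a] b(2) by auto
  qed
  then obtain c where c: "c \<in> S" "c \<noteq> a" "cf \<beta> c \<noteq> 0" by blast
  then have "cf \<beta> c > 0" using nonneg_comb_ge[OF bD(2)] by force
  then have "cf (root_reflection ip a \<beta>) c > 0" using c a by (simp add: root_reflection_def cf_simple)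
  moreover have r: "root_reflection ip a \<beta> \<in> \<Delta>" using reflection_root aD bD by blast
  ultimately have "- root_reflection ip a \<beta> \<notin> nonneg_comb S"
    using nonneg_comb_ge[of "- root_reflection ip a \<beta>" c] c by auto
  then show ?thesis using r pos_or_neg by (auto simp: pos_roots_def)
qed

text \<open>The descent step for inductions over positive roots: every positive root is reached from
  simple ones by simple reflections. Integrality of the Cartan number makes the height drop by at
  least 1.\<close>

lemma nonsimple_reflect:
  assumes b: "\<beta> \<in> \<Phi>p" "\<beta> \<notin> S"
  obtains a where "a \<in> S" "ip \<beta> a > 0" "root_reflection ip a \<beta> \<in> \<Phi>p"
    "ht (root_reflection ip a \<beta>) \<le> ht \<beta> - 1"
proof -
  have bD: "\<beta> \<in> \<Delta>" "\<beta> \<in> nonneg_comb S" "\<beta> \<noteq> 0" using b pos_rootD root_nonzero by auto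
  then obtain a where a: "a \<in> S" "ip \<beta> a > 0" using nonneg_comb_simple by blast
  have aD: "a \<in> \<Delta>" using a simple_subset by blast
  have r: "root_reflection ip a \<beta> \<in> \<Phi>p" using simple_reflection_pos[OF a(1) b(1)] b a by blast
  have "ip \<beta> (coroot ip a) > 0" using coroot_pos_iff[OF aD] a by simp
  moreover obtain n where "ip \<beta> (coroot ip a) = of_int n" using cartan_int[OF aD bD(1)] by (rule Ints_cases)
  ultimately have "ip \<beta> (coroot ip a) \<ge> 1" by simp
  then have "ht (root_reflection ip a \<beta>) \<le> ht \<beta> - 1" by (simp add: root_reflection_def ht_simple a)
  then show ?thesis using that a r by blast
qed

text \<open>Heights of positive roots are positive integers, so descending in height terminates.\<close>

lemma pos_root_induct [consumes 1, case_names root]: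
  assumes "\<beta> \<in> \<Phi>p"
    and step: "\<And>\<beta>. \<beta> \<in> \<Phi>p \<Longrightarrow> (\<And>\<gamma>. \<gamma> \<in> \<Phi>p \<Longrightarrow> ht \<gamma> \<le> ht \<beta> - 1 \<Longrightarrow> P \<gamma>) \<Longrightarrow> P \<beta>"
  shows "P \<beta>"
  using assms(1)
proof (induction "nat \<lfloor>ht \<beta>\<rfloor>" arbitrary: \<beta> rule: less_induct)
  case less
  show ?case
  proof (rule step[OF less.prems])
    fix \<gamma> assume g: "\<gamma> \<in> \<Phi>p" "ht \<gamma> \<le> ht \<beta> - 1"
    then show "P \<gamma>" using less.hyps[of \<gamma>] ht_pos_root[OF g(1)] by linarith
  qed
qed

text \<open>A proper subset \<open>J\<close> of \<open>S\<close> orthogonal to its complement would split \<open>\<Delta>\<close>.\<close>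

lemma simple_connected:
  assumes J: "J \<subseteq> S" "J \<noteq> {}" and orth: "\<And>a b. a \<in> J \<Longrightarrow> b \<in> S - J \<Longrightarrow> ip a b = 0"
  shows "J = S"
proof -
  have orth_span: "ip x y = 0" if "x \<in> vec.span J" "y \<in> vec.span (S - J)" for x y
  proof (rule ip_span_eq_0[OF that(2)])
    fix b assume b: "b \<in> S - J"
    have "ip b x = 0" using that(1) by (rule ip_span_eq_0) (use orth b ip_sym in metis)
    then show "ip x b = 0" using ip_sym by metis
  qed
  have "\<beta> \<in> vec.span J \<or> \<beta> \<in> vec.span (S - J)" if "\<beta> \<in> \<Phi>p" for \<beta>
    using that
  proof (induction rule: pos_root_induct)
    case (root \<beta>)
    show ?case
    proof (cases "\<beta> \<in> S")
      case True
      then show ?thesis using vec.span_base[of \<beta> J] vec.span_base[of \<beta> "S - J"] by auto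
    next
      case False
      then obtain a where a: "a \<in> S" "ip \<beta> a > 0" "root_reflection ip a \<beta> \<in> \<Phi>p"
        "ht (root_reflection ip a \<beta>) \<le> ht \<beta> - 1" using nonsimple_reflect root.hyps by blast
      define \<gamma> where "\<gamma> = root_reflection ip a \<beta>"
      have \<beta>: "\<beta> = \<gamma> + ip \<beta> (coroot ip a) *s a" by (simp add: \<gamma>_def root_reflection_def)
      \<comment> \<open>Reflection reverses the sign of the pairing with \<open>a\<close>. So
        \<gamma> and \<open>a\<close> are not orthogonal and have to belong to the same part, to
        which \<beta> then belongs too.\<close>
      have neg: "ip \<gamma> a < 0"
        using a coroot_self[of a] simple_subset root_pos[of a]
        by (auto simp: \<gamma>_def root_reflection_def coroot_def)
      have IH: "\<gamma> \<in> vec.span J \<or> \<gamma> \<in> vec.span (S - J)" using root a by (simp add: \<gamma>_def)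
      show ?thesis
      proof (cases "a \<in> J")
        case True
        have "ip \<gamma> a = 0" if "\<gamma> \<in> vec.span (S - J)"
          using orth_span[OF vec.span_base[OF True] that] ip_sym[of \<gamma> a] by simp
        then have g: "\<gamma> \<in> vec.span J" using IH neg by fastforce
        have "\<beta> \<in> vec.span J"
          by (subst \<beta>) (rule vec.span_add[OF g vec.span_scale[OF vec.span_base[OF True]]])
        then show ?thesis by blast
      next
        case False
        then have aJ: "a \<in> S - J" using a by simp
        have "ip \<gamma> a = 0" if "\<gamma> \<in> vec.span J"
          using orth_span[OF that vec.span_base[OF aJ]] .
        then have g: "\<gamma> \<in> vec.span (S - J)" using IH neg by fastforce
        have "\<beta> \<in> vec.span (S - J)"
          by (subst \<beta>) (rule vec.span_add[OF g vec.span_scale[OF vec.span_base[OF aJ]]])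
        then show ?thesis by blast
      qed
    qed
  qed
  then have *: "\<beta> \<in> vec.span J \<or> \<beta> \<in> vec.span (S - J)" if "\<beta> \<in> \<Delta>" for \<beta>
    using that uminus_pos_root_iff[OF that] by (metis vec.span_neg minus_minus)
  have "\<Delta> \<inter> vec.span J = {} \<or> \<Delta> \<inter> vec.span (S - J) = {}"
    using * orth_span by (intro irreducible) auto
  moreover obtain a where "a \<in> J" using J by auto
  then have "a \<in> \<Delta> \<inter> vec.span J" using J simple_subset vec.span_base[of a J] by auto
  ultimately have disj: "\<Delta> \<inter> vec.span (S - J) = {}" by auto
  have "S \<subseteq> J"
  proof
    fix b assume "b \<in> S"
    then show "b \<in> J" using disj simple_subset vec.span_base[of b "S - J"] by auto
  qed
  then show ?thesis using J by auto
qed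

section \<open>The highest root\<close>

lemma simple_nonempty: "S \<noteq> {}"
proof
  assume "S = {}"
  then have "(UNIV :: (rat ^ 'n) set) = {0}" using span_simple by simp
  moreover have "(1 :: rat ^ 'n) \<noteq> 0" by (simp add: vec_eq_iff)
  ultimately show False by blast
qed

text \<open>For a simple root \<open>b\<close> outside the support \<open>J\<close> of \<beta>, the
  pairing of \<beta> with \<open>b\<close> is a sum of nonpositive terms, yet nonnegative by
  dominance. Hence all terms vanish and \<open>J\<close> is orthogonal to its complement.\<close>

lemma dominant_full_support:
  assumes \<beta>: "\<beta> \<in> \<Phi>p" and dom: "\<And>a. a \<in> S \<Longrightarrow> ip \<beta> a \<ge> 0" and c: "c \<in> S"
  shows "cf \<beta> c > 0"
proof -
  define J where "J = {a\<in>S. cf \<beta> a \<noteq> 0}"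
  have b0: "\<beta> \<noteq> 0" and bN: "\<beta> \<in> nonneg_comb S" using \<beta> pos_rootD root_nonzero by auto
  \<comment> \<open>A positive pairing would make \<open>a - b\<close> a root, although its
    coefficients have both signs.\<close>
  have obtuse: "ip a b \<le> 0" if ab: "a \<in> S" "b \<in> S" "a \<noteq> b" for a b
  proof (rule ccontr)
    assume "\<not> ?thesis"
    then have "a - b \<in> \<Delta>" using ab simple_subset by (intro diff_root) auto
    then have "a - b \<in> nonneg_comb S \<or> b - a \<in> nonneg_comb S" using pos_or_neg[of "a - b"] by simp
    then show False using nonneg_comb_ge[of "a - b" b] nonneg_comb_ge[of "b - a" a] ab
      by (auto simp: cf_simple)
  qed
  have "J = S"
  proof (rule simple_connected)
    show "J \<subseteq> S" by (auto simp: J_def)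
    show "J \<noteq> {}" using cf_eqI[of \<beta> 0] b0 by (auto simp: J_def)
    fix a b assume a: "a \<in> J" and b: "b \<in> S - J"
    have nonpos: "cf \<beta> d * ip d b \<le> 0" if "d \<in> S" for d
      using obtuse[of d b] nonneg_comb_ge[OF bN that] that b
      by (cases "d = b") (auto simp: J_def mult_nonneg_nonpos)
    have "0 \<le> ip \<beta> b" using dom b by blast
    also have "ip \<beta> b = (\<Sum>d\<in>S. cf \<beta> d * ip d b)"
      by (subst cf_sum[of \<beta>, symmetric]) (simp add: ip_sum_left)
    finally have "(\<Sum>d\<in>S. - (cf \<beta> d * ip d b)) \<le> 0" by (simp add: sum_negf)
    moreover have "- (cf \<beta> a * ip a b) \<le> (\<Sum>d\<in>S. - (cf \<beta> d * ip d b))"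
      using nonpos a finite_simple by (intro member_le_sum) (auto simp: J_def)
    moreover have "cf \<beta> a * ip a b \<le> 0" using nonpos[of a] a by (simp add: J_def)
    ultimately have "cf \<beta> a * ip a b = 0" by linarith
    then show "ip a b = 0" using a by (auto simp: J_def)
  qed
  then show ?thesis using c nonneg_comb_ge[OF bN c] by (force simp: J_def)
qed

lemma maximal_root_dominant:
  assumes t: "t \<in> \<Phi>p" and max: "\<And>\<beta>. \<beta> \<in> \<Delta> \<Longrightarrow> \<beta> - t \<in> nonneg_comb S \<Longrightarrow> \<beta> = t" and a: "a \<in> S"
  shows "ip t a \<ge> 0"
proof (rule ccontr)
  assume "\<not> ?thesis"
  then have neg: "ip t a < 0" by simp
  have nz: "t + a \<noteq> 0" using ht_pos_root[OF t] ht_simple[OF a] ht_add[of t a] by (auto simp del: ht_add)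
  have "t + a \<in> \<Delta>" using pos_rootD(1)[OF t] a simple_subset neg nz by (intro add_root) auto
  then have "t + a = t" using max[of "t + a"] simple_pos[OF a] pos_rootD by auto
  then show False using ht_simple[OF a] by auto
qed

text \<open>Maximal roots are dominant and have full support, so two of them pair positively. If
  they were different, their difference would be a root, hence they would be comparable, against
  maximality. A unique maximal root lies above every positive root.\<close>

lemma highest_root_exists: "\<exists>!t. t \<in> \<Delta> \<and> (\<forall>\<beta>\<in>\<Delta>. t - \<beta> \<in> nonneg_comb S)"
proof -
  define maxl where "maxl t \<longleftrightarrow> t \<in> \<Phi>p \<and> (\<forall>\<beta>\<in>\<Delta>. \<beta> - t \<in> nonneg_comb S \<longrightarrow> \<beta> = t)" for t
  \<comment> \<open>By finiteness there is a root of greatest height among those above \<beta>; it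
    is maximal.\<close>
  have above: "\<exists>t. maxl t \<and> t - \<beta> \<in> nonneg_comb S" if b: "\<beta> \<in> \<Phi>p" for \<beta>
  proof -
    define U where "U = {\<gamma>\<in>\<Delta>. \<gamma> - \<beta> \<in> nonneg_comb S}"
    have U: "finite U" "\<beta> \<in> U" using finite_roots b pos_rootD nonneg_comb_zero by (auto simp: U_def)
    have "Max (ht ` U) \<in> ht ` U" using U by (intro Max_in) auto
    then obtain t where t0: "t \<in> U" "Max (ht ` U) = ht t" by blast
    then have t: "t \<in> U" "\<And>\<gamma>. \<gamma> \<in> U \<Longrightarrow> ht \<gamma> \<le> ht t"
      using Max_ge[of "ht ` U"] U(1) by auto
    have up: "\<gamma> \<in> U" if "\<gamma> \<in> \<Delta>" "\<gamma> - t \<in> nonneg_comb S" for \<gamma>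
      using nonneg_comb_add[of "\<gamma> - t" "t - \<beta>"] t(1) that by (simp add: U_def)
    have "\<gamma> = t" if "\<gamma> \<in> \<Delta>" "\<gamma> - t \<in> nonneg_comb S" for \<gamma>
      using t(2)[OF up[OF that]] ht_nonneg_comb[OF that(2)] by force
    moreover have "t \<in> \<Phi>p"
      using t(1) nonneg_comb_add[of "t - \<beta>" \<beta>] pos_rootD[OF b] by (simp add: U_def pos_roots_def)
    ultimately have "maxl t" by (auto simp: maxl_def)
    then show ?thesis using t(1) by (auto simp: U_def)
  qed
  have dom: "ip t a \<ge> 0" if "maxl t" "a \<in> S" for t a
    using that maximal_root_dominant[of t a] by (auto simp: maxl_def)
  have unique: "t = u" if t: "maxl t" and u: "maxl u" for t u
  proof (rule ccontr)
    assume ne: "t \<noteq> u"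
    have tD: "t \<in> \<Delta>" "u \<in> \<Delta>" "t \<in> nonneg_comb S" "t \<noteq> 0" 
      using t u pos_rootD root_nonzero unfolding maxl_def by auto
    obtain a where a: "a \<in> S" "ip t a > 0" using nonneg_comb_simple tD by blast
    have cu: "cf u c > 0" if "c \<in> S" for c
      using u dom[OF u] that dominant_full_support by (auto simp: maxl_def)
    have "0 < cf u a * ip t a" using a cu by simp
    also have "\<dots> \<le> (\<Sum>c\<in>S. cf u c * ip t c)"
      using a cu dom[OF t] finite_simple by (intro member_le_sum) (auto intro: mult_nonneg_nonneg less_imp_le)
    also have "\<dots> = ip t u" by (subst (2) cf_sum[of u, symmetric]) (simp add: ip_sum_right)
    finally have "t - u \<in> \<Delta>" using tD ne by (intro diff_root) auto
    then have "t - u \<in> nonneg_comb S \<or> u - t \<in> nonneg_comb S" using pos_or_neg[of "t - u"] by simp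
    then show False using t u ne tD by (auto simp: maxl_def)
  qed
  obtain s where "s \<in> \<Phi>p" using simple_nonempty simple_pos by blast
  then obtain t where t: "maxl t" using above by blast
  have hi: "t - \<beta> \<in> nonneg_comb S" if "\<beta> \<in> \<Phi>p" for \<beta> using above[OF that] unique[OF t] by auto
  have "t - \<beta> \<in> nonneg_comb S" if b: "\<beta> \<in> \<Delta>" for \<beta>
  proof (cases "\<beta> \<in> \<Phi>p")
    case False
    then have "- \<beta> \<in> nonneg_comb S" using uminus_pos_root_iff[OF b] pos_rootD by blast
    moreover have "t \<in> nonneg_comb S" using t pos_rootD by (auto simp: maxl_def)
    ultimately show ?thesis using nonneg_comb_add[of t "- \<beta>"] by simp
  qed (use hi in blast)
  moreover have "t \<in> \<Delta>" using t pos_rootD by (auto simp: maxl_def)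
  moreover have "u = t" if "u \<in> \<Delta>" "\<forall>\<beta>\<in>\<Delta>. u - \<beta> \<in> nonneg_comb S" for u
    using that(2)[rule_format, of t] that(1) t pos_rootD(1)[of t] by (auto simp: maxl_def)
  ultimately show ?thesis by blast
qed

lemma highest_root: "\<theta> \<in> \<Delta>" "\<beta> \<in> \<Delta> \<Longrightarrow> \<theta> - \<beta> \<in> nonneg_comb S"
  using theI'[OF highest_root_exists] by (auto simp: highest_root_def)

lemma highest_root_pos: "\<theta> \<in> \<Phi>p"
proof -
  obtain a where a: "a \<in> S" using simple_nonempty by blast
  then have "\<theta> - a + a \<in> nonneg_comb S"
    using highest_root simple_pos pos_rootD by (intro nonneg_comb_add) blast+
  then show ?thesis using highest_root(1) by (simp add: pos_roots_def)
qed

lemma highest_root_coeff: "a \<in> S \<Longrightarrow> cf \<theta> a \<ge> 1"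
  using nonneg_comb_ge[OF highest_root(2)[of a], of a] simple_subset by (auto simp: cf_simple)

lemma ht_highest_root: "\<beta> \<in> \<Delta> \<Longrightarrow> ht \<beta> \<le> ht \<theta>" "\<beta> \<in> \<Delta> \<Longrightarrow> ht \<beta> = ht \<theta> \<Longrightarrow> \<beta> = \<theta>"
  using ht_nonneg_comb[OF highest_root(2)[of \<beta>]] by fastforce+

end

section \<open>The affine root system\<close>

lemma affine_scale_add_left: "affine_scale (c + d) x = affine_scale c x + affine_scale d x"
  and affine_scale_scale: "affine_scale c (affine_scale d x) = affine_scale (c * d) x"
  and affine_scale_diff_right: "affine_scale c (x - y) = affine_scale c x - affine_scale c y"
  by (cases x; cases y; simp add: affine_scale_def vec.scale_right_distrib vec.scale_left_distrib
      vec.scale_right_diff_distrib algebra_simps)+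

lemma affine_scale_simps [simp]: "affine_scale 1 x = x" "affine_scale 0 x = 0" "affine_scale (-1) x = - x"
  "affine_scale 2 x = x + x"
  by (cases x; simp add: affine_scale_def vec_eq_iff zero_prod_def)+

definition imag :: "rat \<Rightarrow> 'n::finite affine_vec" where
  "imag c = (0, c, 0)"

lemma imag_add: "imag (c + d) = imag c + imag d" and imag_0 [simp]: "imag 0 = 0"
  and imag_minus: "imag (- c) = - imag c" and imag_diff: "imag (c - d) = imag c - imag d"
  and imag_eq_0 [simp]: "imag c = 0 \<longleftrightarrow> c = 0"
  and fst_imag [simp]: "fst (imag c) = 0" and level_imag [simp]: "fst (snd (imag c)) = c"
  by (simp_all add: imag_def zero_prod_def)

abbreviation level :: "'n::finite affine_vec \<Rightarrow> rat" where
  "level x \<equiv> fst (snd x)"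

context rat_inner
begin

lemma affine_form_sym: "affine_form ip x y = affine_form ip y x"
  by (cases x; cases y) (simp add: affine_form_def ip_sym mult.commute)

lemma affine_form_add_left [simp]: "affine_form ip (x + y) z = affine_form ip x z + affine_form ip y z"
  by (cases x; cases y; cases z) (simp add: affine_form_def algebra_simps)

lemma affine_form_scale_left [simp]: "affine_form ip (affine_scale c x) y = c * affine_form ip x y"
  by (cases x; cases y) (simp add: affine_form_def affine_scale_def algebra_simps)

lemma affine_form_add_right [simp]: "affine_form ip z (x + y) = affine_form ip z x + affine_form ip z y"
  by (metis affine_form_sym affine_form_add_left)

lemma affine_form_scale_right [simp]: "affine_form ip x (affine_scale c y) = c * affine_form ip x y"
  by (metis affine_form_sym affine_form_scale_left)

lemma affine_form_minus_left [simp]: "affine_form ip (- x) y = - affine_form ip x y"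
  by (cases x; cases y) (simp add: affine_form_def)

lemma affine_form_minus_right [simp]: "affine_form ip x (- y) = - affine_form ip x y"
  by (metis affine_form_sym affine_form_minus_left)

lemma affine_form_diff_left [simp]: "affine_form ip (x - y) z = affine_form ip x z - affine_form ip y z"
  by (cases x; cases y; cases z) (simp add: affine_form_def algebra_simps)

lemma affine_form_diff_right [simp]: "affine_form ip z (x - y) = affine_form ip z x - affine_form ip z y"
  by (metis affine_form_sym affine_form_diff_left)

lemma affine_reflection_add: "affine_reflection ip a (x + y) = affine_reflection ip a x + affine_reflection ip a y"
  by (simp add: affine_reflection_def affine_scale_add_left add_divide_distrib distrib_left)

lemma affine_reflection_scale:
  "affine_reflection ip a (affine_scale c x) = affine_scale c (affine_reflection ip a x)"
  by (simp add: affine_reflection_def affine_scale_diff_right affine_scale_scale mult.left_commute)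

lemma affine_reflection_form:
  assumes "affine_form ip a a \<noteq> 0"
  shows "affine_form ip (affine_reflection ip a x) (affine_reflection ip a y) = affine_form ip x y"
  using assms by (simp add: affine_reflection_def affine_form_sym[of a y] field_simps)

lemma affine_reflection_self:
  assumes "affine_form ip a a \<noteq> 0"
  shows "affine_reflection ip a a = - a"
  using assms by (simp add: affine_reflection_def)

lemma affine_reflection_involution:
  assumes "affine_form ip a a \<noteq> 0"
  shows "affine_reflection ip a (affine_reflection ip a x) = x"
proof -
  define c where "c = 2 * affine_form ip x a / affine_form ip a a"
  have "affine_form ip (affine_reflection ip a x) a = - affine_form ip x a"
    using assms by (simp add: affine_reflection_def)
  then have "affine_reflection ip a (affine_reflection ip a x) = x - affine_scale c a - affine_scale (- c) a"
    by (simp add: affine_reflection_def[of ip a "affine_reflection ip a x"])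
      (simp add: affine_reflection_def c_def)
  moreover have "affine_scale (- c) a = - affine_scale c a"
    by (cases a) (simp add: affine_scale_def)
  ultimately show ?thesis by simp
qed

lemma affine_reflection_conj:
  assumes add: "\<And>x y. w (x + y) = w x + w y"
    and scale: "\<And>c x. w (affine_scale c x) = affine_scale c (w x)"
    and form: "\<And>x y. affine_form ip (w x) (w y) = affine_form ip x y"
  shows "w (affine_reflection ip a x) = affine_reflection ip (w a) (w x)"
proof -
  have "w (x - affine_scale c a) = w x - affine_scale c (w a)" for c
    using add[of "x - affine_scale c a" "affine_scale c a"] by (simp add: scale algebra_simps)
  then show ?thesis by (simp add: affine_reflection_def form)
qed

end

section \<open>Groups generated by involutions\<close>

definition comp_list :: "('a \<Rightarrow> 'a) list \<Rightarrow> 'a \<Rightarrow> 'a" where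
  "comp_list fs = foldr (\<circ>) fs id"

lemma comp_list_simps [simp]: "comp_list [] = id" "comp_list (f # fs) = f \<circ> comp_list fs"
  by (simp_all only: comp_list_def foldr.simps id_apply o_apply)

lemma comp_list_append: "comp_list (fs @ gs) = comp_list fs \<circ> comp_list gs"
  by (induction fs) (simp_all only: append.simps comp_list_simps id_comp o_assoc)

text \<open>Inverses add nothing, since each generator is its own inverse, and on
  \<open>UNIV\<close> the product of \<open>BijGroup\<close> is plain composition. Both Weyl groups
  thereby become sets of words.\<close>

lemma generate_involutions:
  fixes G :: "('a \<Rightarrow> 'a) set"
  assumes inv: "\<And>g x. g \<in> G \<Longrightarrow> g (g x) = x"
  shows "generate (BijGroup UNIV) G = {comp_list fs | fs. set fs \<subseteq> G}"
proof -
  have Bij_iff: "f \<in> Bij UNIV \<longleftrightarrow> bij f" for f :: "'a \<Rightarrow> 'a"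
    by (simp add: Bij_def)
  have bij: "g \<in> Bij UNIV" if "g \<in> G" for g
    unfolding Bij_iff using inv[OF that] by (intro o_bij[of g g]) auto
  have bijs: "comp_list fs \<in> Bij UNIV" if "set fs \<subseteq> G" for fs
    using that
  proof (induction fs)
    case Nil then show ?case unfolding Bij_iff by simp
  next
    case (Cons g fs)
    then show ?case using bij[of g] unfolding Bij_iff comp_list_simps by (intro bij_comp) auto
  qed
  have mult: "f \<otimes>\<^bsub>BijGroup UNIV\<^esub> g = f \<circ> g" if "f \<in> Bij UNIV" "g \<in> Bij UNIV" for f g
    using that by (auto simp: BijGroup_def compose_def)
  have one: "\<one>\<^bsub>BijGroup UNIV\<^esub> = (id :: 'a \<Rightarrow> 'a)"
    by (auto simp: BijGroup_def)
  have inverse: "inv\<^bsub>BijGroup UNIV\<^esub> g = g" if "g \<in> G" for g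
  proof (rule group.inv_equality[OF group_BijGroup])
    show "g \<otimes>\<^bsub>BijGroup UNIV\<^esub> g = \<one>\<^bsub>BijGroup UNIV\<^esub>"
      using mult[OF bij[OF that] bij[OF that]] inv[OF that] by (auto simp: one)
  qed (use bij[OF that] in \<open>auto simp: BijGroup_def\<close>)
  show ?thesis
  proof (intro equalityI subsetI)
    fix w assume "w \<in> generate (BijGroup UNIV) G"
    then have "\<exists>fs. w = comp_list fs \<and> set fs \<subseteq> G"
    proof induction
      case one
      show ?case by (intro exI[of _ "[]"]) (simp add: \<open>\<one>\<^bsub>BijGroup UNIV\<^esub> = id\<close>)
    next
      case (incl h) then show ?case by (intro exI[of _ "[h]"]) simp
    next
      case (inv h) then show ?case by (intro exI[of _ "[h]"]) (simp add: inverse)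
    next
      case (eng f g)
      then obtain fs gs where "f = comp_list fs" "set fs \<subseteq> G" "g = comp_list gs" "set gs \<subseteq> G" by auto
      then show ?case using mult[OF bijs bijs, of fs gs] by (intro exI[of _ "fs @ gs"]) (simp add: comp_list_append)
    qed
    then show "w \<in> {comp_list fs | fs. set fs \<subseteq> G}" by auto
  next
    fix w assume "w \<in> {comp_list fs | fs. set fs \<subseteq> G}"
    then obtain fs where w: "w = comp_list fs" "set fs \<subseteq> G" by auto
    have "comp_list fs \<in> generate (BijGroup UNIV) G"
      using w(2)
    proof (induction fs)
      case Nil
      have "\<one>\<^bsub>BijGroup UNIV\<^esub> \<in> generate (BijGroup UNIV) G" by (rule generate.one)
      then show ?case by (simp only: one comp_list_simps)
    next
      case (Cons g fs)
      have "g \<otimes>\<^bsub>BijGroup UNIV\<^esub> comp_list fs \<in> generate (BijGroup UNIV) G"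
        by (rule generate.eng[OF generate.incl Cons.IH]) (use Cons.prems in simp_all)
      moreover have "g \<otimes>\<^bsub>BijGroup UNIV\<^esub> comp_list fs = g \<circ> comp_list fs"
        by (rule mult[OF bij bijs]) (use Cons.prems in simp_all)
      ultimately show ?case by (simp only: comp_list_simps)
    qed
    then show "w \<in> generate (BijGroup UNIV) G" by (simp add: w)
  qed
qed

context root_system
begin

section \<open>Affine real roots and their height\<close>

abbreviation "\<Pi>a \<equiv> affine_simple_roots \<Delta> S"
abbreviation "\<Phi>a \<equiv> affine_pos_roots \<Delta> S"
abbreviation "sref \<equiv> affine_reflection ip"

definition real_roots :: "'n affine_vec set" where
  "real_roots = {(\<beta>, of_int k, 0) | \<beta> k. \<beta> \<in> \<Delta>}"

lemma real_rootE:
  assumes "x \<in> real_roots"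
  obtains \<beta> k where "x = (\<beta>, of_int k, 0)" "\<beta> \<in> \<Delta>"
  using assms by (auto simp: real_roots_def)

lemma real_rootI: "\<beta> \<in> \<Delta> \<Longrightarrow> (\<beta>, of_int k, 0) \<in> real_roots"
  by (auto simp: real_roots_def)

lemma real_rootI0: "\<beta> \<in> \<Delta> \<Longrightarrow> (\<beta>, 0, 0) \<in> real_roots"
  using real_rootI[of \<beta> 0] by simp

lemma real_rootI1: "\<beta> \<in> \<Delta> \<Longrightarrow> (\<beta>, -1, 0) \<in> real_roots" "\<beta> \<in> \<Delta> \<Longrightarrow> (\<beta>, 1, 0) \<in> real_roots"
  using real_rootI[of \<beta> "-1"] real_rootI[of \<beta> 1] by simp_all

lemma uminus_real_root: "x \<in> real_roots \<Longrightarrow> - x \<in> real_roots"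
proof (elim real_rootE)
  fix \<beta> k assume "x = (\<beta>, of_int k, 0)" "\<beta> \<in> \<Delta>"
  then show "- x \<in> real_roots" using real_rootI[of "- \<beta>" "- k"] by simp
qed

lemma fst_real_root: "x \<in> real_roots \<Longrightarrow> fst x \<in> \<Delta>"
  by (auto elim: real_rootE)

lemma level_real_root: "x \<in> real_roots \<Longrightarrow> level x \<in> \<int>"
  by (auto elim: real_rootE)

lemma affine_form_real: "x \<in> real_roots \<Longrightarrow> y \<in> real_roots \<Longrightarrow> affine_form ip x y = ip (fst x) (fst y)"
  by (auto elim!: real_rootE simp: affine_form_def)

lemma real_root_form_pos: "x \<in> real_roots \<Longrightarrow> affine_form ip x x > 0"
  using affine_form_real root_pos fst_real_root by simp

lemma real_root_nonzero: "x \<in> real_roots \<Longrightarrow> x \<noteq> 0"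
  using fst_real_root root_nonzero by fastforce

text \<open>The linear functional with value 1 on every affine simple root. Since \<delta> is the
  sum of \<theta> and the affine simple root \<delta> - \<theta>, its value on \<delta> must be
  \<open>1 + ht \<theta>\<close>, the Coxeter number; the \<lambda>-component is ignored.\<close>

definition aht :: "'n affine_vec \<Rightarrow> rat" where
  "aht x = ht (fst x) + level x * (1 + ht \<theta>)"

lemma aht_add [simp]: "aht (x + y) = aht x + aht y"
  and aht_minus [simp]: "aht (- x) = - aht x"
  and aht_diff [simp]: "aht (x - y) = aht x - aht y"
  and aht_zero [simp]: "aht 0 = 0"
  by (simp_all add: aht_def algebra_simps)

lemma ht_highest_root_pos: "ht \<theta> \<ge> 1"
  using ht_pos_root highest_root_pos by blast

lemma ht_abs: "\<beta> \<in> \<Delta> \<Longrightarrow> \<bar>ht \<beta>\<bar> \<le> ht \<theta>"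
  using ht_highest_root(1)[of \<beta>] ht_highest_root(1)[of "- \<beta>"] by auto

lemma aht_int: "x \<in> real_roots \<Longrightarrow> aht x \<in> \<int>"
  unfolding aht_def using ht_int[OF fst_real_root] ht_int[OF highest_root(1)] level_real_root by auto

lemma affine_pos_real: "x \<in> \<Phi>a \<Longrightarrow> x \<in> real_roots"
  using pos_rootD real_rootI0 real_rootI by (auto simp: affine_pos_roots_def)

lemma aht_level_pos:
  assumes "\<beta> \<in> \<Delta>" "(1::int) \<le> k"
  shows "aht (\<beta>, of_int k, 0) > 0"
proof -
  have "1 * (1 + ht \<theta>) \<le> of_int k * (1 + ht \<theta>)"
    using assms ht_highest_root_pos by (intro mult_right_mono) auto
  then show ?thesis using ht_abs[OF assms(1)] by (simp add: aht_def)
qed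

text \<open>Finite heights are at most \<open>ht \<theta>\<close> in absolute value, which is less
  than the weight \<open>1 + ht \<theta>\<close> of one level. So the level decides the sign, and
  the finite height does so only on level 0.\<close>

lemma affine_pos_iff:
  assumes "x \<in> real_roots"
  shows "x \<in> \<Phi>a \<longleftrightarrow> aht x > 0"
proof -
  obtain \<beta> k where x: "x = (\<beta>, of_int k, 0)" "\<beta> \<in> \<Delta>" using assms by (rule real_rootE)
  consider "k \<ge> 1" | "k = 0" | "k \<le> -1" by linarith
  then show ?thesis
  proof cases
    case 1
    then have "x \<in> \<Phi>a" using x by (auto simp: affine_pos_roots_def)
    then show ?thesis using aht_level_pos[OF x(2) 1] x(1) by simp
  next
    case 2
    then have "x \<in> \<Phi>a \<longleftrightarrow> \<beta> \<in> \<Phi>p" using x by (auto simp: affine_pos_roots_def)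
    then show ?thesis using 2 x pos_root_iff by (simp add: aht_def)
  next
    case 3
    then have "x \<notin> \<Phi>a" using x by (auto simp: affine_pos_roots_def)
    moreover have "- x = (- \<beta>, of_int (- k), 0)" using x by simp
    then have "aht (- x) > 0" using aht_level_pos[of "- \<beta>" "- k"] x(2) 3 by (simp del: aht_minus)
    ultimately show ?thesis by simp
  qed
qed

lemma aht_nonzero: "x \<in> real_roots \<Longrightarrow> aht x \<noteq> 0"
proof -
  assume "x \<in> real_roots"
  then obtain \<beta> k where x: "x = (\<beta>, of_int k, 0)" "\<beta> \<in> \<Delta>" by (rule real_rootE)
  have mx: "- x = (- \<beta>, of_int (- k), 0)" using x by simp
  consider "k \<ge> 1" | "k = 0" | "- k \<ge> 1" by linarith
  then show ?thesis
  proof cases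
    case 1 then show ?thesis using aht_level_pos[OF x(2) 1] x(1) by simp
  next
    case 2
    then show ?thesis
      using x ht_pos_root[of \<beta>] ht_pos_root[of "- \<beta>"] uminus_pos_root_iff[of \<beta>] by (auto simp: aht_def)
  next
    case 3
    then have "aht (- x) > 0" using aht_level_pos[of "- \<beta>" "- k"] x(2) mx by (simp del: aht_minus)
    then show ?thesis by simp
  qed
qed

lemma affine_neg_iff:
  assumes "x \<in> real_roots"
  shows "x \<in> uminus ` \<Phi>a \<longleftrightarrow> aht x < 0" "x \<notin> \<Phi>a \<longleftrightarrow> aht x < 0"
proof -
  have "x \<in> uminus ` \<Phi>a \<longleftrightarrow> - x \<in> \<Phi>a" by force
  then show "x \<in> uminus ` \<Phi>a \<longleftrightarrow> aht x < 0"
    using affine_pos_iff[OF uminus_real_root[OF assms]] by simp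
  show "x \<notin> \<Phi>a \<longleftrightarrow> aht x < 0"
    using affine_pos_iff[OF assms] aht_nonzero[OF assms] by linarith
qed

lemma aht_pos: "x \<in> real_roots \<Longrightarrow> aht x > 0 \<Longrightarrow> aht x \<ge> 1"
  using aht_int[of x] by (auto elim!: Ints_cases)

lemma affine_simple_cases:
  assumes "a \<in> \<Pi>a"
  obtains b where "a = (b, 0, 0)" "b \<in> S" | "a = (- \<theta>, 1, 0)"
  using assms by (auto simp: affine_simple_roots_def)

lemma affine_simpleI: "b \<in> S \<Longrightarrow> (b, 0, 0) \<in> \<Pi>a" "(- \<theta>, 1, 0) \<in> \<Pi>a"
  by (auto simp: affine_simple_roots_def)

lemma affine_simple_real: "a \<in> \<Pi>a \<Longrightarrow> a \<in> real_roots"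
  using simple_subset real_rootI0 real_rootI1 highest_root(1) by (auto elim!: affine_simple_cases)

lemma aht_simple: "a \<in> \<Pi>a \<Longrightarrow> aht a = 1"
  by (auto elim!: affine_simple_cases simp: aht_def ht_simple)

text \<open>The bound on finite heights leaves only levels 0 and 1. On level 1 the finite height has
  to be \<open>- ht \<theta>\<close>, which only the lowest root attains.\<close>

lemma aht_1_simple:
  assumes "x \<in> real_roots" "aht x = 1"
  shows "x \<in> \<Pi>a"
proof -
  obtain \<beta> k where x: "x = (\<beta>, of_int k, 0)" "\<beta> \<in> \<Delta>" using assms(1) by (rule real_rootE)
  have eq: "ht \<beta> + of_int k * (1 + ht \<theta>) = 1" using assms(2) x by (simp add: aht_def)
  have "x \<in> \<Phi>a" using assms affine_pos_iff by simp
  then have "k \<ge> 0" using x by (auto simp: affine_pos_roots_def)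
  moreover have "k < 2"
  proof (rule ccontr)
    assume "\<not> k < 2"
    define m where "m = of_int k * (1 + ht \<theta>)"
    have "2 * (1 + ht \<theta>) \<le> m"
      unfolding m_def using ht_highest_root_pos \<open>\<not> k < 2\<close> by (intro mult_right_mono) auto
    moreover have "ht \<beta> + m = 1" using eq by (simp add: m_def)
    ultimately show False using ht_abs[OF x(2)] ht_highest_root_pos by simp
  qed
  ultimately consider "k = 0" | "k = 1" by linarith
  then show ?thesis
  proof cases
    case 1
    then have "\<beta> \<in> \<Phi>p" "ht \<beta> = 1" using eq pos_root_iff[OF x(2)] by auto
    then have "\<beta> \<in> S" using ht_1_nonneg_comb pos_rootD by blast
    then show ?thesis using 1 x affine_simpleI by simp
  next
    case 2
    then have "ht (- \<beta>) = ht \<theta>" using eq by simp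
    then have "- \<beta> = \<theta>" using ht_highest_root(2)[of "- \<beta>"] x(2) by simp
    then show ?thesis using 2 x affine_simpleI by (simp flip: \<open>- \<beta> = \<theta>\<close>)
  qed
qed

text \<open>The finite parts of the affine simple roots satisfy a linear relation with only positive
  coefficients. If all pairings with \<beta> were nonpositive, the relation would force them to
  vanish, and \<beta> would be orthogonal to a spanning set.\<close>

lemma exists_acute_affine_simple:
  assumes "\<beta> \<in> \<Delta>"
  shows "\<exists>a\<in>\<Pi>a. ip \<beta> (fst a) > 0"
proof (rule ccontr)
  assume "\<not> ?thesis"
  then have *: "\<And>a. a \<in> \<Pi>a \<Longrightarrow> ip \<beta> (fst a) \<le> 0" by force
  have nonpos: "ip \<beta> a \<le> 0" if "a \<in> S" for a using *[OF affine_simpleI(1)[OF that]] by simp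
  have "0 \<le> ip \<beta> \<theta>" using *[OF affine_simpleI(2)] by simp
  also have "\<dots> = (\<Sum>a\<in>S. cf \<theta> a * ip \<beta> a)"
    by (subst cf_sum[of \<theta>, symmetric]) (simp add: ip_sum_right)
  finally have sum_ge: "(\<Sum>a\<in>S. cf \<theta> a * - ip \<beta> a) \<le> 0" by (simp add: sum_negf)
  have zero: "ip \<beta> a = 0" if a: "a \<in> S" for a
  proof -
    have "cf \<theta> a * - ip \<beta> a \<le> (\<Sum>a\<in>S. cf \<theta> a * - ip \<beta> a)"
    proof (rule member_le_sum[OF a _ finite_simple])
      fix b assume "b \<in> S - {a}"
      then show "0 \<le> cf \<theta> b * - ip \<beta> b"
        using nonpos highest_root_coeff[of b] by (intro mult_nonneg_nonneg) auto
    qed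
    then have "cf \<theta> a * - ip \<beta> a \<le> 0" using sum_ge by simp
    then have "ip \<beta> a \<ge> 0" using highest_root_coeff[OF a] by (simp add: zero_le_mult_iff)
    then show ?thesis using nonpos[OF a] by simp
  qed
  have "ip \<beta> \<beta> = 0"
    using ip_span_eq_0[of \<beta> S \<beta>] span_simple zero by simp
  then show False using assms root_nonzero by simp
qed

lemma sref_real: "a \<in> real_roots \<Longrightarrow> x \<in> real_roots \<Longrightarrow> sref a x \<in> real_roots"
proof -
  assume ax: "a \<in> real_roots" "x \<in> real_roots"
  obtain \<alpha> k where a: "a = (\<alpha>, of_int k, 0)" "\<alpha> \<in> \<Delta>" using ax(1) by (rule real_rootE)
  obtain \<beta> j where x: "x = (\<beta>, of_int j, 0)" "\<beta> \<in> \<Delta>" using ax(2) by (rule real_rootE)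
  have c: "ip \<beta> (coroot ip \<alpha>) = 2 * ip \<beta> \<alpha> / ip \<alpha> \<alpha>" by (simp add: coroot_def)
  obtain n where n: "ip \<beta> (coroot ip \<alpha>) = of_int n"
    using cartan_int[OF a(2) x(2)] by (rule Ints_cases)
  have "sref a x = (root_reflection ip \<alpha> \<beta>, of_int (j - n * k), 0)"
    unfolding a x affine_reflection_def root_reflection_def affine_scale_def affine_form_def
    by (simp flip: n) (simp add: c)
  then show ?thesis using reflection_root[OF a(2) x(2)] real_rootI by metis
qed

text \<open>The expression is the coefficient of \<open>x\<close> at the simple root
  \<open>a\<close> when \<open>x\<close> is written in affine simple roots: each \<delta>
  contributes a copy of \<theta>.\<close>

lemma affine_pos_coeff: "x \<in> \<Phi>a \<Longrightarrow> a \<in> S \<Longrightarrow> cf (fst x) a + level x * cf \<theta> a \<ge> 0"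
proof -
  assume x: "x \<in> \<Phi>a" and a: "a \<in> S"
  have t: "cf \<theta> a \<ge> 1" using highest_root_coeff a by simp
  from x consider \<beta> where "x = (\<beta>, 0, 0)" "\<beta> \<in> \<Phi>p" | \<beta> k where "x = (\<beta>, of_int k, 0)" "\<beta> \<in> \<Delta>" "k \<ge> (1::int)"
    by (auto simp: affine_pos_roots_def)
  then show ?thesis
  proof cases
    case 1 then show ?thesis using nonneg_comb_ge[OF pos_rootD(2) a] by simp
  next
    case 2
    have "cf (\<theta> - - \<beta>) a \<ge> 0" using 2 a by (intro nonneg_comb_ge highest_root) auto
    moreover have "1 * cf \<theta> a \<le> of_int k * cf \<theta> a" using 2 t by (intro mult_right_mono) auto
    ultimately show ?thesis using 2 by simp
  qed
qed

text \<open>Only the coefficient at \<open>a\<close> changes. For a finite \<open>a\<close> the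
  level is preserved, which reduces the claim to the finite case. For \<delta> - \<theta>, if
  \<open>x\<close> and \<open>- sref a x\<close> were both positive, all other coefficients would be
  both nonnegative and nonpositive; then \<beta> is a multiple of \<theta>, and reducedness gives
  \<open>x = a\<close>.\<close>

lemma sref_simple_pos:
  assumes a: "a \<in> \<Pi>a" and x: "x \<in> \<Phi>a" "x \<noteq> a"
  shows "sref a x \<in> \<Phi>a"
proof (rule ccontr)
  assume "sref a x \<notin> \<Phi>a"
  moreover have R: "sref a x \<in> real_roots" using sref_real affine_simple_real a affine_pos_real x by simp
  ultimately have neg: "- sref a x \<in> \<Phi>a" using affine_neg_iff affine_pos_iff uminus_real_root by simp
  obtain \<beta> k where xb: "x = (\<beta>, of_int k, 0)" "\<beta> \<in> \<Delta>" using affine_pos_real[OF x(1)] by (rule real_rootE)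
  have k0: "k \<ge> 0" using x(1) xb by (auto simp: affine_pos_roots_def)
  show False
    using a
  proof (cases rule: affine_simple_cases)
    case (1 b)
    have eq: "sref a x = (root_reflection ip b \<beta>, of_int k, 0)"
      by (simp add: affine_reflection_def affine_scale_def affine_form_def 1 xb root_reflection_def coroot_def)
    then have "k \<le> 0" using neg by (auto simp: affine_pos_roots_def minus_equation_iff)
    then have k: "k = 0" using k0 by simp
    then have "\<beta> \<in> \<Phi>p" "\<beta> \<noteq> b" using x xb 1 by (auto simp: affine_pos_roots_def)
    then have "root_reflection ip b \<beta> \<in> \<Phi>p" using simple_reflection_pos 1 by blast
    then have "sref a x \<in> \<Phi>a" using eq k by (auto simp: affine_pos_roots_def)
    then show False using \<open>sref a x \<notin> \<Phi>a\<close> by simp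
  next
    case 2
    define n where "n = 2 * affine_form ip x a / affine_form ip a a"
    have eq: "sref a x = (\<beta> + n *s \<theta>, of_int k - n, 0)"
      by (simp add: affine_reflection_def flip: n_def) (simp add: affine_scale_def 2 xb)
    have "cf \<beta> b + of_int k * cf \<theta> b = 0" if "b \<in> S" for b
      using affine_pos_coeff[OF x(1) that] affine_pos_coeff[OF neg that]
      by (simp add: eq[unfolded xb] xb algebra_simps)
    then have \<beta>: "\<beta> = (- of_int k) *s \<theta>"
      by (intro cf_eqI) (simp add: eq_neg_iff_add_eq_0)
    then have "- (of_int k :: rat) = 1 \<or> - (of_int k :: rat) = -1"
      using reduced[OF highest_root(1)] xb(2) by metis
    then have "(of_int k :: rat) = 1" using k0 by linarith
    then show False using \<beta> x(2) 2 xb by (simp add: vec_eq_iff)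
  qed
qed

lemma sref_involution: "a \<in> real_roots \<Longrightarrow> sref a (sref a x) = x"
  by (metis affine_reflection_involution real_root_form_pos less_irrefl)

lemma sref_self: "a \<in> real_roots \<Longrightarrow> sref a a = - a"
  by (metis affine_reflection_self real_root_form_pos less_irrefl)

section \<open>Words in the simple reflections and the exchange property\<close>

definition word :: "'n affine_vec list \<Rightarrow> 'n affine_vec \<Rightarrow> 'n affine_vec" where
  "word as = comp_list (map sref as)"

lemma word_Nil [simp]: "word [] = id" and word_Cons [simp]: "word (a # as) = sref a \<circ> word as"
  by (simp_all add: word_def)

lemma word_append: "word (as @ bs) = word as \<circ> word bs"
  by (simp add: word_def comp_list_append)

abbreviation "Wa \<equiv> affine_weyl_group ip \<Delta> S"

lemma Wa_word: "Wa = {word as | as. set as \<subseteq> \<Pi>a}"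
proof -
  have "Wa = {comp_list fs | fs. set fs \<subseteq> sref ` \<Pi>a}"
    unfolding affine_weyl_group_def
    by (rule generate_involutions) (auto simp: sref_involution affine_simple_real)
  also have "\<dots> = {word as | as. set as \<subseteq> \<Pi>a}"
  proof -
    have "\<exists>as. set as \<subseteq> \<Pi>a \<and> fs = map sref as" if "set fs \<subseteq> sref ` \<Pi>a" for fs
      using that
    proof (induction fs)
      case (Cons f fs)
      then obtain a as where "a \<in> \<Pi>a" "f = sref a" "set as \<subseteq> \<Pi>a" "fs = map sref as" by auto
      then show ?case by (intro exI[of _ "a # as"]) simp
    qed simp
    moreover have "set (map sref as) \<subseteq> sref ` \<Pi>a" if "set as \<subseteq> \<Pi>a" for as
      using that by (simp add: image_mono)
    ultimately show ?thesis unfolding word_def by blast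
  qed
  finally show ?thesis .
qed

lemma Wa_id: "id \<in> Wa"
  unfolding Wa_word by (auto intro!: exI[of _ "[]"])

lemma Wa_comp: "u \<in> Wa \<Longrightarrow> w \<in> Wa \<Longrightarrow> u \<circ> w \<in> Wa"
proof -
  assume "u \<in> Wa" "w \<in> Wa"
  then obtain as bs where "u = word as" "w = word bs" "set as \<subseteq> \<Pi>a" "set bs \<subseteq> \<Pi>a" by (auto simp: Wa_word)
  then show ?thesis unfolding Wa_word by (auto intro!: exI[of _ "as @ bs"] simp: word_append)
qed

lemma Wa_refl: "a \<in> \<Pi>a \<Longrightarrow> sref a \<in> Wa"
  unfolding Wa_word by (auto intro!: exI[of _ "[a]"])

lemma Wa_induct [consumes 1, case_names id left]:
  assumes "w \<in> Wa" "P id" "\<And>a w. a \<in> \<Pi>a \<Longrightarrow> w \<in> Wa \<Longrightarrow> P w \<Longrightarrow> P (sref a \<circ> w)"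
  shows "P w"
proof -
  obtain as where "w = word as" "set as \<subseteq> \<Pi>a" using assms(1) by (auto simp: Wa_word)
  then show ?thesis
  proof (induction as arbitrary: w)
    case Nil
    then have "w = id" by (simp only: word_Nil)
    then show ?case using assms(2) by (simp only:)
  next
    case (Cons a as)
    have w: "w = sref a \<circ> word as" using Cons.prems by (simp only: word_Cons)
    have "P (word as)" using Cons by simp
    then show ?case
      unfolding w using Cons.prems by (intro assms(3)) (auto simp: Wa_word)
  qed
qed

lemma Wa_add: "w \<in> Wa \<Longrightarrow> w (x + y) = w x + w y"
  by (induction rule: Wa_induct) (auto simp: affine_reflection_add)

lemma Wa_scale: "w \<in> Wa \<Longrightarrow> w (affine_scale c x) = affine_scale c (w x)"
  by (induction rule: Wa_induct) (auto simp: affine_reflection_scale)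

lemma Wa_form: "w \<in> Wa \<Longrightarrow> affine_form ip (w x) (w y) = affine_form ip x y"
proof (induction rule: Wa_induct)
  case (left a w)
  then show ?case using affine_reflection_form[of a] real_root_form_pos[of a] affine_simple_real by simp
qed simp

lemma Wa_imag: "w \<in> Wa \<Longrightarrow> w (imag c) = imag c"
proof (induction rule: Wa_induct)
  case (left a w)
  have "affine_form ip (imag c) a = 0"
    using affine_simple_real[OF left(1)] by (auto elim!: real_rootE simp: imag_def affine_form_def)
  then show ?case using left by (simp add: affine_reflection_def)
qed simp

lemma Wa_real: "w \<in> Wa \<Longrightarrow> x \<in> real_roots \<Longrightarrow> w x \<in> real_roots"
  by (induction rule: Wa_induct) (auto simp: sref_real affine_simple_real)

lemma Wa_minus: "w \<in> Wa \<Longrightarrow> w (- x) = - w x"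
  using Wa_scale[of w "-1" x] by simp

lemma Wa_diff: "w \<in> Wa \<Longrightarrow> w (x - y) = w x - w y"
  using Wa_add[of w x "- y"] Wa_minus by simp

lemma Wa_zero: "w \<in> Wa \<Longrightarrow> w 0 = 0"
  using Wa_imag[of w 0] by simp

lemma Wa_conj: "w \<in> Wa \<Longrightarrow> w (sref a x) = sref (w a) (w x)"
  by (intro affine_reflection_conj Wa_add Wa_scale Wa_form)

lemma Wa_inverse: "w \<in> Wa \<Longrightarrow> \<exists>u\<in>Wa. u \<circ> w = id \<and> w \<circ> u = id"
proof (induction rule: Wa_induct)
  case id then show ?case using Wa_id by (intro bexI[of _ id]) auto
next
  case (left a w)
  then obtain u where u: "u \<in> Wa" "u \<circ> w = id" "w \<circ> u = id" by blast
  have r: "sref a (sref a x) = x" for x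
    using sref_involution affine_simple_real left(1) by blast
  have uw: "u (w x) = x" "w (u x) = x" for x
    using fun_cong[OF u(2), of x] fun_cong[OF u(3), of x] by (simp_all only: comp_apply id_apply)
  have "u \<circ> sref a \<in> Wa" using u left by (intro Wa_comp Wa_refl)
  moreover have "(u \<circ> sref a) \<circ> (sref a \<circ> w) = id" "(sref a \<circ> w) \<circ> (u \<circ> sref a) = id"
    by (rule ext, simp only: comp_apply id_apply uw r)+
  ultimately show ?case by blast
qed

lemma Wa_bij: "w \<in> Wa \<Longrightarrow> bij w"
  using Wa_inverse o_bij by blast

abbreviation winv :: "('n affine_vec \<Rightarrow> 'n affine_vec) \<Rightarrow> 'n affine_vec \<Rightarrow> 'n affine_vec" where
  "winv w \<equiv> inv_into UNIV w"

lemma winv_Wa: "w \<in> Wa \<Longrightarrow> winv w \<in> Wa"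
  using Wa_inverse inv_unique_comp by metis

lemma winv_left [simp]: "w \<in> Wa \<Longrightarrow> winv w (w x) = x"
  using Wa_bij bij_inv_eq_iff by metis

lemma winv_right [simp]: "w \<in> Wa \<Longrightarrow> w (winv w x) = x"
  using Wa_bij bij_inv_eq_iff by metis

lemma Wa_eq_iff: "w \<in> Wa \<Longrightarrow> w x = w y \<longleftrightarrow> x = y"
  by (metis winv_left)

text \<open>Apply the letters from the right: at some letter \<open>a\<close> the image of
  \<open>b\<close> turns negative. Since \<open>sref a\<close> makes no positive root but
  \<open>a\<close> negative, the image just before that letter is \<open>a\<close> itself.\<close>

lemma word_exchange:
  assumes "set as \<subseteq> \<Pi>a" "b \<in> \<Pi>a" "- word as b \<in> \<Phi>a"
  shows "\<exists>p a q. as = p @ a # q \<and> word q b = a"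
  using assms
proof (induction as)
  case Nil
  then show ?case using affine_pos_iff[of "- b"] uminus_real_root affine_simple_real aht_simple[of b] by simp
next
  case (Cons a as)
  have "word as \<in> Wa" using Cons.prems by (auto simp: Wa_word)
  then have R: "word as b \<in> real_roots" using Cons.prems Wa_real affine_simple_real by blast
  show ?case
  proof (cases "- word as b \<in> \<Phi>a")
    case True
    then obtain p c q where "as = p @ c # q" "word q b = c" using Cons by auto
    then show ?thesis by (intro exI[of _ "a # p"] exI[of _ c] exI[of _ q]) simp
  next
    case False
    then have pos: "word as b \<in> \<Phi>a"
      using affine_pos_iff[OF uminus_real_root[OF R]] affine_pos_iff[OF R] aht_nonzero[OF R] by force
    have neg: "- sref a (word as b) \<in> \<Phi>a" using Cons.prems by simp
    have "word as b = a"
    proof (rule ccontr)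
      assume "word as b \<noteq> a"
      then have "sref a (word as b) \<in> \<Phi>a" using sref_simple_pos pos Cons.prems by simp
      then show False
        using neg affine_pos_iff affine_pos_real by (metis aht_minus less_asym neg_less_0_iff_less)
    qed
    then show ?thesis by (intro exI[of _ "[]"] exI[of _ a] exI[of _ as]) simp
  qed
qed

text \<open>By the exchange property, the last letter of a word that inverts no simple root cancels an earlier one.\<close>

lemma word_positive_eq_id:
  assumes "set as \<subseteq> \<Pi>a" "\<And>b. b \<in> \<Pi>a \<Longrightarrow> word as b \<in> \<Phi>a"
  shows "word as = id"
  using assms
proof (induction "length as" arbitrary: as rule: less_induct)
  case less
  show ?case
  proof (cases as rule: rev_cases)
    case Nil then show ?thesis by simp
  next
    case (snoc bs b)
    then have b: "b \<in> \<Pi>a" and bs: "set bs \<subseteq> \<Pi>a" using less.prems by auto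
    have bR: "b \<in> real_roots" using b affine_simple_real by blast
    have "word bs \<in> Wa" using bs by (auto simp: Wa_word)
    then have "word as b = - word bs b"
      using snoc by (simp add: word_append sref_self[OF bR] Wa_minus)
    then have "- word bs b \<in> \<Phi>a" using less.prems(2)[OF b] by simp
    then obtain p a q where bs_eq: "bs = p @ a # q" and a: "word q b = a" using word_exchange[OF bs b] by blast
    have q: "word q \<in> Wa" using bs bs_eq by (auto simp: Wa_word)
    have "sref a (word q (sref b x)) = word q x" for x
      using Wa_conj[OF q, of b "sref b x"] sref_involution[OF bR] a by simp
    then have "word as = word (p @ q)"
      by (auto simp: snoc bs_eq word_append)
    moreover have "word (p @ q) = id"
      using less.hyps[of "p @ q"] less.prems calculation snoc bs_eq by simp
    ultimately show ?thesis by simp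
  qed
qed

lemma Wa_positive_eq_id: "w \<in> Wa \<Longrightarrow> (\<And>b. b \<in> \<Pi>a \<Longrightarrow> w b \<in> \<Phi>a) \<Longrightarrow> w = id"
  using word_positive_eq_id by (auto simp: Wa_word)

end

section \<open>The cone spanned by an ideal\<close>

context root_system
begin

text \<open>The affine counterpart of \<open>add_root\<close>. The second alternative arises when
  the finite parts are opposite, so that only an integral multiple of \<delta> remains.\<close>

lemma real_root_add:
  assumes x: "x \<in> real_roots" and y: "y \<in> real_roots" and neg: "ip (fst x) (fst y) < 0"
  obtains "x + y \<in> real_roots" | c :: int where "x + y = imag (of_int c)"
proof -
  obtain \<alpha> k where a: "x = (\<alpha>, of_int k, 0)" "\<alpha> \<in> \<Delta>" using x by (rule real_rootE)
  obtain \<beta> j where b: "y = (\<beta>, of_int j, 0)" "\<beta> \<in> \<Delta>" using y by (rule real_rootE)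
  have eq: "x + y = (\<alpha> + \<beta>, of_int (k + j), 0)" using a b by simp
  show thesis
  proof (cases "\<alpha> + \<beta> = 0")
    case True then show thesis using eq by (intro that(2)[of "k + j"]) (simp add: imag_def)
  next
    case False
    then have "\<alpha> + \<beta> \<in> \<Delta>" using add_root[of \<alpha> \<beta>] a b neg by simp
    then show thesis using eq that(1) real_rootI by metis
  qed
qed

lemma real_root_diff:
  assumes x: "x \<in> real_roots" and y: "y \<in> real_roots" and pos: "ip (fst x) (fst y) > 0"
  obtains "x - y \<in> real_roots" | c :: int where "x - y = imag (of_int c)"
  using real_root_add[OF x uminus_real_root[OF y]] pos by auto

definition shifted :: "(rat ^ 'n) set \<Rightarrow> 'n affine_vec set" where
  "shifted I = {(\<beta>, 0, 0) | \<beta>. \<beta> \<in> \<Phi>p} \<union> {(\<gamma>, -1, 0) | \<gamma>. \<gamma> \<in> I}"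

definition ideal_cone :: "(rat ^ 'n) set \<Rightarrow> 'n affine_vec set" where
  "ideal_cone I = {sum_list ts + imag (of_nat j) | ts j. set ts \<subseteq> shifted I}"

text \<open>A functional as in \<open>positive_functional\<close> is positive on nonzero cone
  elements, so both summands then have a strictly smaller value than \<open>e\<close>.\<close>

definition decomposable :: "(rat ^ 'n) set \<Rightarrow> 'n affine_vec \<Rightarrow> bool" where
  "decomposable I e \<longleftrightarrow> (\<exists>x\<in>ideal_cone I. \<exists>y\<in>ideal_cone I. x \<noteq> 0 \<and> y \<noteq> 0 \<and> e = x + y)"

lemma ideal_cone_add:
  assumes "x \<in> ideal_cone I" "y \<in> ideal_cone I"
  shows "x + y \<in> ideal_cone I"
proof -
  obtain ts j where "x = sum_list ts + imag (of_nat j)" "set ts \<subseteq> shifted I"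
    using assms(1) by (auto simp: ideal_cone_def)
  moreover obtain us k where "y = sum_list us + imag (of_nat k)" "set us \<subseteq> shifted I"
    using assms(2) by (auto simp: ideal_cone_def)
  ultimately show ?thesis
    unfolding ideal_cone_def
    by (intro CollectI exI[of _ "ts @ us"] exI[of _ "j + k"]) (auto simp: imag_add)
qed

lemma shifted_ideal_cone: "t \<in> shifted I \<Longrightarrow> t \<in> ideal_cone I"
  unfolding ideal_cone_def by (intro CollectI exI[of _ "[t]"] exI[of _ 0]) simp

lemma imag_ideal_cone: "imag (of_nat j) \<in> ideal_cone I"
  unfolding ideal_cone_def by (intro CollectI exI[of _ "[]"] exI[of _ j]) simp

lemma sum_list_ideal_cone: "set ts \<subseteq> shifted I \<Longrightarrow> sum_list ts + imag (of_nat j) \<in> ideal_cone I"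
  unfolding ideal_cone_def by blast

lemma decomposable_ideal_cone: "decomposable I e \<Longrightarrow> e \<in> ideal_cone I"
  unfolding decomposable_def using ideal_cone_add by blast

lemma decomposableI:
  "x \<in> ideal_cone I \<Longrightarrow> y \<in> ideal_cone I \<Longrightarrow> x \<noteq> 0 \<Longrightarrow> y \<noteq> 0 \<Longrightarrow> e = x + y \<Longrightarrow> decomposable I e"
  unfolding decomposable_def by blast

lemma fst_sum_list: "fst (sum_list ts) = sum_list (map fst ts)"
  by (induction ts) auto

lemma level_sum_list: "level (sum_list ts) = sum_list (map level ts)"
  by (induction ts) auto

lemma sum_list_remove1: "t \<in> set ts \<Longrightarrow> sum_list ts = t + sum_list (remove1 t ts)"
  for ts :: "'a::ab_group_add list"
  by (induction ts) (auto simp: algebra_simps)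

end

text \<open>
  \<open>H\<close> will be the height composed with an element of the affine Weyl group that is positive
  on \<open>\<Delta>\<^sup>+\<close>.
\<close>

locale positive_functional = root_system ip \<Delta> S
  for ip :: "rat ^ 'n::finite \<Rightarrow> rat ^ 'n \<Rightarrow> rat" and \<Delta> S :: "(rat ^ 'n) set" +
  fixes H :: "'n affine_vec \<Rightarrow> rat" and I :: "(rat ^ 'n) set"
  assumes H_add: "H (x + y) = H x + H y"
    and H_imag: "H (imag 1) > 0"
    and H_pos: "\<beta> \<in> \<Phi>p \<Longrightarrow> H (\<beta>, 0, 0) > 0"
    and H_ideal: "\<gamma> \<in> I \<Longrightarrow> H (\<gamma>, -1, 0) > 0"
    and I_pos: "I \<subseteq> \<Phi>p"
begin

lemma H_zero [simp]: "H 0 = 0"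
  using H_add[of 0 0] by simp

lemma H_minus: "H (- x) = - H x"
  using H_add[of x "- x"] by simp

lemma H_imag_nat: "H (imag (of_nat n)) = of_nat n * H (imag 1)"
  by (induction n) (simp_all add: imag_add H_add algebra_simps)

lemma H_imag_int_pos: "H (imag (of_int c)) > 0 \<longleftrightarrow> c > 0"
proof (cases "c \<ge> 0")
  case True
  then obtain n where "c = int n" using nonneg_int_cases by blast
  then show ?thesis using H_imag_nat[of n] H_imag by (simp add: zero_less_mult_iff)
next
  case False
  then obtain n where "c = - int n" using nonneg_int_cases[of "- c"] by (metis add.inverse_inverse linear neg_0_le_iff_le)
  then show ?thesis
    using False H_imag_nat[of n] H_imag by (simp add: imag_minus H_minus mult_less_0_iff)
qed

lemma H_shifted: "t \<in> shifted I \<Longrightarrow> H t > 0"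
  using H_pos H_ideal by (auto simp: shifted_def)

lemma shifted_real: "t \<in> shifted I \<Longrightarrow> t \<in> real_roots"
  and fst_shifted: "t \<in> shifted I \<Longrightarrow> fst t \<in> \<Phi>p"
  and level_shifted: "t \<in> shifted I \<Longrightarrow> level t = 0 \<or> level t = -1"
  using I_pos pos_rootD(1) real_rootI0 real_rootI1(1) by (auto simp: shifted_def)

lemma H_sum_list: "set ts \<subseteq> shifted I \<Longrightarrow> H (sum_list ts) \<ge> 0"
  by (induction ts) (use H_shifted in \<open>force simp: H_add\<close>)+

lemma H_sum_list_imag: "set ts \<subseteq> shifted I \<Longrightarrow> H (sum_list ts + imag (of_nat j)) \<ge> 0"
  using H_sum_list H_imag by (simp add: H_add H_imag_nat)

lemma H_ideal_cone:
  assumes "x \<in> ideal_cone I"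
  shows "H x \<ge> 0" "x \<noteq> 0 \<Longrightarrow> H x > 0"
proof -
  obtain ts j where x: "x = sum_list ts + imag (of_nat j)" "set ts \<subseteq> shifted I"
    using assms by (auto simp: ideal_cone_def)
  show "H x \<ge> 0" using H_sum_list_imag x by simp
  assume "x \<noteq> 0"
  show "H x > 0"
  proof (cases ts)
    case Nil
    then have "j > 0" using x \<open>x \<noteq> 0\<close> by (cases j) auto
    then show ?thesis using x Nil H_imag by (simp add: H_imag_nat)
  next
    case (Cons t us)
    then have "H x = H t + H (sum_list us + imag (of_nat j))" using x by (simp add: H_add)
    then show ?thesis using H_shifted[of t] H_sum_list_imag[of us j] x Cons by simp
  qed
qed

lemma ideal_cone_nonneg: "x \<in> ideal_cone I \<Longrightarrow> fst x \<in> nonneg_comb S"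
proof -
  assume "x \<in> ideal_cone I"
  then obtain ts j where x: "x = sum_list ts + imag (of_nat j)" "set ts \<subseteq> shifted I"
    by (auto simp: ideal_cone_def)
  have "fst t \<in> nonneg_comb S" if "t \<in> set ts" for t
    using pos_rootD(2)[OF fst_shifted] x(2) that by blast
  then show ?thesis by (simp add: x(1) fst_sum_list nonneg_comb_sum_list image_subset_iff)
qed

text \<open>Among the generators of the cone, only those from \<open>I\<close> shifted by -\<delta>
  have negative level, so at least one of them occurs and can be split off.\<close>

lemma ideal_cone_level_neg:
  assumes "x \<in> ideal_cone I" "level x < 0"
  obtains \<gamma> y where "\<gamma> \<in> I" "y \<in> ideal_cone I" "x = (\<gamma>, -1, 0) + y"
proof -
  obtain ts j where x: "x = sum_list ts + imag (of_nat j)" "set ts \<subseteq> shifted I"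
    using assms(1) by (auto simp: ideal_cone_def)
  have "\<exists>t\<in>set ts. level t \<noteq> 0"
  proof (rule ccontr)
    assume "\<not> ?thesis"
    then have "sum_list (map level ts) = 0" by (induction ts) auto
    then show False using assms(2) x by (simp add: level_sum_list)
  qed
  then obtain t where t: "t \<in> set ts" "level t \<noteq> 0" by blast
  then obtain \<gamma> where "t = (\<gamma>, -1, 0)" "\<gamma> \<in> I" using x(2) by (auto simp: shifted_def)
  moreover have "sum_list (remove1 t ts) + imag (of_nat j) \<in> ideal_cone I"
    using x(2) set_remove1_subset[of t ts] by (intro sum_list_ideal_cone) blast
  moreover have "x = t + (sum_list (remove1 t ts) + imag (of_nat j))"
    using x(1) sum_list_remove1[OF t(1)] by (simp add: add.assoc)
  ultimately show thesis using that by simp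
qed

lemma level_0_shifted:
  assumes "x \<in> real_roots" "level x = 0" "H x > 0"
  shows "x \<in> shifted I"
proof -
  obtain \<beta> k where x: "x = (\<beta>, of_int k, 0)" "\<beta> \<in> \<Delta>" using assms(1) by (rule real_rootE)
  then have x0: "x = (\<beta>, 0, 0)" using assms(2) by simp
  have "\<beta> \<in> \<Phi>p"
  proof (rule ccontr)
    assume "\<beta> \<notin> \<Phi>p"
    then have "H (- x) > 0" using uminus_pos_root_iff[OF x(2)] H_pos[of "- \<beta>"] x0 by simp
    then show False using assms(3) H_minus[of x] by simp
  qed
  then show ?thesis using x0 by (simp add: shifted_def)
qed

text \<open>
  Move the summands of \<open>ts\<close> one by one over to \<open>b\<close> or to \<open>e\<close>. If no pairing has a sign that
  allows this, the square length of the sum of the finite parts of \<open>ts\<close> is nonpositive.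
\<close>

lemma decomposable_above:
  assumes "e \<in> real_roots" "level e < 0" "b \<in> real_roots" "level b \<ge> 0" "H b > 0"
    and "set ts \<subseteq> shifted I" "e = b + sum_list ts + imag (of_nat j)"
  shows "decomposable I e"
  using assms
proof (induction "length ts" arbitrary: e b ts rule: less_induct)
  case less
  note e = less.prems(1,2) and b = less.prems(3-5) and ts = less.prems(6) and eq = less.prems(7)
  have rest: "sum_list (remove1 t ts) + imag (of_nat j) \<in> ideal_cone I" for t
    using ts set_remove1_subset[of t ts] by (intro sum_list_ideal_cone) blast
  have rest_subset: "set (remove1 t ts) \<subseteq> shifted I" for t
    using ts set_remove1_subset[of t ts] by blast
  have shorter: "length (remove1 t ts) < length ts" if "t \<in> set ts" for t
    using that length_pos_if_in_set[OF that] by (simp add: length_remove1)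
  have fst_e: "fst e \<noteq> 0" using fst_real_root[OF e(1)] root_nonzero by blast
  have level_e: "level e \<le> -1" using level_real_root[OF e(1)] e(2) by (auto elim!: Ints_cases)
  show ?case
  proof (cases "level b = 0")
    case True
    have "b \<in> ideal_cone I" using level_0_shifted b True shifted_ideal_cone by blast
    moreover have "sum_list ts + imag (of_nat j) \<noteq> 0"
    proof
      assume "sum_list ts + imag (of_nat j) = 0"
      then have "e = b" using eq by (simp add: add.assoc)
      then show False using e b by simp
    qed
    ultimately show ?thesis
      using decomposableI[of b I "sum_list ts + imag (of_nat j)" e] sum_list_ideal_cone[OF ts]
        real_root_nonzero[OF b(1)] eq by (simp add: add.assoc)
  next
    case False
    \<comment> \<open>This leaves room: \<open>b\<close> can absorb a summand of level -1 and keep a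
      nonnegative level, so the induction hypothesis applies to \<open>b + t\<close>.\<close>
    then have level_b: "level b \<ge> 1" using level_real_root[OF b(1)] b(2) by (auto elim!: Ints_cases)
    consider (b) t where "t \<in> set ts" "ip (fst b) (fst t) < 0"
      | (e) t where "t \<in> set ts" "ip (fst e) (fst t) > 0"
      | (none) "\<And>t. t \<in> set ts \<Longrightarrow> ip (fst b) (fst t) \<ge> 0" "\<And>t. t \<in> set ts \<Longrightarrow> ip (fst e) (fst t) \<le> 0"
      by force
    then show ?thesis
    proof cases
      case b': b
      then have t: "t \<in> shifted I" using ts by blast
      have eq': "e = (b + t) + sum_list (remove1 t ts) + imag (of_nat j)"
        using eq sum_list_remove1[OF b'(1)] by (simp add: algebra_simps)
      have Hbt: "H (b + t) > 0" using b H_shifted[OF t] by (simp add: H_add)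
      show ?thesis
      proof (rule real_root_add[OF b(1) shifted_real[OF t] b'(2)])
        assume "b + t \<in> real_roots"
        moreover have "level (b + t) \<ge> 0" using level_b level_shifted[OF t] by auto
        ultimately show ?thesis
          using less.hyps[OF shorter[OF b'(1)] e _ _ Hbt rest_subset eq'] by blast
      next
        fix c assume c: "b + t = imag (of_int c)"
        \<comment> \<open>The imaginary sum is a positive multiple of \<delta>, hence itself a
          nonzero cone element. The remaining part carries the finite part of \<open>e\<close> and
          so is nonzero too.\<close>
        then have "c > 0" using Hbt H_imag_int_pos by simp
        then obtain n where n: "c = int n" using nonneg_int_cases[of c] by auto
        define z where "z = sum_list (remove1 t ts) + imag (of_nat j)"
        have e_eq: "e = imag (of_nat n) + z" using eq' c n by (simp add: z_def add.assoc)
        have "z \<noteq> 0" using fst_e arg_cong[OF e_eq, of fst] by auto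
        moreover have "imag (of_nat n) \<noteq> (0 :: 'n affine_vec)" using n \<open>c > 0\<close> by simp
        moreover have "z \<in> ideal_cone I" using rest by (simp add: z_def)
        ultimately show ?thesis using decomposableI[OF imag_ideal_cone[of n] _ _ _ e_eq] by blast
      qed
    next
      case e': e
      then have t: "t \<in> shifted I" using ts by blast
      have eq': "e - t = b + sum_list (remove1 t ts) + imag (of_nat j)"
        using eq sum_list_remove1[OF e'(1)] by (simp add: algebra_simps)
      have He: "H (e - t) > 0"
        using b H_sum_list_imag[OF rest_subset, of t j] by (simp add: eq' H_add add.assoc)
      have t0: "t \<noteq> 0" using real_root_nonzero shifted_real t by blast
      show ?thesis
      proof (rule real_root_diff[OF e(1) shifted_real[OF t] e'(2)])
        assume R: "e - t \<in> real_roots"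
        have "e - t \<in> ideal_cone I"
        proof (cases "level (e - t) < 0")
          case True
          then show ?thesis
            using less.hyps[OF shorter[OF e'(1)] R _ b rest_subset eq'] decomposable_ideal_cone by blast
        next
          case False
          then have "level (e - t) = 0" using level_e level_shifted[OF t] by auto
          then show ?thesis using level_0_shifted[OF R _ He] shifted_ideal_cone by blast
        qed
        then show ?thesis
          using decomposableI[of t I "e - t" e] shifted_ideal_cone[OF t] t0 real_root_nonzero[OF R] by simp
      next
        fix c assume c: "e - t = imag (of_int c)"
        then have "c > 0" using He H_imag_int_pos by simp
        then obtain n where n: "c = int n" using nonneg_int_cases[of c] by auto
        have "e = t + imag (of_nat n)" using c n by (simp add: algebra_simps)
        then show ?thesis
          using decomposableI[OF shifted_ideal_cone[OF t] imag_ideal_cone[of n] t0] n \<open>c > 0\<close> by simp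
      qed
    next
      case none
      define v where "v = sum_list (map fst ts)"
      have v: "fst e - fst b = v" using eq by (simp add: v_def fst_sum_list)
      have "ip v v = (\<Sum>t\<leftarrow>ts. ip (fst e) (fst t) - ip (fst b) (fst t))"
        by (subst v[symmetric]) (simp add: v_def ip_sum_list_right sum_list_subtractf comp_def)
      also have "\<dots> \<le> 0" using none by (intro sum_list_nonpos) force
      finally have "v = 0" using ip_pos[of v] by force
      \<comment> \<open>The finite parts of the summands are positive roots, so their sum
        \<open>v\<close> vanishes only if there are none. But then \<open>e\<close> is
        \<open>b\<close> plus a nonnegative multiple of \<delta>, against the signs of the
        levels.\<close>
      have "ts = []"
      proof (cases ts)
        case (Cons t us)
        have "sum_list (map fst us) \<in> nonneg_comb S"
          using ts Cons fst_shifted pos_rootD(2) by (intro nonneg_comb_sum_list) auto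
        then have "ht (sum_list (map fst us)) \<ge> 0"
          using ht_nonneg_comb by (cases "sum_list (map fst us) = 0") force+
        moreover have "ht (fst t) \<ge> 1" using ts Cons fst_shifted ht_pos_root by auto
        moreover have "ht v = ht (fst t) + ht (sum_list (map fst us))" by (simp add: v_def Cons)
        ultimately show ?thesis using \<open>v = 0\<close> by simp
      qed simp
      then show ?thesis using eq e b by simp
    qed
  qed
qed

end

context root_system
begin

lemma ideal_subset_pos: "ad_nilpotent_ideal \<Delta> S I \<Longrightarrow> I \<subseteq> \<Phi>p"
  by (simp add: ad_nilpotent_ideal_def)

lemma ideal_step: "ad_nilpotent_ideal \<Delta> S I \<Longrightarrow> \<gamma> \<in> I \<Longrightarrow> \<nu> \<in> \<Phi>p \<Longrightarrow> \<gamma> + \<nu> \<in> \<Delta> \<Longrightarrow> \<gamma> + \<nu> \<in> I"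
  by (simp add: ad_nilpotent_ideal_def)

text \<open>Close the gap between \<mu> and \<gamma> by simple roots. A simple \<open>a\<close>
  pairing positively with \<gamma> - \<mu> pairs negatively with \<mu> or positively with \<gamma>:
  either \<mu> can be raised by \<open>a\<close> inside \<open>I\<close>, or \<gamma> can be lowered
  by \<open>a\<close>, and the induction hypothesis puts \<gamma> - a into \<open>I\<close>.\<close>

lemma above_ideal_not_generator:
  assumes I: "ad_nilpotent_ideal \<Delta> S I"
    and "\<mu> \<in> I" "\<gamma> \<in> \<Delta>" "\<gamma> - \<mu> \<in> nonneg_comb S" "\<gamma> \<noteq> \<mu>"
  shows "\<exists>\<alpha>\<in>\<Phi>p. \<gamma> - \<alpha> \<in> I"
  using assms(2-)
proof (induction "nat \<lfloor>ht (\<gamma> - \<mu>)\<rfloor>" arbitrary: \<gamma> \<mu> rule: less_induct)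
  case less
  note \<mu> = less.prems(1) and \<gamma> = less.prems(2) and d = less.prems(3) and ne = less.prems(4)
  have \<mu>p: "\<mu> \<in> \<Phi>p" using \<mu> ideal_subset_pos[OF I] by blast
  obtain a where a: "a \<in> S" "ip (\<gamma> - \<mu>) a > 0" "cf (\<gamma> - \<mu>) a > 0"
    using nonneg_comb_simple[OF d] ne by auto
  have ap: "a \<in> \<Phi>p" "a \<in> \<Delta>" using a simple_pos simple_subset by auto
  have d': "\<gamma> - \<mu> - a \<in> nonneg_comb S" using nonneg_comb_diff_simple[OF d a(1)] a(3) by simp
  have ht_d: "ht (\<gamma> - \<mu>) \<ge> 1" using ht_nonneg_comb[OF d] ne by simp
  consider "ip \<mu> a < 0" | "ip \<gamma> a > 0" using a(2) by fastforce
  then show ?case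
  proof cases
    case 1
    have "\<mu> + a \<noteq> 0" using ht_pos_root[OF \<mu>p] ht_simple[OF a(1)] ht_add[of \<mu> a] by (auto simp del: ht_add)
    then have "\<mu> + a \<in> \<Delta>" using add_root[of \<mu> a] 1 ap pos_rootD(1)[OF \<mu>p] by simp
    then have \<mu>a: "\<mu> + a \<in> I" using ideal_step[OF I \<mu> ap(1)] by simp
    show ?thesis
    proof (cases "\<gamma> = \<mu> + a")
      case True
      then have "\<gamma> - a \<in> I" using \<mu> by simp
      then show ?thesis using ap by blast
    next
      case False
      have "nat \<lfloor>ht (\<gamma> - (\<mu> + a))\<rfloor> < nat \<lfloor>ht (\<gamma> - \<mu>)\<rfloor>"
        using ht_d ht_simple[OF a(1)] by simp linarith
      then show ?thesis
        using less.hyps[of \<gamma> "\<mu> + a"] \<mu>a \<gamma> False d' by (simp add: diff_diff_eq)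
    qed
  next
    case 2
    have "\<gamma> \<noteq> a" using ht_d ht_pos_root[OF \<mu>p] ht_simple[OF a(1)] by auto
    then have \<gamma>a: "\<gamma> - a \<in> \<Delta>" using diff_root[of \<gamma> a] 2 ap \<gamma> by simp
    have "\<gamma> - a \<in> I"
    proof (cases "\<gamma> - a = \<mu>")
      case True then show ?thesis using \<mu> by simp
    next
      case False
      have "nat \<lfloor>ht (\<gamma> - a - \<mu>)\<rfloor> < nat \<lfloor>ht (\<gamma> - \<mu>)\<rfloor>"
        using ht_d ht_simple[OF a(1)] by simp linarith
      moreover have "\<gamma> - a - \<mu> \<in> nonneg_comb S" using d' by (simp add: algebra_simps)
      ultimately obtain \<alpha> where "\<alpha> \<in> \<Phi>p" "\<gamma> - a - \<alpha> \<in> I"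
        using less.hyps[of "\<gamma> - a" \<mu>] \<mu> \<gamma>a False by auto
      then show ?thesis using ideal_step[OF I, of "\<gamma> - a - \<alpha>" \<alpha>] \<gamma>a by simp
    qed
    then show ?thesis using ap by blast
  qed
qed

section \<open>Dominant and admissible elements\<close>

abbreviation "adm \<equiv> admissible ip \<Delta> S"

lemma aht_scale: "aht (affine_scale c x) = c * aht x"
  by (cases x) (simp add: aht_def affine_scale_def algebra_simps)

lemma aht_imag: "aht (imag c) = c * (1 + ht \<theta>)"
  by (simp add: aht_def)

text \<open>Inverting \<delta> - \<gamma> amounts to keeping the negative root \<gamma> - \<delta>
  positive after \<open>w\<close>; the latter is the form that fits the cone.\<close>

lemma ideal_of_iff:
  assumes "w \<in> Wa"
  shows "\<gamma> \<in> ideal_of \<Delta> S w \<longleftrightarrow> \<gamma> \<in> \<Phi>p \<and> aht (w (\<gamma>, -1, 0)) > 0"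
proof (cases "\<gamma> \<in> \<Phi>p")
  case True
  then have g: "- \<gamma> \<in> \<Delta>" using pos_rootD by simp
  have "(- \<gamma>, of_int 1, 0) \<in> \<Phi>a" using g unfolding affine_pos_roots_def by blast
  then have "(- \<gamma>, 1, 0) \<in> \<Phi>a" by simp
  moreover have "w (- \<gamma>, 1, 0) \<in> real_roots" using g Wa_real[OF assms] real_rootI1(2) by blast
  moreover have "w (- \<gamma>, 1, 0) = - w (\<gamma>, -1, 0)" using Wa_minus[OF assms, of "(\<gamma>, -1, 0)"] by simp
  ultimately show ?thesis using True affine_neg_iff(1)[of "w (- \<gamma>, 1, 0)"]
    by (simp add: ideal_of_def inversion_set_def)
qed (simp add: ideal_of_def)

text \<open>Condition (a) of admissibility, extended from simple to positive roots. Condition (b) is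
  left out because, in the construction of admissible elements, it is obtained only afterwards by
  minimising inversions.\<close>

definition dominant :: "('n affine_vec \<Rightarrow> 'n affine_vec) \<Rightarrow> bool" where
  "dominant w \<longleftrightarrow> w \<in> Wa \<and> (\<forall>\<beta>\<in>\<Phi>p. aht (w (\<beta>, 0, 0)) > 0)"

lemma dominantI:
  assumes w: "w \<in> Wa" and pos: "\<And>\<alpha>. \<alpha> \<in> S \<Longrightarrow> aht (w (\<alpha>, 0, 0)) > 0"
  shows "dominant w"
  unfolding dominant_def
proof (intro conjI ballI w)
  fix \<beta> assume b: "\<beta> \<in> \<Phi>p"
  define f where "f x = aht (w (x, 0, 0))" for x
  have add: "f (x + y) = f x + f y" for x y
    using Wa_add[OF w, of "(x, 0, 0)" "(y, 0, 0)"] by (simp add: f_def)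
  have scale: "f (c *s x) = c * f x" for c x
    using Wa_scale[OF w, of c "(x, 0, 0)"] aht_scale by (simp add: f_def affine_scale_def)
  have zero: "f 0 = 0" using add[of 0 0] by simp
  have sum: "f (\<Sum>i\<in>A. g i) = (\<Sum>i\<in>A. f (g i))" for g and A :: "(rat ^ 'n) set"
    by (induction A rule: infinite_finite_induct) (simp_all add: add zero)
  have f_eq: "f \<beta> = (\<Sum>a\<in>S. cf \<beta> a * f a)"
    by (subst cf_sum[of \<beta>, symmetric]) (simp add: sum scale)
  have nonneg: "cf \<beta> a * f a \<ge> 0" if "a \<in> S" for a
    using nonneg_comb_ge[OF pos_rootD(2)[OF b] that] pos[OF that] by (simp add: f_def)
  obtain a where a: "a \<in> S" "cf \<beta> a > 0"
    using nonneg_comb_simple[OF pos_rootD(2)[OF b] root_nonzero[OF pos_rootD(1)[OF b]]] by blast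
  then have "cf \<beta> a * f a > 0" using pos by (simp add: f_def)
  then have "f \<beta> > 0" 
    unfolding f_eq using sum_pos2[OF finite_simple a(1), of "\<lambda>a. cf \<beta> a * f a"] nonneg by blast
  then show "aht (w (\<beta>, 0, 0)) > 0" by (simp add: f_def)
qed

lemma dominant_positive_functional:
  assumes "dominant w"
  shows "positive_functional ip \<Delta> S (\<lambda>x. aht (w x)) (ideal_of \<Delta> S w)"
proof
  have w: "w \<in> Wa" using assms by (simp add: dominant_def)
  show "aht (w (x + y)) = aht (w x) + aht (w y)" for x y using Wa_add[OF w] by simp
  show "0 < aht (w (imag 1))" using Wa_imag[OF w] ht_highest_root_pos by (simp add: aht_imag)
  show "0 < aht (w (\<beta>, 0, 0))" if "\<beta> \<in> \<Phi>p" for \<beta> using assms that by (simp add: dominant_def)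
  show "0 < aht (w (\<gamma>, -1, 0))" if "\<gamma> \<in> ideal_of \<Delta> S w" for \<gamma> using that ideal_of_iff[OF w] by simp
  show "ideal_of \<Delta> S w \<subseteq> \<Phi>p" by (auto simp: ideal_of_def)
qed

lemma admissible_Wa: "w \<in> adm \<Longrightarrow> w \<in> Wa"
  by (simp add: admissible_def)

lemma admissible_dominant: "w \<in> adm \<Longrightarrow> dominant w"
proof (rule dominantI)
  assume w: "w \<in> adm"
  then show "w \<in> Wa" by (rule admissible_Wa)
  fix \<alpha> assume "\<alpha> \<in> S"
  then have "w (\<alpha>, 0, 0) \<in> \<Phi>a" using w by (simp add: admissible_def)
  then show "aht (w (\<alpha>, 0, 0)) > 0" using affine_pos_iff affine_pos_real by blast
qed

text \<open>A root of negative level is negative, so condition (b) applies to it. This is the only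
  form in which (b) is exploited.\<close>

lemma admissible_simple_level:
  assumes w: "w \<in> adm" and a: "a \<in> \<Pi>a" and neg: "level (winv w a) < 0"
  obtains \<gamma> where "\<gamma> \<in> ideal_of \<Delta> S w" "winv w a = (\<gamma>, -1, 0)"
proof -
  have W: "w \<in> Wa" using w by (rule admissible_Wa)
  have R: "winv w a \<in> real_roots" using Wa_real[OF winv_Wa[OF W]] affine_simple_real[OF a] by simp
  have "winv w a \<notin> \<Phi>a" using neg by (auto simp: affine_pos_roots_def)
  then have "winv w a \<in> uminus ` \<Phi>a" using affine_neg_iff[OF R] by simp
  then obtain \<gamma> where g: "\<gamma> \<in> \<Phi>p" "winv w a = (\<gamma>, -1, 0)"
    using w a by (auto simp: admissible_def)
  then have "w (\<gamma>, -1, 0) = a" using winv_right[OF W, of a] by simp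
  then have "\<gamma> \<in> ideal_of \<Delta> S w" using ideal_of_iff[OF W] g aht_simple[OF a] by simp
  then show thesis using that g by blast
qed

text \<open>Induction on the height of \<open>w e\<close>. Unless \<open>w e\<close> is simple,
  subtract an affine simple root \<open>a\<close> in acute position, that is, remove
  \<open>b = winv w a\<close> from \<open>e\<close>. If \<open>b\<close> has negative level, it is a
  cone generator by condition (b); otherwise the regrouping of \<open>decomposable_above\<close> is
  needed.\<close>

lemma admissible_cone:
  assumes w: "w \<in> adm" and "e \<in> real_roots" "level e < 0" "aht (w e) > 0"
  shows "w e \<in> \<Pi>a \<or> decomposable (ideal_of \<Delta> S w) e" and "e \<in> ideal_cone (ideal_of \<Delta> S w)"
proof -
  define I where "I = ideal_of \<Delta> S w"
  interpret positive_functional ip \<Delta> S "\<lambda>x. aht (w x)" I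
    unfolding I_def by (rule dominant_positive_functional[OF admissible_dominant[OF w]])
  have W: "w \<in> Wa" using w by (rule admissible_Wa)
  have simple_cone: "e \<in> ideal_cone I" if e: "w e \<in> \<Pi>a" "level e < 0" for e
  proof -
    have "level (winv w (w e)) < 0" using e(2) W by simp
    then obtain \<gamma> where "\<gamma> \<in> I" "winv w (w e) = (\<gamma>, -1, 0)"
      using admissible_simple_level[OF w e(1)] unfolding I_def by blast
    then show ?thesis using W by (intro shifted_ideal_cone) (simp add: shifted_def)
  qed
  have main: "w e \<in> \<Pi>a \<or> decomposable I e"
    if "e \<in> real_roots" "level e < 0" "aht (w e) > 0" for e
    using that
  proof (induction "nat \<lfloor>aht (w e)\<rfloor>" arbitrary: e rule: less_induct)
    case less
    note e = less.prems
    have level_e: "level e \<le> -1" using level_real_root[OF e(1)] e(2) by (auto elim!: Ints_cases)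
    have we: "w e \<in> real_roots" using Wa_real[OF W e(1)] .
    show ?case
    proof (cases "w e \<in> \<Pi>a")
      case False
      then have "aht (w e) \<noteq> 1" using aht_1_simple[OF we] by blast
      then have ht2: "aht (w e) \<ge> 2" using aht_int[OF we] e(3) by (auto elim!: Ints_cases)
      obtain a where a: "a \<in> \<Pi>a" "ip (fst (w e)) (fst a) > 0"
        using exists_acute_affine_simple[OF fst_real_root[OF we]] by blast
      have aR: "a \<in> real_roots" using affine_simple_real a by blast
      define b where "b = winv w a"
      have wb: "w b = a" using W by (simp add: b_def)
      have bR: "b \<in> real_roots" unfolding b_def using Wa_real[OF winv_Wa[OF W] aR] .
      have b_neg: "b \<in> shifted I \<and> level b = -1" if "level b < 0"
      proof -
        have "level (winv w a) < 0" using that by (simp add: b_def)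
        then obtain \<gamma> where "\<gamma> \<in> I" "b = (\<gamma>, -1, 0)"
          using admissible_simple_level[OF w a(1)] unfolding b_def I_def by blast
        then show ?thesis by (simp add: shifted_def)
      qed
      have b0: "b \<noteq> 0" using real_root_nonzero[OF bR] .
      have "decomposable I e"
      proof (rule real_root_diff[OF we aR a(2)])
        fix c assume c: "w e - a = imag (of_int c)"
        have "w (e - b) = w (imag (of_int c))" using c wb Wa_diff[OF W] Wa_imag[OF W] by simp
        then have eb: "e - b = imag (of_int c)" using Wa_eq_iff[OF W] by blast
        have "H (imag (of_int c)) > 0" if "H = (\<lambda>x. aht (w x))" for H
          using that ht2 aht_simple[OF a(1)] c aht_diff[of "w e" a] Wa_imag[OF W] by simp
        then have "c > 0" using H_imag_int_pos by blast
        then obtain n where n: "c = int n" using nonneg_int_cases[of c] by auto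
        \<comment> \<open>As \<open>e\<close> has negative level and \<open>c\<close> is positive,
          \<open>b\<close> has negative level as well and is a cone generator; \<delta> taken
          \<open>c\<close> times is the other summand.\<close>
        have "level e = level b + of_int c" using arg_cong[OF eb, of level] by simp
        moreover have "(of_int c :: rat) > 0" using \<open>c > 0\<close> by simp
        ultimately have "level b < 0" using e(2) by linarith
        then have "b \<in> ideal_cone I" using b_neg shifted_ideal_cone by blast
        moreover have "e = b + imag (of_nat n)" using eb n by (simp add: algebra_simps)
        ultimately show ?thesis
          using decomposableI[of b I "imag (of_nat n)" e] imag_ideal_cone b0 n \<open>c > 0\<close> by simp
      next
        assume "w e - a \<in> real_roots"
        then have web: "w (e - b) \<in> real_roots" using wb Wa_diff[OF W] by simp
        then have ebR: "e - b \<in> real_roots" using Wa_real[OF winv_Wa[OF W] web] W by simp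
        have aht_eb: "aht (w (e - b)) = aht (w e) - 1" using wb Wa_diff[OF W] aht_simple[OF a(1)] by simp
        have eb_pos: "aht (w (e - b)) > 0" using aht_eb ht2 by simp
        have IH: "e - b \<in> ideal_cone I" if "level (e - b) < 0"
        proof -
          have "nat \<lfloor>aht (w (e - b))\<rfloor> < nat \<lfloor>aht (w e)\<rfloor>" using aht_eb ht2 by simp
          then have "w (e - b) \<in> \<Pi>a \<or> decomposable I (e - b)"
            using less.hyps[of "e - b"] ebR that eb_pos by blast
          then show ?thesis using simple_cone that decomposable_ideal_cone by blast
        qed
        show ?thesis
        proof (cases "level b < 0")
          case True
          then have b: "b \<in> ideal_cone I" "level b = -1" using b_neg shifted_ideal_cone by blast+
          have "e - b \<in> ideal_cone I"
          proof (cases "level (e - b) < 0")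
            case False
            then have "level (e - b) = 0" using level_e b(2) by simp
            then show ?thesis using level_0_shifted[OF ebR] eb_pos shifted_ideal_cone by blast
          qed (rule IH)
          then show ?thesis
            using decomposableI[of b I "e - b" e] b(1) b0 real_root_nonzero[OF ebR] by simp
        next
          \<comment> \<open>Here \<open>b\<close> need not lie in the cone. But \<open>e - b\<close>
            has negative level and smaller height, so it does, and \<open>e\<close> is a root of
            nonnegative level plus cone generators.\<close>
          case False
          then have "level (e - b) < 0" using e(2) by simp
          then obtain ts j where tj: "e - b = sum_list ts + imag (of_nat j)" "set ts \<subseteq> shifted I"
            using IH by (auto simp: ideal_cone_def)
          have "e = b + sum_list ts + imag (of_nat j)" using tj(1) by (simp add: algebra_simps)
          moreover have "aht (w b) > 0" using wb aht_simple[OF a(1)] by simp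
          ultimately show ?thesis using decomposable_above[OF e(1,2) bR _ _ tj(2)] False by simp
        qed
      qed
      then show ?thesis by simp
    qed simp
  qed
  show "w e \<in> \<Pi>a \<or> decomposable (ideal_of \<Delta> S w) e" using main assms(2-) by (simp add: I_def)
  then show "e \<in> ideal_cone (ideal_of \<Delta> S w)"
    using simple_cone[of e] assms(3) decomposable_ideal_cone unfolding I_def by blast
qed

text \<open>If \<gamma> - \<delta> decomposed in the cone, one summand would have negative level and
  contain some \<mu> - \<delta> with \<mu> in \<open>I\<close>. The rest is nonzero of level 0 with
  nonnegative finite part, so \<gamma> lies strictly above \<mu> and cannot be a generator.\<close>

lemma generator_imp_simple:
  assumes w: "w \<in> adm" and I: "ad_nilpotent_ideal \<Delta> S I" "ideal_of \<Delta> S w = I"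
    and g: "\<gamma> \<in> ideal_generators \<Delta> S I"
  shows "w (\<gamma>, -1, 0) \<in> \<Pi>a"
proof (rule ccontr)
  assume not_simple: "w (\<gamma>, -1, 0) \<notin> \<Pi>a"
  interpret positive_functional ip \<Delta> S "\<lambda>x. aht (w x)" I
    using dominant_positive_functional[OF admissible_dominant[OF w]] I(2) by simp
  have W: "w \<in> Wa" using w by (rule admissible_Wa)
  have gI: "\<gamma> \<in> I" using g by (simp add: ideal_generators_def)
  then have gp: "\<gamma> \<in> \<Phi>p" using I_pos by blast
  have pos: "aht (w (\<gamma>, -1, 0)) > 0" using gI I(2) ideal_of_iff[OF W] by blast
  have R: "(\<gamma>, -1, 0) \<in> real_roots" using real_rootI1 pos_rootD(1)[OF gp] by blast
  have "decomposable I (\<gamma>, -1, 0)"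
    using admissible_cone(1)[OF w R _ pos] not_simple I(2) by simp
  then obtain x y where xy: "x \<in> ideal_cone I" "y \<in> ideal_cone I" "x \<noteq> 0" "y \<noteq> 0" "(\<gamma>, -1, 0) = x + y"
    unfolding decomposable_def by blast
  have no: False
    if x: "x \<in> ideal_cone I" "level x < 0" and y: "y \<in> ideal_cone I" "y \<noteq> 0" and eq: "(\<gamma>, -1, 0) = x + y"
    for x y
  proof -
    obtain \<mu> z where z: "\<mu> \<in> I" "z \<in> ideal_cone I" "x = (\<mu>, -1, 0) + z"
      using ideal_cone_level_neg[OF x] by blast
    have yz: "z + y = (\<gamma> - \<mu>, 0, 0)"
    proof -
      have "z + y = x + y - (\<mu>, -1, 0)" using z(3) by simp
      then show ?thesis by (simp add: zero_prod_def flip: eq)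
    qed
    have "aht (w (z + y)) > 0"
      using H_ideal_cone(1)[OF z(2)] H_ideal_cone(2)[OF y] H_add[of z y] by linarith
    then have "z + y \<noteq> 0" using Wa_zero[OF W] by auto
    then have "\<gamma> \<noteq> \<mu>" unfolding yz by (auto simp: prod_eq_iff)
    moreover have "\<gamma> - \<mu> \<in> nonneg_comb S"
      using ideal_cone_nonneg[OF ideal_cone_add[OF z(2) y(1)]] yz by simp
    ultimately obtain \<alpha> where "\<alpha> \<in> \<Phi>p" "\<gamma> - \<alpha> \<in> I"
      using above_ideal_not_generator[OF I(1) z(1) pos_rootD(1)[OF gp]] by blast
    then show False using g by (simp add: ideal_generators_def)
  qed
  have "level x + level y = -1" using arg_cong[OF xy(5), of level] by simp
  then consider "level x < 0" | "level y < 0" by linarith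
  then show False
    using no[OF xy(1) _ xy(2,4,5)] no[OF xy(2) _ xy(1,3)] xy(5) by cases (simp_all add: add.commute)
qed

text \<open>Splitting \<gamma> as (\<gamma> - \<alpha>) + \<alpha> inside \<open>I\<close> would
  write the height 1 of a simple root as a number that is at least 1 plus a positive one.\<close>

lemma simple_imp_generator:
  assumes w: "w \<in> adm" and I: "ideal_of \<Delta> S w = I" and a: "w (\<gamma>, -1, 0) \<in> \<Pi>a" and g: "\<gamma> \<in> I"
  shows "\<gamma> \<in> ideal_generators \<Delta> S I"
  unfolding ideal_generators_def
proof (intro CollectI conjI ballI g notI)
  fix \<alpha> assume \<alpha>: "\<alpha> \<in> \<Phi>p" and d: "\<gamma> - \<alpha> \<in> I"
  have W: "w \<in> Wa" using w by (rule admissible_Wa)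
  have "((\<gamma>, -1, 0) :: 'n affine_vec) = (\<gamma> - \<alpha>, -1, 0) + (\<alpha>, 0, 0)" by simp
  then have "w (\<gamma>, -1, 0) = w (\<gamma> - \<alpha>, -1, 0) + w (\<alpha>, 0, 0)" using Wa_add[OF W] by metis
  then have eq: "1 = aht (w (\<gamma> - \<alpha>, -1, 0)) + aht (w (\<alpha>, 0, 0))" using aht_simple[OF a] by simp
  have d': "\<gamma> - \<alpha> \<in> \<Phi>p" "aht (w (\<gamma> - \<alpha>, -1, 0)) > 0" using d I ideal_of_iff[OF W] by auto
  then have "aht (w (\<gamma> - \<alpha>, -1, 0)) \<ge> 1"
    using pos_rootD(1)[OF d'(1)] by (intro aht_pos Wa_real[OF W] real_rootI1)
  moreover have "aht (w (\<alpha>, 0, 0)) > 0" using admissible_dominant[OF w] \<alpha> by (simp add: dominant_def)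
  ultimately show False using eq by simp
qed

lemma admissible_unique:
  assumes w: "w \<in> adm" and w': "w' \<in> adm" and eq: "ideal_of \<Delta> S w = ideal_of \<Delta> S w'"
  shows "w = w'"
proof -
  have W: "w \<in> Wa" "w' \<in> Wa" using w w' admissible_Wa by auto
  \<comment> \<open>Positivity under \<open>u\<close> places \<open>e\<close> in the cone, and
    \<open>v\<close> has the same cone, on whose nonzero elements it is positive.\<close>
  have transfer: "aht (v e) > 0"
    if "u \<in> adm" "v \<in> adm" "ideal_of \<Delta> S u = ideal_of \<Delta> S v" "e \<in> real_roots" "level e < 0" "aht (u e) > 0" for u v e
  proof -
    interpret positive_functional ip \<Delta> S "\<lambda>x. aht (v x)" "ideal_of \<Delta> S v"
      using dominant_positive_functional[OF admissible_dominant] that(2) .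
    show ?thesis
      using H_ideal_cone(2)[of e] admissible_cone(2)[OF that(1,4-6)] that(3) real_root_nonzero[OF that(4)] by simp
  qed
  have "w' \<circ> winv w = id"
  proof (rule Wa_positive_eq_id)
    show "w' \<circ> winv w \<in> Wa" using W winv_Wa Wa_comp by blast
    fix a assume a: "a \<in> \<Pi>a"
    define x where "x = winv w a"
    have xR: "x \<in> real_roots" unfolding x_def using Wa_real[OF winv_Wa] W affine_simple_real a by blast
    have wx: "aht (w x) > 0" using aht_simple[OF a] W by (simp add: x_def)
    have "aht (w' x) > 0"
    proof (cases "level x < 0")
      case True then show ?thesis using transfer[OF w w' eq xR _ wx] by simp
    next
      case False
      show ?thesis
      proof (cases "level x = 0")
        case True
        interpret positive_functional ip \<Delta> S "\<lambda>x. aht (w x)" "ideal_of \<Delta> S w"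
          using dominant_positive_functional[OF admissible_dominant[OF w]] .
        have "x \<in> shifted (ideal_of \<Delta> S w)" using level_0_shifted[OF xR True] wx by simp
        then obtain \<beta> where "\<beta> \<in> \<Phi>p" "x = (\<beta>, 0, 0)" using True by (auto simp: shifted_def)
        then show ?thesis using admissible_dominant[OF w'] by (simp add: dominant_def)
      next
        case False
        then have "level (- x) < 0" using \<open>\<not> level x < 0\<close> by simp
        show ?thesis
        proof (rule ccontr)
          assume "\<not> ?thesis"
          then have "aht (w' (- x)) > 0"
            using aht_nonzero[OF Wa_real[OF W(2) xR]] Wa_minus[OF W(2), of x] by simp
          then have "aht (w (- x)) > 0"
            using transfer[OF w' w eq[symmetric] uminus_real_root[OF xR]] \<open>level (- x) < 0\<close> by simp
          then show False using wx Wa_minus[OF W(1), of x] by simp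
        qed
      qed
    qed
    then show "(w' \<circ> winv w) a \<in> \<Phi>a"
      using affine_pos_iff[OF Wa_real[OF W(2) xR]] by (simp add: x_def)
  qed
  then have "w' (winv w (w x)) = w x" for x by (metis comp_apply id_apply)
  then show ?thesis using W by auto
qed

end

section \<open>Existence of admissible elements\<close>

context root_system
begin

text \<open>Coincides with \<open>inversion_set\<close> for elements of \<open>Wa\<close>, with the
  sign expressed by the height.\<close>

definition inversions :: "('n affine_vec \<Rightarrow> 'n affine_vec) \<Rightarrow> 'n affine_vec set" where
  "inversions w = {x \<in> \<Phi>a. aht (w x) < 0}"

lemma inversions_sref:
  assumes w: "w \<in> Wa" and a: "a \<in> \<Pi>a"
  shows "inversions (sref a \<circ> w) \<subseteq> insert (winv w a) (inversions w)"
proof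
  fix x assume "x \<in> inversions (sref a \<circ> w)"
  then have x: "x \<in> \<Phi>a" "aht (sref a (w x)) < 0" by (auto simp: inversions_def)
  have R: "w x \<in> real_roots" using Wa_real[OF w] affine_pos_real x by blast
  show "x \<in> insert (winv w a) (inversions w)"
  proof (cases "aht (w x) < 0")
    case False
    then have pos: "w x \<in> \<Phi>a" using affine_neg_iff(2)[OF R] by blast
    have "w x = a"
    proof (rule ccontr)
      assume "w x \<noteq> a"
      then have "sref a (w x) \<in> \<Phi>a" using sref_simple_pos[OF a pos] by blast
      then have "aht (sref a (w x)) > 0" using affine_pos_iff affine_pos_real by blast
      then show False using x(2) by simp
    qed
    then show ?thesis using winv_left[OF w, of x] by simp
  qed (use x in \<open>simp add: inversions_def\<close>)
qed

lemma finite_inversions: "w \<in> Wa \<Longrightarrow> finite (inversions w)"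
proof (induction rule: Wa_induct)
  case id
  have "inversions id = {}" using affine_pos_iff affine_pos_real by (force simp: inversions_def)
  then show ?case by (simp only: finite.emptyI)
next
  case (left a w)
  then show ?case using finite_subset[OF inversions_sref] by blast
qed

text \<open>The only root that could become an inversion is \<open>winv w a\<close>, which is not
  positive; its negative ceases to be one.\<close>

lemma inversions_psubset:
  assumes w: "w \<in> Wa" and a: "a \<in> \<Pi>a" and neg: "aht (winv w a) < 0"
  shows "inversions (sref a \<circ> w) \<subset> inversions w"
proof -
  have aR: "a \<in> real_roots" using affine_simple_real a by blast
  have R: "winv w a \<in> real_roots" using Wa_real[OF winv_Wa[OF w] aR] .
  have "winv w a \<notin> inversions (sref a \<circ> w)"
    using neg affine_pos_iff[OF R] by (simp add: inversions_def)
  then have "inversions (sref a \<circ> w) \<subseteq> inversions w" using inversions_sref[OF w a] by blast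
  moreover have "- winv w a \<in> inversions w"
    using affine_pos_iff[OF uminus_real_root[OF R]] neg Wa_minus[OF w] w aht_simple[OF a]
    by (simp add: inversions_def)
  moreover have "sref a (w (- winv w a)) = a"
    using Wa_minus[OF w, of "winv w a"] w sref_self[OF aR] sref_involution[OF aR, of a] by simp
  then have "- winv w a \<notin> inversions (sref a \<circ> w)" using aht_simple[OF a] by (simp add: inversions_def)
  ultimately show ?thesis by blast
qed

lemma affine_posI: "\<beta> \<in> \<Phi>p \<Longrightarrow> (\<beta>, 0, 0) \<in> \<Phi>a" "\<beta> \<in> \<Delta> \<Longrightarrow> (\<beta>, 1, 0) \<in> \<Phi>a"
proof -
  show "(\<beta>, 0, 0) \<in> \<Phi>a" if "\<beta> \<in> \<Phi>p" using that by (auto simp: affine_pos_roots_def)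
  assume "\<beta> \<in> \<Delta>"
  then have "(\<beta>, of_int 1, 0) \<in> \<Phi>a" unfolding affine_pos_roots_def by blast
  then show "(\<beta>, 1, 0) \<in> \<Phi>a" by simp
qed

lemma ideal_of_inversions: "w \<in> Wa \<Longrightarrow> \<gamma> \<in> \<Phi>p \<Longrightarrow> \<gamma> \<in> ideal_of \<Delta> S w \<longleftrightarrow> (- \<gamma>, 1, 0) \<in> inversions w"
  using affine_posI(2)[of "- \<gamma>"] pos_rootD(1)[of \<gamma>] ideal_of_iff[of w \<gamma>] Wa_minus[of w "(\<gamma>, -1, 0)"]
  by (simp add: inversions_def)

text \<open>An element with the fewest inversions among those with the given ideal is admissible.\<close>

lemma admissible_of_dominant:
  assumes "dominant u"
  shows "\<exists>w\<in>adm. ideal_of \<Delta> S w = ideal_of \<Delta> S u"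
proof -
  define P where "P w \<longleftrightarrow> dominant w \<and> ideal_of \<Delta> S w = ideal_of \<Delta> S u" for w
  have "P u" using assms by (simp add: P_def)
  then obtain w where w: "P w" and least: "\<And>v. P v \<Longrightarrow> card (inversions w) \<le> card (inversions v)"
    using ex_has_least_nat[of P u "\<lambda>w. card (inversions w)"] by blast
  have dom: "dominant w" and W: "w \<in> Wa" using w by (auto simp: P_def dominant_def)
  have "\<exists>\<gamma>\<in>\<Phi>p. winv w a = (\<gamma>, -1, 0)" if a: "a \<in> \<Pi>a" and neg: "winv w a \<in> uminus ` \<Phi>a" for a
  proof -
    define v where "v = sref a \<circ> w"
    have aR: "a \<in> real_roots" using affine_simple_real a by blast
    have V: "v \<in> Wa" unfolding v_def using W a by (intro Wa_comp Wa_refl)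
    have "aht (winv w a) < 0" using affine_neg_iff(1)[OF Wa_real[OF winv_Wa[OF W] aR]] neg by blast
    then have sub: "inversions v \<subset> inversions w" unfolding v_def by (rule inversions_psubset[OF W a])
    have "aht (v (\<beta>, 0, 0)) > 0" if b: "\<beta> \<in> \<Phi>p" for \<beta>
    proof -
      have "(\<beta>, 0, 0) \<notin> inversions w" using dom b by (auto simp: dominant_def inversions_def)
      then have "(\<beta>, 0, 0) \<notin> inversions v" using sub by blast
      then have "\<not> aht (v (\<beta>, 0, 0)) < 0" using affine_posI(1)[OF b] by (simp add: inversions_def)
      then show ?thesis using aht_nonzero[OF Wa_real[OF V real_rootI0[OF pos_rootD(1)[OF b]]]] by simp
    qed
    then have "dominant v" using V by (simp add: dominant_def)
    moreover have "card (inversions v) < card (inversions w)"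
      using sub finite_inversions[OF W] by (rule psubset_card_mono[rotated])
    \<comment> \<open>\<open>v\<close> is dominant with fewer inversions, so by the choice of
      \<open>w\<close> it cannot have the same ideal. Some \<gamma> is lost.\<close>
    ultimately have "ideal_of \<Delta> S v \<noteq> ideal_of \<Delta> S w" using least[of v] w by (auto simp: P_def)
    moreover have "ideal_of \<Delta> S v \<subseteq> ideal_of \<Delta> S w"
      using sub ideal_of_inversions[OF V] ideal_of_inversions[OF W] by (auto simp: ideal_of_def)
    ultimately obtain \<gamma> where g: "\<gamma> \<in> ideal_of \<Delta> S w" "\<gamma> \<notin> ideal_of \<Delta> S v" by blast
    then have gp: "\<gamma> \<in> \<Phi>p" by (simp add: ideal_of_def)
    have R: "(\<gamma>, -1, 0) \<in> real_roots" using real_rootI1 pos_rootD(1)[OF gp] by blast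
    have "aht (w (\<gamma>, -1, 0)) > 0" using g ideal_of_iff[OF W] by blast
    then have pos: "w (\<gamma>, -1, 0) \<in> \<Phi>a" using affine_pos_iff[OF Wa_real[OF W R]] by blast
    \<comment> \<open>Losing \<gamma> means that \<open>sref a\<close> makes the positive root
      \<open>w (\<gamma>, -1, 0)\<close> negative, which happens to \<open>a\<close> only.\<close>
    have "w (\<gamma>, -1, 0) = a"
    proof (rule ccontr)
      assume "w (\<gamma>, -1, 0) \<noteq> a"
      then have "v (\<gamma>, -1, 0) \<in> \<Phi>a" using sref_simple_pos[OF a pos] by (simp add: v_def)
      then show False using g(2) gp ideal_of_iff[OF V] affine_pos_iff[OF Wa_real[OF V R]] by blast
    qed
    then have "winv w a = (\<gamma>, -1, 0)" using winv_left[OF W] by metis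
    then show ?thesis using gp by blast
  qed
  moreover have "w (\<alpha>, 0, 0) \<in> \<Phi>a" if "\<alpha> \<in> S" for \<alpha>
  proof -
    have "(\<alpha>, 0, 0) \<in> real_roots" using that simple_subset real_rootI0 by blast
    then show ?thesis
      using affine_pos_iff[OF Wa_real[OF W]] dom simple_pos[OF that] by (simp add: dominant_def)
  qed
  ultimately have "w \<in> adm" using W by (simp add: admissible_def)
  then show ?thesis using w by (auto simp: P_def)
qed

text \<open>After composing with \<open>sref a\<close>, the only root that turns from positive to
  negative is \<gamma> - \<delta>. So dominance survives and exactly \<gamma> leaves the
  ideal.\<close>

lemma remove_generator:
  assumes w: "w \<in> adm" and J: "ad_nilpotent_ideal \<Delta> S J" "ideal_of \<Delta> S w = J"
    and g: "\<gamma> \<in> ideal_generators \<Delta> S J"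
  shows "\<exists>v. dominant v \<and> ideal_of \<Delta> S v = J - {\<gamma>}"
proof -
  define a where "a = w (\<gamma>, -1, 0)"
  have a: "a \<in> \<Pi>a" unfolding a_def by (rule generator_imp_simple[OF w J g])
  have aR: "a \<in> real_roots" using affine_simple_real a by blast
  have W: "w \<in> Wa" using w by (rule admissible_Wa)
  define v where "v = sref a \<circ> w"
  have V: "v \<in> Wa" unfolding v_def using W a by (intro Wa_comp Wa_refl)
  have keep: "aht (v x) > 0" if "x \<in> real_roots" "aht (w x) > 0" "x \<noteq> (\<gamma>, -1, 0)" for x
  proof -
    have "w x \<in> \<Phi>a" using that affine_pos_iff[OF Wa_real[OF W]] by blast
    moreover have "w x \<noteq> a" unfolding a_def using that(3) Wa_eq_iff[OF W] by blast
    ultimately have "v x \<in> \<Phi>a" unfolding v_def using sref_simple_pos[OF a] by simp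
    then show ?thesis using affine_pos_iff affine_pos_real by blast
  qed
  have "aht (v (\<beta>, 0, 0)) > 0" if "\<beta> \<in> \<Phi>p" for \<beta>
    using keep[of "(\<beta>, 0, 0)"] that admissible_dominant[OF w] real_rootI0 pos_rootD(1)
    by (simp add: dominant_def)
  then have "dominant v" using V by (simp add: dominant_def)
  moreover have "ideal_of \<Delta> S v = J - {\<gamma>}"
  proof (rule Set.set_eqI)
    fix \<mu>
    show "\<mu> \<in> ideal_of \<Delta> S v \<longleftrightarrow> \<mu> \<in> J - {\<gamma>}"
    proof (cases "\<mu> \<in> \<Phi>p")
      case True
      have mD: "\<mu> \<in> \<Delta>" using True pos_rootD by blast
      consider "\<mu> = \<gamma>" | "\<mu> \<noteq> \<gamma>" "\<mu> \<in> J" | "\<mu> \<notin> J" by blast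
      then show ?thesis
      proof cases
        case 1
        then have "v (\<mu>, -1, 0) = - a" using sref_self[OF aR] by (simp add: v_def a_def)
        then show ?thesis using 1 ideal_of_iff[OF V] aht_simple[OF a] by simp
      next
        case 2
        then have "aht (v (\<mu>, -1, 0)) > 0"
          using keep[of "(\<mu>, -1, 0)"] real_rootI1(1)[OF mD] J(2) ideal_of_iff[OF W] by blast
        then show ?thesis using 2 True ideal_of_iff[OF V] by blast
      next
        case 3
        have R: "(\<mu>, -1, 0) \<in> real_roots" "(- \<mu>, 1, 0) \<in> real_roots"
          using real_rootI1 mD by simp_all
        have neg: "w (- \<mu>, 1, 0) = - w (\<mu>, -1, 0)" "v (- \<mu>, 1, 0) = - v (\<mu>, -1, 0)"
          using Wa_minus[OF W, of "(\<mu>, -1, 0)"] Wa_minus[OF V, of "(\<mu>, -1, 0)"] by simp_all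
        \<comment> \<open>Nothing new enters either: here \<delta> - \<mu> is positive under
          \<open>w\<close>, and \<open>keep\<close> applies to it because its level is 1.\<close>
        have "\<not> aht (w (\<mu>, -1, 0)) > 0" using 3 J(2) ideal_of_iff[OF W] True by blast
        then have "aht (w (- \<mu>, 1, 0)) > 0" using aht_nonzero[OF Wa_real[OF W R(1)]] neg by simp
        then have "aht (v (- \<mu>, 1, 0)) > 0" using keep[OF R(2)] by simp
        then show ?thesis using 3 neg ideal_of_iff[OF V] by simp
      qed
    next
      case False
      then show ?thesis using ideal_subset_pos[OF J(1)] by (auto simp: ideal_of_def)
    qed
  qed
  ultimately show ?thesis by blast
qed

text \<open>Conjugating by a simple reflection in acute position lowers the height of the root until
  it is simple. Reflections in non-simple roots are what translations are made of.\<close>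

lemma sref_Wa:
  assumes "x \<in> \<Phi>a"
  shows "sref x \<in> Wa"
  using assms
proof (induction "nat \<lfloor>aht x\<rfloor>" arbitrary: x rule: less_induct)
  case less
  have xR: "x \<in> real_roots" using affine_pos_real less.prems by blast
  show ?case
  proof (cases "x \<in> \<Pi>a")
    case True then show ?thesis by (rule Wa_refl)
  next
    case False
    obtain a where a: "a \<in> \<Pi>a" "ip (fst x) (fst a) > 0"
      using exists_acute_affine_simple[OF fst_real_root[OF xR]] by blast
    have aR: "a \<in> real_roots" using affine_simple_real a by blast
    define y where "y = sref a x"
    have y: "y \<in> \<Phi>a" unfolding y_def using sref_simple_pos[OF a(1) less.prems] False a(1) by blast
    have yR: "y \<in> real_roots" using affine_pos_real y by blast
    have "2 * affine_form ip x a / affine_form ip a a > 0"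
      using a(2) affine_form_real[OF xR aR] real_root_form_pos[OF aR] by simp
    then have "aht y < aht x"
      unfolding y_def affine_reflection_def by (simp add: aht_scale aht_simple[OF a(1)])
    moreover have "aht y \<in> \<int>" "aht x \<in> \<int>" "aht y > 0"
      using aht_int xR yR affine_pos_iff[OF yR] y by auto
    ultimately have "nat \<lfloor>aht y\<rfloor> < nat \<lfloor>aht x\<rfloor>" by (auto elim!: Ints_cases)
    then have "sref y \<in> Wa" using less.hyps y by blast
    moreover have "sref x = sref a \<circ> (sref y \<circ> sref a)"
    proof (rule ext)
      fix z
      have "sref a y = x" unfolding y_def using sref_involution[OF aR] .
      then show "sref x z = (sref a \<circ> (sref y \<circ> sref a)) z"
        using Wa_conj[OF Wa_refl[OF a(1)], of y "sref a z"] sref_involution[OF aR, of z] by simp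
    qed
    ultimately show ?thesis using Wa_comp Wa_refl[OF a(1)] by simp
  qed
qed

section \<open>Translations in the affine Weyl group\<close>

lemma coroot_ip: "\<alpha> \<in> \<Delta> \<Longrightarrow> ip x (coroot ip \<alpha>) *s \<alpha> = ip x \<alpha> *s coroot ip \<alpha>"
  by (simp add: coroot_def vec.scale_scale mult.commute)

lemma sref_lift: "sref (\<beta>, 0, 0) = affine_lift (root_reflection ip \<beta>)"
  by (rule ext) (auto simp: affine_reflection_def affine_lift_def affine_form_def affine_scale_def
      root_reflection_def coroot_def)

text \<open>The two reflecting hyperplanes are parallel, so the reflections differ by a translation.
  Cancelling the finite reflection exhibits the translation by a negative coroot as a product of two
  reflections.\<close>

lemma sref_lift_translation:
  assumes "\<beta> \<in> \<Delta>"
  shows "sref (- \<beta>, 1, 0) = affine_lift (root_reflection ip \<beta>) \<circ> translation ip (- coroot ip \<beta>)"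
proof (rule ext)
  fix z :: "'n affine_vec"
  obtain x k l where z: "z = (x, k, l)" by (cases z)
  have bb: "ip \<beta> \<beta> \<noteq> 0" using root_pos[OF assms] by (metis less_irrefl)
  have cc: "ip (coroot ip \<beta>) (coroot ip \<beta>) / 2 = 2 / ip \<beta> \<beta>"
    using bb by (simp add: coroot_def field_simps)
  have r: "root_reflection ip \<beta> (x - l *s coroot ip \<beta>) = x - (2 * ip x \<beta> / ip \<beta> \<beta>) *s \<beta> + (2 * l / ip \<beta> \<beta>) *s \<beta>"
    using bb by (simp add: root_reflection_def coroot_def vec_eq_iff field_simps)
  have "sref (- \<beta>, 1, 0) z = (x - (2 * ip x \<beta> / ip \<beta> \<beta>) *s \<beta> + (2 * l / ip \<beta> \<beta>) *s \<beta>,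
      k + 2 * ip x \<beta> / ip \<beta> \<beta> - 2 / ip \<beta> \<beta> * l, l)"
    by (simp add: z affine_reflection_def affine_form_def affine_scale_def vec_eq_iff)
      (simp add: algebra_simps add_divide_distrib diff_divide_distrib)
  also have "\<dots> = (affine_lift (root_reflection ip \<beta>) \<circ> translation ip (- coroot ip \<beta>)) z"
    using r by (simp add: z affine_lift_def translation_def cc) (simp add: coroot_def)
  finally show "sref (- \<beta>, 1, 0) z = (affine_lift (root_reflection ip \<beta>) \<circ> translation ip (- coroot ip \<beta>)) z" .
qed

lemma translation_add: "translation ip r (translation ip s x) = translation ip (r + s) x"
  by (cases x) (simp add: translation_def vec.scale_right_distrib ip_sym[of s r] field_simps)

lemma translation_0: "translation ip 0 = id"
  by (rule ext) (auto simp: translation_def)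

lemma translation_coroot_Wa:
  assumes "\<beta> \<in> \<Phi>p"
  shows "translation ip (- coroot ip \<beta>) \<in> Wa"
proof -
  have D: "\<beta> \<in> \<Delta>" using pos_rootD assms by blast
  have 1: "(\<beta>, 0, 0) \<in> \<Phi>a" "(- \<beta>, 1, 0) \<in> \<Phi>a" using affine_posI assms D by simp_all
  have "sref (\<beta>, 0, 0) (sref (\<beta>, 0, 0) x) = x" for x
    using sref_involution affine_pos_real 1 by blast
  then have "translation ip (- coroot ip \<beta>) = sref (\<beta>, 0, 0) \<circ> sref (- \<beta>, 1, 0)"
    by (intro ext) (simp add: sref_lift_translation[OF D] sref_lift)
  then show ?thesis using Wa_comp sref_Wa 1 by simp
qed

text \<open>The sum of positive coroots is the vector usually written
  \<open>2\<rho>\<^sup>\<or>\<close>. The reflection in \<open>a\<close> permutes the positive roots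
  other than \<open>a\<close> and negates pairings with \<open>a\<close>, so everything cancels
  except the contribution 2 of \<open>a\<close> itself.\<close>

lemma sum_pos_coroots:
  assumes a: "a \<in> S"
  shows "ip a (\<Sum>\<beta>\<in>\<Phi>p. coroot ip \<beta>) = 2"
proof -
  define f where "f \<beta> = ip a (coroot ip \<beta>)" for \<beta>
  define s where "s = root_reflection ip a"
  have aD: "a \<in> \<Delta>" using a simple_subset by blast
  have aa: "ip a a \<noteq> 0" using root_pos[OF aD] by (metis less_irrefl)
  have s_s: "s (s x) = x" for x
    using aa by (simp add: s_def root_reflection_def coroot_def vec_eq_iff)
  have s_ip: "ip a (s x) = - ip a x" for x
    using aa by (simp add: s_def root_reflection_def coroot_def ip_sym[of x a])
  have s_form: "ip (s x) (s x) = ip x x" for x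
    using aa by (simp add: s_def root_reflection_def coroot_def ip_sym[of a x] field_simps)
  have "s a = - a" using aa by (simp add: s_def root_reflection_def coroot_def vec_eq_iff)
  have s_in: "s \<beta> \<in> \<Phi>p - {a}" if "\<beta> \<in> \<Phi>p - {a}" for \<beta>
  proof -
    have "s \<beta> \<in> \<Phi>p" unfolding s_def using simple_reflection_pos[OF a] that by blast
    moreover have "s \<beta> \<noteq> a"
    proof
      assume "s \<beta> = a"
      then have "\<beta> = - a" using s_s[of \<beta>] \<open>s a = - a\<close> by simp
      then show False using that uminus_pos_root_iff[OF aD] simple_pos[OF a] by blast
    qed
    ultimately show ?thesis by blast
  qed
  have "bij_betw s (\<Phi>p - {a}) (\<Phi>p - {a})"
    by (rule bij_betw_byWitness[where f' = s]) (use s_s s_in in auto)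
  then have "(\<Sum>\<beta>\<in>\<Phi>p - {a}. f \<beta>) = (\<Sum>\<beta>\<in>\<Phi>p - {a}. f (s \<beta>))"
    by (rule sum.reindex_bij_betw[symmetric])
  also have "\<dots> = - (\<Sum>\<beta>\<in>\<Phi>p - {a}. f \<beta>)"
    by (simp add: f_def coroot_def s_form s_ip sum_negf)
  finally have "(\<Sum>\<beta>\<in>\<Phi>p - {a}. f \<beta>) = 0" by simp
  moreover have "(\<Sum>\<beta>\<in>\<Phi>p. f \<beta>) = f a + (\<Sum>\<beta>\<in>\<Phi>p - {a}. f \<beta>)"
    using finite_pos_roots simple_pos[OF a] by (rule sum.remove)
  ultimately show ?thesis using coroot_self[OF aD] by (simp add: f_def ip_sum_right)
qed

text \<open>Translating by minus the sum \<open>X\<close> of positive coroots raises the level of a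
  root \<gamma> by \<open>2 * ht \<gamma>\<close>. For a positive \<gamma> this is at least 2,
  enough to lift even level -1 above 0.\<close>

lemma dominant_full_ideal: "\<exists>w. dominant w \<and> ideal_of \<Delta> S w = \<Phi>p"
proof -
  define X where "X = (\<Sum>\<beta>\<in>\<Phi>p. coroot ip \<beta>)"
  define w where "w = translation ip (- X)"
  have "translation ip (\<Sum>\<beta>\<in>A. - coroot ip \<beta>) \<in> Wa" if "A \<subseteq> \<Phi>p" for A
    using finite_subset[OF that finite_pos_roots] that
  proof induction
    case empty then show ?case using Wa_id by (simp only: sum.empty translation_0)
  next
    case (insert \<beta> A)
    have "translation ip (\<Sum>\<beta>\<in>insert \<beta> A. - coroot ip \<beta>)
        = translation ip (- coroot ip \<beta>) \<circ> translation ip (\<Sum>\<beta>\<in>A. - coroot ip \<beta>)"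
      by (rule ext) (simp only: comp_apply translation_add sum.insert[OF insert.hyps])
    moreover have "\<beta> \<in> \<Phi>p" "A \<subseteq> \<Phi>p" using insert.prems by auto
    ultimately show ?case using Wa_comp[OF translation_coroot_Wa insert.IH] by (simp only:)
  qed
  then have W: "w \<in> Wa" by (simp add: w_def X_def sum_negf)
  have X: "ip \<gamma> X = 2 * ht \<gamma>" for \<gamma>
  proof -
    have "ip \<gamma> X = (\<Sum>a\<in>S. cf \<gamma> a * ip a X)"
      by (subst cf_sum[of \<gamma>, symmetric]) (simp add: ip_sum_left)
    also have "\<dots> = (\<Sum>a\<in>S. cf \<gamma> a * 2)" using sum_pos_coroots by (simp add: X_def)
    finally show ?thesis by (simp add: ht_def sum_distrib_left mult.commute)
  qed
  have w: "aht (w (\<gamma>, k, 0)) = ht \<gamma> + (k + 2 * ht \<gamma>) * (1 + ht \<theta>)" for \<gamma> k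
    by (simp add: w_def translation_def aht_def X)
  have pos: "aht (w (\<gamma>, k, 0)) > 0" if "\<gamma> \<in> \<Phi>p" "k \<ge> -1" for \<gamma> k
  proof -
    have "(k + 2 * ht \<gamma>) * (1 + ht \<theta>) \<ge> 0"
      using ht_pos_root[OF that(1)] that(2) ht_highest_root_pos by (intro mult_nonneg_nonneg) auto
    then show ?thesis using ht_pos_root[OF that(1)] unfolding w by linarith
  qed
  then have "dominant w" using W by (simp add: dominant_def)
  moreover have "ideal_of \<Delta> S w = \<Phi>p" using ideal_of_iff[OF W] pos by auto
  ultimately show ?thesis by blast
qed

text \<open>A root above \<gamma> is too high to be outside \<open>I\<close>, so the enlarged set is
  an ideal. If \<gamma> - \<alpha> were in \<open>I\<close>, then \<gamma> would be too, so \<gamma>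
  is a generator.\<close>

lemma insert_maximal_ideal:
  assumes I: "ad_nilpotent_ideal \<Delta> S I" and g: "\<gamma> \<in> \<Phi>p - I"
    and max: "\<And>\<beta>. \<beta> \<in> \<Phi>p - I \<Longrightarrow> ht \<beta> \<le> ht \<gamma>"
  shows "ad_nilpotent_ideal \<Delta> S (insert \<gamma> I)" "\<gamma> \<in> ideal_generators \<Delta> S (insert \<gamma> I)"
proof -
  show "ad_nilpotent_ideal \<Delta> S (insert \<gamma> I)"
    unfolding ad_nilpotent_ideal_def
  proof (intro conjI ballI impI)
    show "insert \<gamma> I \<subseteq> \<Phi>p" using g ideal_subset_pos[OF I] by blast
    fix \<mu> \<nu> assume m: "\<mu> \<in> insert \<gamma> I" and n: "\<nu> \<in> \<Phi>p" and D: "\<mu> + \<nu> \<in> \<Delta>"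
    show "\<mu> + \<nu> \<in> insert \<gamma> I"
    proof (cases "\<mu> \<in> I")
      case True then show ?thesis using ideal_step[OF I _ n D] by blast
    next
      case False
      then have m: "\<mu> = \<gamma>" using m by blast
      have "ht (\<gamma> + \<nu>) > ht \<gamma>" using ht_pos_root[OF n] by simp
      moreover have "\<gamma> + \<nu> \<in> \<Phi>p"
        using D m pos_root_iff[of "\<gamma> + \<nu>"] calculation ht_pos_root[of \<gamma>] g by auto
      ultimately have "\<gamma> + \<nu> \<in> I" using max[of "\<gamma> + \<nu>"] by force
      then show ?thesis using m by simp
    qed
  qed
  show "\<gamma> \<in> ideal_generators \<Delta> S (insert \<gamma> I)"
    unfolding ideal_generators_def
  proof (intro CollectI conjI ballI notI)
    fix \<alpha> assume a: "\<alpha> \<in> \<Phi>p" and "\<gamma> - \<alpha> \<in> insert \<gamma> I"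
    moreover have "\<alpha> \<noteq> 0" using a pos_rootD root_nonzero by blast
    ultimately have "\<gamma> - \<alpha> \<in> I" by auto
    then show False using ideal_step[OF I _ a, of "\<gamma> - \<alpha>"] g pos_rootD by simp
  qed simp
qed

text \<open>The induction is on the number of missing roots: put back one of greatest height, take
  the element of the larger ideal, and remove the root again as a generator.\<close>

lemma admissible_exists:
  assumes "ad_nilpotent_ideal \<Delta> S I"
  shows "\<exists>w\<in>adm. ideal_of \<Delta> S w = I"
  using assms
proof (induction "card (\<Phi>p - I)" arbitrary: I rule: less_induct)
  case less
  show ?case
  proof (cases "\<Phi>p - I = {}")
    case True
    then have "I = \<Phi>p" using ideal_subset_pos[OF less.prems] by blast
    then show ?thesis using dominant_full_ideal admissible_of_dominant by metis
  next
    case False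
    have fin: "finite (\<Phi>p - I)" using finite_pos_roots by simp
    have "Max (ht ` (\<Phi>p - I)) \<in> ht ` (\<Phi>p - I)" using fin False by (intro Max_in) auto
    then obtain \<gamma> where g: "\<gamma> \<in> \<Phi>p - I" "Max (ht ` (\<Phi>p - I)) = ht \<gamma>" by blast
    then have max: "ht \<beta> \<le> ht \<gamma>" if "\<beta> \<in> \<Phi>p - I" for \<beta>
      using Max_ge[of "ht ` (\<Phi>p - I)" "ht \<beta>"] fin that by simp
    note J = insert_maximal_ideal[OF less.prems g(1) max]
    have "card (\<Phi>p - insert \<gamma> I) < card (\<Phi>p - I)" using fin g(1) by (intro psubset_card_mono) auto
    then obtain w where w: "w \<in> adm" "ideal_of \<Delta> S w = insert \<gamma> I" using less.hyps J(1) by blast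
    obtain v where v: "dominant v" "ideal_of \<Delta> S v = insert \<gamma> I - {\<gamma>}"
      using remove_generator[OF w(1) J(1) w(2) J(2)] by blast
    have "insert \<gamma> I - {\<gamma>} = I" using g(1) by blast
    then show ?thesis using admissible_of_dominant[OF v(1)] v(2) by simp
  qed
qed

lemma admissible_of:
  assumes "ad_nilpotent_ideal \<Delta> S I"
  shows "admissible_of ip \<Delta> S I \<in> adm" "ideal_of \<Delta> S (admissible_of ip \<Delta> S I) = I"
proof -
  obtain w where w: "w \<in> adm" "ideal_of \<Delta> S w = I" using admissible_exists[OF assms] by blast
  have "admissible_of ip \<Delta> S I = w"
    unfolding admissible_of_def the_inv_into_def using w admissible_unique by (intro the_equality) auto
  then show "admissible_of ip \<Delta> S I \<in> adm" "ideal_of \<Delta> S (admissible_of ip \<Delta> S I) = I"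
    using w by simp_all
qed

section \<open>The decomposition of the affine Weyl group\<close>

lemma root_reflection_involution: "\<alpha> \<in> \<Delta> \<Longrightarrow> root_reflection ip \<alpha> (root_reflection ip \<alpha> x) = x"
  using root_pos[of \<alpha>] by (auto simp: root_reflection_def coroot_def vec_eq_iff)

lemma root_reflection_form:
  "\<alpha> \<in> \<Delta> \<Longrightarrow> ip (root_reflection ip \<alpha> x) (root_reflection ip \<alpha> y) = ip x y"
  using root_pos[of \<alpha>] by (simp add: root_reflection_def coroot_def ip_sym[of \<alpha> y] field_simps)

lemma root_reflection_add: "root_reflection ip \<alpha> (x + y) = root_reflection ip \<alpha> x + root_reflection ip \<alpha> y"
  and root_reflection_scale: "root_reflection ip \<alpha> (c *s x) = c *s root_reflection ip \<alpha> x"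
  by (simp_all add: root_reflection_def vec_eq_iff algebra_simps)

lemma root_reflection_adjoint:
  "\<alpha> \<in> \<Delta> \<Longrightarrow> ip (root_reflection ip \<alpha> x) y = ip x (root_reflection ip \<alpha> y)"
  using root_reflection_form[of \<alpha> x "root_reflection ip \<alpha> y"] by (simp add: root_reflection_involution)

lemma root_reflection_conj:
  assumes "\<alpha> \<in> \<Delta>"
  shows "root_reflection ip (root_reflection ip \<alpha> \<beta>) x
    = root_reflection ip \<alpha> (root_reflection ip \<beta> (root_reflection ip \<alpha> x))"
proof -
  have "root_reflection ip \<alpha> (u - c *s \<beta>) = root_reflection ip \<alpha> u - c *s root_reflection ip \<alpha> \<beta>" for u c
    by (simp add: root_reflection_def vec_eq_iff algebra_simps)
  then show ?thesis
    by (simp add: root_reflection_def[of ip "root_reflection ip \<alpha> \<beta>"] root_reflection_def[of ip \<beta>]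
        coroot_def root_reflection_form[OF assms] root_reflection_involution[OF assms]
        root_reflection_adjoint[OF assms])
qed

section \<open>The finite Weyl group\<close>

abbreviation "W \<equiv> weyl_group ip S"

lemma W_comp_list: "W = {comp_list fs | fs. set fs \<subseteq> root_reflection ip ` S}"
  unfolding weyl_group_def using simple_subset
  by (intro generate_involutions) (auto simp: root_reflection_involution)

lemma W_id: "id \<in> W"
  unfolding W_comp_list by (auto intro!: exI[of _ "[]"])

lemma W_comp: "u \<in> W \<Longrightarrow> v \<in> W \<Longrightarrow> u \<circ> v \<in> W"
proof -
  assume "u \<in> W" "v \<in> W"
  then obtain fs gs where "u = comp_list fs" "v = comp_list gs"
    "set fs \<subseteq> root_reflection ip ` S" "set gs \<subseteq> root_reflection ip ` S" by (auto simp: W_comp_list)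
  then show ?thesis unfolding W_comp_list by (auto intro!: exI[of _ "fs @ gs"] simp: comp_list_append)
qed

lemma W_simple: "a \<in> S \<Longrightarrow> root_reflection ip a \<in> W"
  unfolding W_comp_list by (auto intro!: exI[of _ "[root_reflection ip a]"])

lemma W_reflection:
  assumes "\<beta> \<in> \<Phi>p"
  shows "root_reflection ip \<beta> \<in> W"
  using assms
proof (induction rule: pos_root_induct)
  case (root \<beta>)
  show ?case
  proof (cases "\<beta> \<in> S")
    case True then show ?thesis by (rule W_simple)
  next
    case False
    then obtain a where a: "a \<in> S" "ip \<beta> a > 0" "root_reflection ip a \<beta> \<in> \<Phi>p"
      "ht (root_reflection ip a \<beta>) \<le> ht \<beta> - 1" using nonsimple_reflect root.hyps by blast
    have aD: "a \<in> \<Delta>" using a simple_subset by blast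
    have "root_reflection ip \<beta> = root_reflection ip a \<circ> (root_reflection ip (root_reflection ip a \<beta>) \<circ> root_reflection ip a)"
      by (rule ext) (simp add: root_reflection_conj[OF aD] root_reflection_involution[OF aD])
    then show ?thesis
      using W_comp[OF W_simple[OF a(1)] W_comp[OF root(2)[OF a(3,4)] W_simple[OF a(1)]]] by (simp only:)
  qed
qed

section \<open>The coroot lattice\<close>

abbreviation "Q \<equiv> coroot_lattice ip S"

lemma Q_zero: "0 \<in> Q"
  unfolding coroot_lattice_def by (intro CollectI exI[of _ "\<lambda>_. 0"]) simp

lemma Q_add_scale: "x \<in> Q \<Longrightarrow> y \<in> Q \<Longrightarrow> x + of_int k *s y \<in> Q"
proof -
  assume "x \<in> Q" "y \<in> Q"
  then obtain c d :: "rat ^ 'n \<Rightarrow> int" where "x = (\<Sum>\<alpha>\<in>S. of_int (c \<alpha>) *s coroot ip \<alpha>)"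
    "y = (\<Sum>\<alpha>\<in>S. of_int (d \<alpha>) *s coroot ip \<alpha>)" by (auto simp: coroot_lattice_def)
  then have "x + of_int k *s y = (\<Sum>\<alpha>\<in>S. of_int (c \<alpha> + k * d \<alpha>) *s coroot ip \<alpha>)"
    by (simp add: vec.scale_sum_right vec.scale_left_distrib sum.distrib)
  then show ?thesis
    unfolding coroot_lattice_def by (intro CollectI exI[of _ "\<lambda>\<alpha>. c \<alpha> + k * d \<alpha>"] conjI TrueI)
qed

lemma Q_diff_scale: "x \<in> Q \<Longrightarrow> y \<in> Q \<Longrightarrow> c \<in> \<int> \<Longrightarrow> x - c *s y \<in> Q"
  using Q_add_scale[of x y] by (auto elim!: Ints_cases simp: vec_eq_iff) (metis of_int_minus add_uminus_conv_diff vec.scale_minus_left)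

lemma Q_simple: "a \<in> S \<Longrightarrow> coroot ip a \<in> Q"
proof -
  assume a: "a \<in> S"
  have "coroot ip a = (\<Sum>\<alpha>\<in>S. if \<alpha> = a then coroot ip \<alpha> else 0)" using a finite_simple by simp
  also have "\<dots> = (\<Sum>\<alpha>\<in>S. of_int (if \<alpha> = a then 1 else 0) *s coroot ip \<alpha>)" by (intro sum.cong) auto
  finally show ?thesis
    unfolding coroot_lattice_def by (intro CollectI exI[of _ "\<lambda>\<alpha>. if \<alpha> = a then 1 else 0"] conjI TrueI)
qed

lemma Q_ip_int: "r \<in> Q \<Longrightarrow> \<beta> \<in> \<Delta> \<Longrightarrow> ip r \<beta> \<in> \<int>"
proof -
  assume r: "r \<in> Q" and b: "\<beta> \<in> \<Delta>"
  obtain c :: "rat ^ 'n \<Rightarrow> int" where c: "r = (\<Sum>\<alpha>\<in>S. of_int (c \<alpha>) *s coroot ip \<alpha>)"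
    using r by (auto simp: coroot_lattice_def)
  have "ip (coroot ip \<alpha>) \<beta> \<in> \<int>" if "\<alpha> \<in> S" for \<alpha>
    using cartan_int[of \<alpha> \<beta>] that simple_subset b ip_sym[of \<beta>] by auto
  then show ?thesis unfolding c by (auto simp: ip_sum_left intro!: Ints_sum Ints_mult)
qed

lemma root_reflection_coroot:
  assumes "\<beta> \<in> \<Delta>"
  shows "root_reflection ip \<beta> x = x - ip x \<beta> *s coroot ip \<beta>"
  using coroot_ip[OF assms] by (simp add: root_reflection_def)

text \<open>The coroot of \<beta> is a simple reflection of the coroot of a lower root, and simple
  reflections preserve the lattice because its elements pair integrally with roots.\<close>

lemma Q_coroot:
  assumes "\<beta> \<in> \<Phi>p"
  shows "coroot ip \<beta> \<in> Q"
  using assms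
proof (induction rule: pos_root_induct)
  case (root \<beta>)
  show ?case
  proof (cases "\<beta> \<in> S")
    case True then show ?thesis by (rule Q_simple)
  next
    case False
    then obtain a where a: "a \<in> S" "ip \<beta> a > 0" "root_reflection ip a \<beta> \<in> \<Phi>p"
      "ht (root_reflection ip a \<beta>) \<le> ht \<beta> - 1" using nonsimple_reflect root.hyps by blast
    define \<gamma> where "\<gamma> = root_reflection ip a \<beta>"
    have aD: "a \<in> \<Delta>" using a simple_subset by blast
    have IH: "coroot ip \<gamma> \<in> Q" unfolding \<gamma>_def using root(2) a by blast
    have "\<beta> = root_reflection ip a \<gamma>" by (simp add: \<gamma>_def root_reflection_involution[OF aD])
    moreover have "ip \<beta> \<beta> = ip \<gamma> \<gamma>" by (simp add: \<gamma>_def root_reflection_form[OF aD])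
    ultimately have "coroot ip \<beta> = root_reflection ip a (coroot ip \<gamma>)"
      by (metis coroot_def root_reflection_scale)
    then have "coroot ip \<beta> = coroot ip \<gamma> - ip (coroot ip \<gamma>) a *s coroot ip a"
      using root_reflection_coroot[OF aD] by simp
    then show ?thesis using Q_diff_scale[OF IH Q_simple[OF a(1)] Q_ip_int[OF IH aD]] by simp
  qed
qed

text \<open>The semidirect product relation: a translation passes a finite reflection by having its
  vector reflected.\<close>

lemma translation_lift:
  assumes "\<beta> \<in> \<Delta>"
  shows "translation ip r (affine_lift (root_reflection ip \<beta>) x)
    = affine_lift (root_reflection ip \<beta>) (translation ip (root_reflection ip \<beta> r) x)"
  by (cases x) (simp add: translation_def affine_lift_def root_reflection_add root_reflection_scale
      root_reflection_involution[OF assms] root_reflection_adjoint[OF assms] root_reflection_form[OF assms])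

lemma affine_lift_comp: "affine_lift u (affine_lift v x) = affine_lift (u \<circ> v) x"
  by (cases x) (simp add: affine_lift_def)

lemma Wa_decomp:
  assumes "w \<in> Wa"
  shows "\<exists>v\<in>W. \<exists>r\<in>Q. w = affine_lift v \<circ> translation ip r"
proof -
  obtain as where "w = word as" "set as \<subseteq> \<Pi>a" using assms by (auto simp: Wa_word)
  then show ?thesis
  \<comment> \<open>Letters are appended on the right, next to the translation; each is moved past
    it and absorbed into the finite part.\<close>
  proof (induction as arbitrary: w rule: rev_induct)
    case Nil
    have "w = affine_lift id \<circ> translation ip 0"
      using Nil by (auto simp: affine_lift_def translation_def)
    then show ?case using W_id Q_zero by blast
  next
    case (snoc a as)
    have "\<exists>v\<in>W. \<exists>r\<in>Q. word as = affine_lift v \<circ> translation ip r"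
      using snoc.prems by (intro snoc.IH[OF refl]) simp
    then obtain v r where v: "v \<in> W" and r: "r \<in> Q" and IH: "word as = affine_lift v \<circ> translation ip r"
      by blast
    have w: "w x = affine_lift v (translation ip r (sref a x))" for x
      using snoc.prems IH by (simp add: word_append)
    have step: "affine_lift v (translation ip r (affine_lift (root_reflection ip \<beta>) x))
        = affine_lift (v \<circ> root_reflection ip \<beta>) (translation ip (root_reflection ip \<beta> r) x)"
      and mem: "v \<circ> root_reflection ip \<beta> \<in> W" "root_reflection ip \<beta> r \<in> Q" if "\<beta> \<in> \<Phi>p" for \<beta> x
    proof -
      have D: "\<beta> \<in> \<Delta>" using that pos_rootD by blast
      show "affine_lift v (translation ip r (affine_lift (root_reflection ip \<beta>) x))
        = affine_lift (v \<circ> root_reflection ip \<beta>) (translation ip (root_reflection ip \<beta> r) x)"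
        by (simp add: translation_lift[OF D] affine_lift_comp)
      show "v \<circ> root_reflection ip \<beta> \<in> W" using v W_reflection[OF that] by (rule W_comp)
      show "root_reflection ip \<beta> r \<in> Q"
        unfolding root_reflection_coroot[OF D] using r Q_coroot[OF that] Q_ip_int[OF r D] by (rule Q_diff_scale)
    qed
    have "a \<in> \<Pi>a" using snoc.prems by simp
    then show ?case
    proof (cases rule: affine_simple_cases)
      case (1 b)
      then have b: "b \<in> \<Phi>p" using simple_pos by blast
      have "w = affine_lift (v \<circ> root_reflection ip b) \<circ> translation ip (root_reflection ip b r)"
        by (rule ext) (simp only: w 1 sref_lift step[OF b] comp_apply)
      then show ?thesis using mem[OF b] by blast
    next
      case 2
      have "w = affine_lift (v \<circ> root_reflection ip \<theta>) \<circ> translation ip (root_reflection ip \<theta> r + - coroot ip \<theta>)"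
        by (rule ext) (simp only: w 2 sref_lift_translation[OF highest_root(1)] step[OF highest_root_pos]
            comp_apply translation_add)
      moreover have "root_reflection ip \<theta> r + - coroot ip \<theta> \<in> Q"
        using Q_diff_scale[OF mem(2)[OF highest_root_pos] Q_coroot[OF highest_root_pos], of 1] by simp
      ultimately show ?thesis using mem(1)[OF highest_root_pos] by blast
    qed
  qed
qed

text \<open>A translation sends \<lambda> to its vector \<open>r\<close> modulo \<delta> and
  \<lambda>, and the finite part then produces \<open>v r\<close>. Uniqueness of the pair is visible
  already on the finite space, where \<open>w\<close> is x \<mapsto> v(x) - (x,r)\<delta>.\<close>

lemma d_elem_eq:
  assumes "w \<in> Wa"
  shows "d_elem ip S w = fst (w (0, 0, 1))"
proof -
  obtain v r where vr: "v \<in> W" "r \<in> Q" "w = affine_lift v \<circ> translation ip r"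
    using Wa_decomp[OF assms] by blast
  have unique: "v' = v \<and> r' = r" if "w = affine_lift v' \<circ> translation ip r'" for v' r'
  proof -
    have "affine_lift v' (translation ip r' (x, 0, 0)) = affine_lift v (translation ip r (x, 0, 0))" for x
      using that vr(3) by (metis comp_apply)
    then have eq: "v' x = v x" "ip x r' = ip x r" for x
      by (simp_all add: affine_lift_def translation_def)
    show ?thesis using eq ip_nondegenerate[of r' r] by auto
  qed
  have "weyl_decomp ip S w = (v, r)"
    unfolding weyl_decomp_def
  proof (rule the_equality)
    show "case (v, r) of (v, r) \<Rightarrow> v \<in> W \<and> r \<in> Q \<and> w = affine_lift v \<circ> translation ip r" using vr by simp
    fix z assume "case z of (v, r) \<Rightarrow> v \<in> W \<and> r \<in> Q \<and> w = affine_lift v \<circ> translation ip r"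
    then show "z = (v, r)" using unique[of "fst z" "snd z"] by (auto simp: case_prod_beta prod_eq_iff)
  qed
  then show ?thesis by (simp add: d_elem_def vr(3) affine_lift_def translation_def)
qed

text \<open>The level is the pairing with \<lambda>, and the isometry \<open>w\<close> can be moved
  to the other side. The unknown \<delta>-coefficient \<open>k'\<close> of \<open>w c\<close> drops
  out since the argument has no \<lambda>-component.\<close>

lemma level_winv:
  assumes w: "w \<in> Wa"
  shows "level (winv w (y, k, 0)) = ip (d_elem ip S w) y + k"
proof -
  define c :: "'n affine_vec" where "c = (0, 0, 1)"
  have last: "snd (snd x) = affine_form ip x (imag 1)" for x :: "'n affine_vec"
    by (cases x) (simp add: affine_form_def imag_def)
  have "snd (snd (w c)) = snd (snd c)"
    using Wa_form[OF w, of c "imag 1"] Wa_imag[OF w] by (simp add: last)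
  then obtain k' where wc: "w c = (d_elem ip S w, k', 1)"
    using d_elem_eq[OF w] by (cases "w c") (simp add: c_def)
  have "level (winv w (y, k, 0)) = affine_form ip (winv w (y, k, 0)) c"
    by (cases "winv w (y, k, 0)") (simp add: affine_form_def c_def)
  also have "\<dots> = affine_form ip (y, k, 0) (w c)"
    using Wa_form[OF w, of "winv w (y, k, 0)" c] w by simp
  also have "\<dots> = ip (d_elem ip S w) y + k"
    by (simp add: wc affine_form_def ip_sym)
  finally show ?thesis .
qed

end

section \<open>Minimal faces of polyhedra\<close>

context rat_inner
begin

text \<open>Active constraints do not change along \<open>x\<close>, and the finitely many inactive
  ones leave room for a short step. This serves both to go beyond \<open>d\<close> and to move
  inside its face.\<close>

lemma polyhedron_slack:
  assumes A: "finite A" and d: "\<And>a. a \<in> A \<Longrightarrow> ip d (f a) \<ge> c a"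
    and x: "\<And>a. a \<in> A \<Longrightarrow> ip d (f a) = c a \<Longrightarrow> ip x (f a) = 0"
  shows "\<exists>e>0. \<forall>a\<in>A. ip (d + e *s x) (f a) \<ge> c a"
  using A d x
proof (induction A)
  case empty
  then show ?case by (intro exI[of _ 1]) simp
next
  case (insert a A)
  then obtain e where e: "e > 0" "\<And>b. b \<in> A \<Longrightarrow> ip (d + e *s x) (f b) \<ge> c b" by auto
  show ?case
  proof (cases "ip d (f a) = c a")
    case True
    then have "ip x (f a) = 0" using insert.prems by blast
    then show ?thesis using True e by (intro exI[of _ e]) auto
  next
    case False
    then have slack: "ip d (f a) - c a > 0" using insert.prems(1)[of a] by simp
    \<comment> \<open>The added 1 keeps the denominator positive when \<open>x\<close> is orthogonal
      to \<open>f a\<close>.\<close>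
    define s where "s = (ip d (f a) - c a) / (\<bar>ip x (f a)\<bar> + 1)"
    define m where "m = min e s"
    have s: "s > 0" using slack by (simp add: s_def)
    have m: "m > 0" "m \<le> e" "m \<le> s" using e s by (auto simp: m_def)
    have "m * \<bar>ip x (f a)\<bar> \<le> s * (\<bar>ip x (f a)\<bar> + 1)" using m by (intro mult_mono) auto
    also have "\<dots> = ip d (f a) - c a" by (simp add: s_def)
    finally have "\<bar>m * ip x (f a)\<bar> \<le> ip d (f a) - c a" using m by (simp add: abs_mult)
    then have "ip (d + m *s x) (f a) \<ge> c a" by simp
    moreover have "ip (d + m *s x) (f b) \<ge> c b" if b: "b \<in> A" for b
    proof (cases "ip x (f b) \<ge> 0")
      case True
      then have "m * ip x (f b) \<ge> 0" using m by simp
      then show ?thesis using insert.prems(1)[of b] b by simp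
    next
      case False
      then have "e * ip x (f b) \<le> m * ip x (f b)" using m by (intro mult_right_mono_neg) auto
      then show ?thesis using e(2)[OF b] by simp
    qed
    ultimately show ?thesis using m by (intro exI[of _ m]) auto
  qed
qed

text \<open>From any point satisfying the active equations, the segment to \<open>d\<close> can be
  prolonged beyond \<open>d\<close> within the polyhedron. So \<open>d\<close> is an interior point
  of a segment ending there, and every face containing \<open>d\<close> contains that point.\<close>

lemma minimal_face_polyhedron:
  assumes A: "finite A" and d: "\<And>a. a \<in> A \<Longrightarrow> ip d (f a) \<ge> c a"
  shows "minimal_face {x. \<forall>a\<in>A. ip x (f a) \<ge> c a} d
    = {x. (\<forall>a\<in>A. ip x (f a) \<ge> c a) \<and> (\<forall>a\<in>A. ip d (f a) = c a \<longrightarrow> ip x (f a) = c a)}"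
    (is "minimal_face ?P d = ?F")
proof -
  have conv_ge: "ip ((1 - t) *s x + t *s y) z \<ge> k"
    if "0 \<le> t" "t \<le> 1" "ip x z \<ge> k" "ip y z \<ge> k" for t x y z k
  proof -
    have "(1 - t) * k + t * k \<le> (1 - t) * ip x z + t * ip y z"
      using that by (intro add_mono mult_left_mono) auto
    then show ?thesis by (simp add: algebra_simps)
  qed
  have conv_eq: "ip ((1 - t) *s x + t *s y) z = k" if "ip x z = k" "ip y z = k" for t x y z k
    using that by (simp add: algebra_simps)
  have extreme: "p = k \<and> q = k" if "(1 - t) * p + t * q = k" "p \<ge> k" "q \<ge> k" "0 < t" "t < 1"
    for p q k t :: rat
  proof -
    have "(1 - t) * (p - k) + t * (q - k) = 0" using that(1) by (simp add: algebra_simps)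
    moreover have "(1 - t) * (p - k) \<ge> 0" "t * (q - k) \<ge> 0" using that by auto
    ultimately have "(1 - t) * (p - k) = 0" "t * (q - k) = 0" by linarith+
    then show ?thesis using that by auto
  qed
  have F: "rat_face_of ?F ?P"
    unfolding rat_face_of_def
  proof (intro conjI ballI allI impI)
    show "?F \<subseteq> ?P" by blast
    show "rat_convex ?F"
      unfolding rat_convex_def
    proof (intro ballI allI impI CollectI conjI)
      fix x y :: "rat ^ 'n" and t :: rat and a assume "x \<in> ?F" "y \<in> ?F" "0 \<le> t \<and> t \<le> 1" "a \<in> A"
      then show "ip ((1 - t) *s x + t *s y) (f a) \<ge> c a" by (intro conv_ge) auto
    next
      fix x y :: "rat ^ 'n" and t :: rat and a assume "x \<in> ?F" "y \<in> ?F" "a \<in> A" "ip d (f a) = c a"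
      then show "ip ((1 - t) *s x + t *s y) (f a) = c a" by (intro conv_eq) auto
    qed
    fix x y :: "rat ^ 'n" and t :: rat assume x: "x \<in> ?P" and y: "y \<in> ?P" and t: "0 < t \<and> t < 1 \<and> (1 - t) *s x + t *s y \<in> ?F"
    have "ip x (f a) = c a \<and> ip y (f a) = c a" if "a \<in> A" "ip d (f a) = c a" for a
    proof (rule extreme)
      have "ip ((1 - t) *s x + t *s y) (f a) = c a" using t that by blast
      then show "(1 - t) * ip x (f a) + t * ip y (f a) = c a" by (simp only: ip_add_left ip_scale_left)
    qed (use x y t that in auto)
    then show "x \<in> ?F" "y \<in> ?F" using x y by auto
  qed
  have minimal: "?F \<subseteq> G" if G: "rat_face_of G ?P" "d \<in> G" for G
  proof
    fix y assume y: "y \<in> ?F"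
    obtain e where e: "e > 0" "\<forall>a\<in>A. ip (d + e *s (d - y)) (f a) \<ge> c a"
      using polyhedron_slack[where A = A and d = d and f = f and c = c and x = "d - y"] A d y by auto
    define z where "z = d + e *s (d - y)"
    \<comment> \<open>Chosen so that \<open>d\<close> is the point with parameter \<open>t\<close>
      on the segment from \<open>y\<close> to \<open>z\<close>.\<close>
    define t where "t = 1 / (1 + e)"
    have t: "0 < t" "t < 1" "t * (1 + e) = 1" using e(1) by (auto simp: t_def)
    have "(1 - t) *s y + t *s z = (t * (1 + e)) *s d + (1 - t * (1 + e)) *s y"
      by (simp add: z_def vec_eq_iff algebra_simps)
    then have "(1 - t) *s y + t *s z = d" using t(3) by simp
    then have z: "0 < t \<and> t < 1 \<and> (1 - t) *s y + t *s z \<in> G" using t(1,2) G(2) by (simp only: simp_thms)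
    have "y \<in> ?P" "z \<in> ?P" using y e(2) by (auto simp: z_def)
    moreover have "\<forall>x\<in>?P. \<forall>y\<in>?P. \<forall>t. 0 < t \<and> t < 1 \<and> (1 - t) *s x + t *s y \<in> G \<longrightarrow> x \<in> G \<and> y \<in> G"
      using G(1) unfolding rat_face_of_def by (elim conjE)
    ultimately show "y \<in> G" using z by blast
  qed
  show ?thesis
    unfolding minimal_face_def
  proof (rule the_equality)
    show "rat_face_of ?F ?P \<and> d \<in> ?F \<and> (\<forall>G. rat_face_of G ?P \<and> d \<in> G \<longrightarrow> ?F \<subseteq> G)"
      using F minimal d by blast
    fix F' assume F': "rat_face_of F' ?P \<and> d \<in> F' \<and> (\<forall>G. rat_face_of G ?P \<and> d \<in> G \<longrightarrow> F' \<subseteq> G)"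
    have "d \<in> ?F" using d by auto
    then have "F' \<subseteq> ?F" using F' F by blast
    moreover have "?F \<subseteq> F'" using minimal F' by blast
    ultimately show "F' = ?F" by (rule subset_antisym)
  qed
qed

text \<open>Differences of points of the face are orthogonal to the active normals. Conversely, a
  small multiple of any vector orthogonal to them can be added to \<open>d\<close> inside the face,
  so these differences span the whole complement.\<close>

lemma codimension_minimal_face:
  assumes A: "finite A" and d: "\<And>a. a \<in> A \<Longrightarrow> ip d (f a) \<ge> c a"
    and inj: "inj_on f {a\<in>A. ip d (f a) = c a}"
    and indep: "vec.independent (f ` {a\<in>A. ip d (f a) = c a})"
  shows "codimension (minimal_face {x. \<forall>a\<in>A. ip x (f a) \<ge> c a} d) = card {a\<in>A. ip d (f a) = c a}"
proof -
  define T where "T = {a\<in>A. ip d (f a) = c a}"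
  define L where "L = {x. \<forall>b\<in>f ` T. ip x b = 0}"
  define F where "F = {x. (\<forall>a\<in>A. ip x (f a) \<ge> c a) \<and> (\<forall>a\<in>A. ip d (f a) = c a \<longrightarrow> ip x (f a) = c a)}"
  define V where "V = {x - y | x y. x \<in> F \<and> y \<in> F}"
  have "V \<subseteq> L" by (auto simp: V_def L_def T_def F_def)
  moreover have "L \<subseteq> vec.span V"
  proof
    fix x assume "x \<in> L"
    then have x: "ip x (f a) = 0" if "a \<in> A" "ip d (f a) = c a" for a using that by (auto simp: L_def T_def)
    obtain e where e: "e > 0" "\<forall>a\<in>A. ip (d + e *s x) (f a) \<ge> c a"
      using polyhedron_slack[where A = A and d = d and f = f and c = c and x = x] A d x by blast
    have "d + e *s x \<in> F" using e(2) x by (auto simp: F_def)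
    moreover have "d \<in> F" using d by (auto simp: F_def)
    ultimately have "(d + e *s x) - d \<in> V" unfolding V_def by blast
    then have "e *s x \<in> vec.span V" by (intro vec.span_base) simp
    then have "(1 / e) *s (e *s x) \<in> vec.span V" by (rule vec.span_scale)
    then show "x \<in> vec.span V" using e(1) by (simp add: vec.scale_scale)
  qed
  ultimately have dim: "vec.dim V = vec.dim L"
    using vec.dim_subset[of V L] vec.dim_mono[of L V] by simp
  have card: "card (f ` T) = card T" using inj unfolding T_def by (rule card_image)
  have "vec.dim L + card T = CARD('n)"
    unfolding L_def card[symmetric] using dim_orthogonal_complement indep by (simp only: T_def)
  moreover have "minimal_face {x. \<forall>a\<in>A. ip x (f a) \<ge> c a} d = F"
    unfolding F_def by (rule minimal_face_polyhedron[OF A d])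
  then have "codimension (minimal_face {x. \<forall>a\<in>A. ip x (f a) \<ge> c a} d) = CARD('n) - vec.dim L"
    unfolding codimension_def dim[symmetric] V_def vec_dim_card by simp
  ultimately show ?thesis by (simp add: T_def)
qed

end

section \<open>Generators and walls\<close>

context root_system
begin

lemma finite_affine_simple: "finite \<Pi>a"
proof -
  have "\<Pi>a = (\<lambda>b. (b, 0, 0)) ` S \<union> {(- \<theta>, 1, 0)}" by (auto simp: affine_simple_roots_def)
  then show ?thesis using finite_simple by simp
qed

text \<open>The bound is -1 for finite simple roots and -2 for the normal \<open>- \<theta>\<close>,
  so all facets take one form indexed by affine simple roots.\<close>

lemma D_simplex_iff: "D_simplex ip \<Delta> S = {\<tau>. \<forall>a\<in>\<Pi>a. ip \<tau> (fst a) \<ge> -1 - level a}"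
proof (intro Set.set_eqI iffI)
  fix \<tau> assume "\<tau> \<in> D_simplex ip \<Delta> S"
  then show "\<tau> \<in> {\<tau>. \<forall>a\<in>\<Pi>a. ip \<tau> (fst a) \<ge> -1 - level a}"
    by (auto simp: D_simplex_def elim!: affine_simple_cases)
next
  fix \<tau> assume "\<tau> \<in> {\<tau>. \<forall>a\<in>\<Pi>a. ip \<tau> (fst a) \<ge> -1 - level a}"
  then have *: "ip \<tau> (fst a) \<ge> -1 - level a" if "a \<in> \<Pi>a" for a using that by blast
  show "\<tau> \<in> D_simplex ip \<Delta> S"
    using *[OF affine_simpleI(1)] *[OF affine_simpleI(2)] by (simp add: D_simplex_def)
qed

lemma inj_on_fst_affine_simple: "inj_on fst \<Pi>a"
proof -
  have "- \<theta> \<notin> S" using simple_pos uminus_pos_root_iff[OF highest_root(1)] highest_root_pos by blast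
  then show ?thesis by (auto simp: inj_on_def elim!: affine_simple_cases)
qed

text \<open>The relation expressing \<theta> in simple roots has no zero coefficient, so omitting
  any single normal destroys it.\<close>

lemma independent_affine_simple:
  assumes T: "T \<subset> \<Pi>a"
  shows "vec.independent (fst ` T)"
proof (cases "(- \<theta>, 1, 0) \<in> T")
  case False
  have "fst ` T \<subseteq> S"
  proof
    fix x assume "x \<in> fst ` T"
    then obtain a where a: "a \<in> T" "x = fst a" by blast
    then have "a \<in> \<Pi>a" using T by blast
    then show "x \<in> S" using a False by (cases rule: affine_simple_cases) auto
  qed
  then show ?thesis using independent_simple vec.independent_mono by blast
next
  case True
  then obtain b where b: "b \<in> S" "(b, 0, 0) \<notin> T" using T by (auto elim!: affine_simple_cases)
  have sub: "fst ` T \<subseteq> insert (- \<theta>) (S - {b})"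
  proof
    fix x assume "x \<in> fst ` T"
    then obtain a where a: "a \<in> T" "x = fst a" by blast
    then have "a \<in> \<Pi>a" using T by blast
    then show "x \<in> insert (- \<theta>) (S - {b})" using a b(2) by (cases rule: affine_simple_cases) auto
  qed
  have "cf x b = 0" if "x \<in> vec.span (S - {b})" for x
    using that by (induction rule: vec.span_induct_alt) (auto simp: cf_simple)
  moreover have "cf (- \<theta>) b \<noteq> 0" using highest_root_coeff[OF b(1)] by auto
  ultimately have "- \<theta> \<notin> vec.span (S - {b})" by blast
  moreover have "vec.independent (S - {b})" using independent_simple vec.independent_mono by blast
  ultimately have "vec.independent (insert (- \<theta>) (S - {b}))" by (rule vec.independent_insertI)
  then show ?thesis using sub vec.independent_mono by blast
qed

text \<open>The finite walls together would make the pairing of \<open>d\<close> with \<theta> equal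
  to \<open>- ht \<theta>\<close>, which is negative, while the remaining wall requires 2.\<close>

lemma not_all_walls: "{a\<in>\<Pi>a. ip d (fst a) = -1 - level a} \<noteq> \<Pi>a"
proof
  assume "{a\<in>\<Pi>a. ip d (fst a) = -1 - level a} = \<Pi>a"
  then have all: "ip d (fst a) = -1 - level a" if "a \<in> \<Pi>a" for a using that by blast
  have "ip d \<theta> = (\<Sum>b\<in>S. cf \<theta> b * ip d b)"
    by (subst cf_sum[of \<theta>, symmetric]) (simp add: ip_sum_right)
  also have "\<dots> = (\<Sum>b\<in>S. - cf \<theta> b)" using all[OF affine_simpleI(1)] by (intro sum.cong) auto
  finally have "ip d \<theta> = - ht \<theta>" by (simp add: ht_def sum_negf)
  then show False using all[OF affine_simpleI(2)] ht_highest_root_pos by simp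
qed

lemma card_generators:
  assumes I: "ad_nilpotent_ideal \<Delta> S I"
  shows "card (ideal_generators \<Delta> S I) = codimension (minimal_face (D_simplex ip \<Delta> S) (d_ideal ip \<Delta> S I))"
proof -
  define w where "w = admissible_of ip \<Delta> S I"
  define d where "d = d_ideal ip \<Delta> S I"
  define T where "T = {a\<in>\<Pi>a. ip d (fst a) = -1 - level a}"
  have w: "w \<in> adm" "ideal_of \<Delta> S w = I" unfolding w_def using admissible_of[OF I] by auto
  have W: "w \<in> Wa" using w by (auto intro: admissible_Wa)
  have level: "level (winv w a) = ip d (fst a) + level a" if "a \<in> \<Pi>a" for a
    using that
  proof (cases rule: affine_simple_cases)
    case (1 b) then show ?thesis using level_winv[OF W, of b 0] by (simp add: d_def d_ideal_def w_def)
  next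
    case 2 then show ?thesis using level_winv[OF W, of "- \<theta>" 1] by (simp add: d_def d_ideal_def w_def)
  qed
  have d: "ip d (fst a) \<ge> -1 - level a" if a: "a \<in> \<Pi>a" for a
  proof (cases "level (winv w a) < 0")
    case True
    then obtain \<gamma> where "winv w a = (\<gamma>, -1, 0)" by (rule admissible_simple_level[OF w(1) a])
    then show ?thesis using level[OF a] by simp
  next
    case False then show ?thesis using level[OF a] by simp
  qed
  have "bij_betw (\<lambda>\<gamma>. w (\<gamma>, -1, 0)) (ideal_generators \<Delta> S I) T"
  proof (intro bij_betw_imageI inj_onI Set.set_eqI iffI)
    fix \<gamma> \<mu> assume "w (\<gamma>, -1, 0) = w (\<mu>, -1, 0)"
    then show "\<gamma> = \<mu>" using Wa_eq_iff[OF W, of "(\<gamma>, -1, 0)" "(\<mu>, -1, 0)"] by simp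
  next
    fix a assume "a \<in> (\<lambda>\<gamma>. w (\<gamma>, -1, 0)) ` ideal_generators \<Delta> S I"
    then obtain \<gamma> where g: "\<gamma> \<in> ideal_generators \<Delta> S I" "a = w (\<gamma>, -1, 0)" by blast
    have a: "a \<in> \<Pi>a" unfolding g(2) by (rule generator_imp_simple[OF w(1) I w(2) g(1)])
    have "winv w a = (\<gamma>, -1, 0)" using W g(2) by simp
    then show "a \<in> T" using level[OF a] a by (simp add: T_def)
  next
    fix a assume "a \<in> T"
    then have a: "a \<in> \<Pi>a" and "level (winv w a) < 0" using level[of a] by (auto simp: T_def)
    then obtain \<gamma> where g: "\<gamma> \<in> I" "winv w a = (\<gamma>, -1, 0)"
      using admissible_simple_level[OF w(1)] w(2) by blast
    then have wa: "w (\<gamma>, -1, 0) = a" using winv_right[OF W, of a] by simp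
    then have "\<gamma> \<in> ideal_generators \<Delta> S I" using simple_imp_generator[OF w(1,2) _ g(1)] a by simp
    then show "a \<in> (\<lambda>\<gamma>. w (\<gamma>, -1, 0)) ` ideal_generators \<Delta> S I" using wa by blast
  qed
  then have "card (ideal_generators \<Delta> S I) = card T" by (rule bij_betw_same_card)
  moreover have "T \<subset> \<Pi>a" using not_all_walls[of d] by (auto simp: T_def)
  then have "vec.independent (fst ` T)" "inj_on fst T"
    using independent_affine_simple inj_on_fst_affine_simple inj_on_subset by blast+
  then have "codimension (minimal_face (D_simplex ip \<Delta> S) d) = card T"
    unfolding D_simplex_iff T_def by (intro codimension_minimal_face finite_affine_simple d)
  ultimately show ?thesis by (simp add: d_def)
qed

end

theorem theorem2p9:
  fixes ip :: "rat ^ 'n::finite \<Rightarrow> rat ^ 'n \<Rightarrow> rat"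
    and \<Delta> S I :: "(rat ^ 'n) set"
  assumes "irreducible_root_system ip \<Delta>"
    and "simple_system \<Delta> S"
    and "ad_nilpotent_ideal \<Delta> S I"
  shows "card (ideal_generators \<Delta> S I) =
         codimension (minimal_face (D_simplex ip \<Delta> S) (d_ideal ip \<Delta> S I))"
proof -
  interpret root_system ip \<Delta> S
    by unfold_locales (use assms in \<open>simp_all add: irreducible_root_system_def\<close>)
  show ?thesis using assms(3) by (rule card_generators)
qed

end
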